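(* Let $d\ge1$ and let $\Gamma$ be a finite graph with $v\ge d+2$ vertices and $e$ edges that is generically locally rigid in $\mathbb{E}^d$. Let $M=\ell(C^d(\Gamma))\subset\mathbb{R}^e$ be the measurement set, let $t=vd-\binom{d+1}{2}=\dim M$, and let $G:M\dashrightarrow\mathrm{Gr}(t,e)$ be the Gauss map of $M$. Then the maps $G$ and $G\circ\ell$ both have rank $vd-k_{\mathrm{sh}}d$, where $k_{\mathrm{sh}}=k_{\mathrm{sh}}(\Gamma,d)$ is the shared stress nullity.
   Context: A graph $\Gamma$ has a finite vertex set $\mathcal V$ and an edge set $\mathcal E$ of two-element subsets of $\mathcal V$. A framework $\rho$ of $\Gamma$ in $\mathbb{E}^d$ is a map $\mathcal V\to\mathbb{E}^d$; $C^d(\Gamma)\cong\mathbb{R}^{vd}$ is the space of all of them. $\ell:C^d(\Gamma)\to\mathbb{R}^e$ has component $|\rho(u)-\rho(w)|^2$ at the edge $\{u,w\}$. $\rho$ is generic if its $vd$ coordinates satisfy no non-trivial polynomial equation with rational coefficients. $\Gamma$ (with $v\ge d+1$) is generically locally rigid in $\mathbb{E}^d$ if generic frameworks $\rho\in C^d(\Gamma)$ are locally rigid, i.e. $\rho$ has a neighborhood in $C^d(\Gamma)$ in which every framework with the same edge lengths as $\rho$ is congruent to $\rho$; equivalently, $\operatorname{rank}d\ell_\rho=vd-\binom{d+1}{2}$ for generic $\rho$. $M$ is a semi-algebraic set of dimension $t$; a point of $M$ is smooth if it has a neighborhood in $M$ smoothly isomorphic to $\mathbb{R}^{t}$. The Gauss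 map $G$ sends each smooth point of $M$ to its tangent space, a point in the Grassmannian $\mathrm{Gr}(t,e)$ of $t$-dimensional linear subspaces of $\mathbb{R}^e$; it is a rational map, defined on a Zariski open subset of $M$. The rank of a rational map is the rank of its linearization at generic points of the domain (the maximal rank of its linearization); equivalently the dimension of its image. An equilibrium stress matrix of $\rho$ is a real symmetric matrix $\Omega$ indexed by $\mathcal V\times\mathcal V$ with $\Omega(u,w)=0$ whenever $u\ne w$ and $\{u,w\}\notin\mathcal E$, with $\sum_{w}\Omega(u,w)=0$ for all $u$, and with $\sum_{w}\Omega(u,w)\rho(w)=0$ for all $u$. $S(\rho)$ is the space of equilibrium stress matrices of $\rho$, and $k_{\mathrm{sh}}(\Gamma,d)=\dim\bigcap_{\Omega\in S(\rho)}\ker\Omega$ for a generic $\rho\in C^d(\Gamma)$ (independent of the generic $\rho$). *)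

theory Defs
  imports "HOL-Analysis.Analysis"
begin

subsection \<open>Graphs, frameworks and stresses\<close>

text \<open>
  The vertex set is the finite type \<open>'v\<close>.  The edges are labelled bijectively by the finite type
  \<open>'e\<close>, which identifies the space of edge measurements with \<open>real^'e\<close>; the edge set itself is
  \<open>range edge\<close>.
\<close>

definition simple_graph :: "('e \<Rightarrow> 'v set) \<Rightarrow> bool" where
  "simple_graph edge \<longleftrightarrow> inj edge \<and> (\<forall>i. card (edge i) = 2)"

type_synonym ('v, 'd) framework = "real^'d^'v"

text \<open>The value described by \<open>THE\<close> is unique since the norm is symmetric in \<open>u\<close> and \<open>w\<close>.\<close>

definition length_map :: "('e::finite \<Rightarrow> 'v set) \<Rightarrow> ('v::finite, 'd::finite) framework \<Rightarrow> real^'e" where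
  "length_map edge \<rho> = (\<chi> i. THE r. \<exists>u w. edge i = {u, w} \<and> r = (norm (\<rho> $ u - \<rho> $ w))\<^sup>2)"

lemma length_map_edge:
  assumes "edge i = {u, w}"
  shows "length_map edge \<rho> $ i = (norm (\<rho> $ u - \<rho> $ w))\<^sup>2"
  unfolding length_map_def vec_lambda_beta
proof (rule the_equality)
  show "\<exists>u' w'. edge i = {u', w'} \<and> (norm (\<rho> $ u - \<rho> $ w))\<^sup>2 = (norm (\<rho> $ u' - \<rho> $ w'))\<^sup>2"
    using assms by blast
next
  fix r assume "\<exists>u' w'. edge i = {u', w'} \<and> r = (norm (\<rho> $ u' - \<rho> $ w'))\<^sup>2"
  then show "r = (norm (\<rho> $ u - \<rho> $ w))\<^sup>2"
    using assms by (auto simp: doubleton_eq_iff norm_minus_commute)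
qed

text \<open>
  A polynomial in the coordinates indexed by \<open>'v \<times> 'd\<close> is given by its finitely supported family
  of rational coefficients, indexed by exponent vectors.
\<close>

definition generic :: "('v::finite, 'd::finite) framework \<Rightarrow> bool" where
  "generic \<rho> \<longleftrightarrow>
    (\<forall>p :: ('v \<times> 'd \<Rightarrow> nat) \<Rightarrow> rat. finite {m. p m \<noteq> 0} \<longrightarrow>
      (\<Sum>m | p m \<noteq> 0. of_rat (p m) * (\<Prod>c\<in>UNIV. (\<rho> $ fst c $ snd c) ^ m c)) = 0 \<longrightarrow>
      (\<forall>m. p m = 0))"

definition congruent_frameworks ::
    "('v::finite, 'd::finite) framework \<Rightarrow> ('v, 'd) framework \<Rightarrow> bool" where
  "congruent_frameworks \<rho> \<sigma> \<longleftrightarrow>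
    (\<exists>h :: real^'d \<Rightarrow> real^'d. (\<forall>x y. dist (h x) (h y) = dist x y) \<and> (\<forall>u. \<sigma> $ u = h (\<rho> $ u)))"

definition locally_rigid :: "('e::finite \<Rightarrow> 'v set) \<Rightarrow> ('v::finite, 'd::finite) framework \<Rightarrow> bool" where
  "locally_rigid edge \<rho> \<longleftrightarrow>
    (\<exists>N. open N \<and> \<rho> \<in> N \<and>
      (\<forall>\<sigma>\<in>N. length_map edge \<sigma> = length_map edge \<rho> \<longrightarrow> congruent_frameworks \<rho> \<sigma>))"

definition generically_locally_rigid ::
    "('e::finite \<Rightarrow> 'v::finite set) \<Rightarrow> 'd::finite itself \<Rightarrow> bool" where
  "generically_locally_rigid edge (_ :: 'd itself) \<longleftrightarrow>
    (\<forall>\<rho> :: ('v, 'd) framework. generic \<rho> \<longrightarrow> locally_rigid edge \<rho>)"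

definition stress_matrices ::
    "('e \<Rightarrow> 'v set) \<Rightarrow> ('v::finite, 'd::finite) framework \<Rightarrow> (real^'v^'v) set" where
  "stress_matrices edge \<rho> = {\<Omega>.
     transpose \<Omega> = \<Omega> \<and>
     (\<forall>u w. u \<noteq> w \<and> {u, w} \<notin> range edge \<longrightarrow> \<Omega> $ u $ w = 0) \<and>
     (\<forall>u. (\<Sum>w\<in>UNIV. \<Omega> $ u $ w) = 0) \<and>
     (\<forall>u. (\<Sum>w\<in>UNIV. (\<Omega> $ u $ w) *\<^sub>R (\<rho> $ w)) = 0)}"

definition shared_stress_kernel ::
    "('e \<Rightarrow> 'v set) \<Rightarrow> ('v::finite, 'd::finite) framework \<Rightarrow> (real^'v) set" where
  "shared_stress_kernel edge \<rho> = (\<Inter>\<Omega>\<in>stress_matrices edge \<rho>. {x. \<Omega> *v x = 0})"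

text \<open>The common value of the dimension over all generic frameworks.\<close>

definition shared_stress_nullity :: "('e \<Rightarrow> 'v::finite set) \<Rightarrow> 'd::finite itself \<Rightarrow> nat" where
  "shared_stress_nullity edge (_ :: 'd itself) =
    (THE k. \<forall>\<rho> :: ('v, 'd) framework. generic \<rho> \<longrightarrow> dim (shared_stress_kernel edge \<rho>) = k)"

subsection \<open>Smooth points, tangent spaces and the Gauss map\<close>

primrec times_differentiable_on ::
    "nat \<Rightarrow> 'a::real_normed_vector set \<Rightarrow> ('a \<Rightarrow> 'b::real_normed_vector) \<Rightarrow> bool" where
  "times_differentiable_on 0 S f \<longleftrightarrow> continuous_on S f"
| "times_differentiable_on (Suc k) S f \<longleftrightarrow>
    (\<forall>x\<in>S. f differentiable (at x)) \<and>
    (\<forall>v. times_differentiable_on k S (\<lambda>x. frechet_derivative f (at x) v))"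

text \<open>Only meant for open \<open>S\<close> in a finite-dimensional space.\<close>

definition smooth_map_on ::
    "'a::real_normed_vector set \<Rightarrow> ('a \<Rightarrow> 'b::real_normed_vector) \<Rightarrow> bool" where
  "smooth_map_on S f \<longleftrightarrow> (\<forall>k. times_differentiable_on k S f)"

text \<open>
  The point \<open>x\<close> of \<open>M\<close> has a neighbourhood \<open>U\<close> in \<open>M\<close> smoothly isomorphic to a \<open>t\<close>-dimensional
  Euclidean space, realised here as a \<open>t\<close>-dimensional linear subspace \<open>L\<close> of the ambient space.
  As usual for subsets of Euclidean space, smoothness of the chart \<open>f\<close> and of its inverse \<open>g\<close>
  means that they extend smoothly to open sets (for \<open>f\<close>, precomposition with a projection onto
  \<open>L\<close> gives an extension to the whole space).
\<close>

definition smooth_point :: "nat \<Rightarrow> 'a::euclidean_space set \<Rightarrow> 'a \<Rightarrow> bool" where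
  "smooth_point t M x \<longleftrightarrow>
    (\<exists>U L W (f :: 'a \<Rightarrow> 'a) (g :: 'a \<Rightarrow> 'a).
       x \<in> U \<and> openin (top_of_set M) U \<and>
       subspace L \<and> dim L = t \<and> open W \<and> U \<subseteq> W \<and>
       smooth_map_on UNIV f \<and> smooth_map_on W g \<and>
       f ` L = U \<and> (\<forall>y\<in>L. g (f y) = y))"

text \<open>The dimension of a nonempty semi-algebraic set.\<close>

definition semialgebraic_dim :: "'a::euclidean_space set \<Rightarrow> nat" where
  "semialgebraic_dim M = Max {t. \<exists>x. smooth_point t M x}"

text \<open>Velocities of curves in \<open>M\<close>; at a smooth point this is the usual tangent space.\<close>

definition tangent_space :: "'a::real_normed_vector set \<Rightarrow> 'a \<Rightarrow> 'a set" where
  "tangent_space M x =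
    {\<gamma>'. \<exists>\<gamma>. \<gamma> 0 = x \<and> (\<forall>\<^sub>F s in nhds (0::real). \<gamma> s \<in> M) \<and> (\<gamma> has_vector_derivative \<gamma>') (at 0)}"

definition gauss_map :: "(real^'e::finite) set \<Rightarrow> real^'e \<Rightarrow> (real^'e) set" where
  "gauss_map M x = tangent_space M x"

text \<open>
  The Grassmannian of \<open>t\<close>-dimensional subspaces of \<open>real^'e\<close> carries its smooth structure through
  the embedding that sends a subspace to the matrix of the orthogonal projection onto it.
\<close>

definition projection_matrix :: "(real^'e::finite) set \<Rightarrow> real^'e^'e" where
  "projection_matrix V = matrix (closest_point V)"

text \<open>
  The rank of a map \<open>F\<close> from \<open>N\<close> to the Grassmannian: the maximal rank of its linearization
  \<open>T\<^sub>x N \<Rightarrow> T\<^bsub>F x\<^esub> Gr\<close>.  The embedding above is an immersion, so composing with it does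
  not change the rank; the restriction of \<open>D\<close> to the tangent space of \<open>N\<close> is determined by
  \<open>F\<close>, although \<open>D\<close> itself need not be.
\<close>

definition grassmannian_map_rank ::
    "'a::euclidean_space set \<Rightarrow> ('a \<Rightarrow> (real^'e::finite) set) \<Rightarrow> nat" where
  "grassmannian_map_rank N F =
    Max {dim (D ` tangent_space N x) | x D.
      x \<in> N \<and> ((\<lambda>y. projection_matrix (F y)) has_derivative D) (at x within N)}"

end

theory Submission
  imports Defs
begin

text \<open>
  Write \<open>R\<^sub>\<rho>(\<sigma>)\<close> for the vector of the \<open>(\<rho>\<^sub>u - \<rho>\<^sub>w) \<bullet> (\<sigma>\<^sub>u - \<sigma>\<^sub>w)\<close> over the edges, so that
  \<open>d\<ell>\<^sub>\<rho> = 2 R\<^sub>\<rho>\<close>.  A generic point maximises the rank of every matrix of rational polynomials.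
  Hence near a generic \<open>\<rho>\<close> the fibres of \<open>\<ell>\<close> are manifolds tangent to \<open>ker R\<^sub>\<rho>\<close>, local rigidity makes this
  kernel equal to that of the complete graph, and \<open>R\<^sub>\<rho>\<close> has rank \<open>t\<close>.

  Every framework is congruent to one in a fixed linear subspace \<open>P\<close> of dimension \<open>t\<close> (by polar
  decomposition), so \<open>M\<close> is the image of \<open>P\<close>.  The Sard theorem for maps between spaces of equal
  dimension provides regular values of \<open>\<ell>\<close> on \<open>P\<close> in every open piece of \<open>M\<close>; the fibre over such
  a value is finite, and \<open>M\<close> is nearby a finite union of closed embedded discs.  One of the discs
  has interior in \<open>M\<close>, so the smooth \<open>t\<close>-dimensional points are dense in \<open>M\<close>.

  At the image of a generic \<open>\<rho>\<close> the tangent space is \<open>im R\<^sub>\<rho>\<close>.  Differentiating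
  \<open>\<Pi>\<^sub>\<sigma> R\<^sub>\<sigma>(\<mu>) = R\<^sub>\<sigma>(\<mu>)\<close>, where \<open>\<Pi>\<^sub>\<sigma>\<close> projects onto the tangent space at \<open>\<ell>(\<sigma>)\<close>, shows that
  \<open>\<tau>\<close> is in the kernel of the derivative of \<open>G \<circ> \<ell>\<close> iff \<open>R\<^sub>\<tau>(\<mu>) \<in> im R\<^sub>\<rho>\<close> for all \<open>\<mu>\<close>, i.e. iff every
  coordinate of \<open>\<tau>\<close> is annihilated by all stress matrices of \<open>\<rho>\<close>.  This kernel has dimension
  \<open>k\<^sub>s\<^sub>h d\<close>.  At the other smooth points the rank is bounded by semicontinuity.
\<close>

section \<open>Smooth maps\<close>

text \<open>Genericity is a condition on \<rho>, smoothness one on the point \<ell>(\<rho>) of M,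
  where the images of distant frameworks may meet. The proof never decides whether every generic
  \<rho> maps to a smooth point. Once the smooth locus is known to be open and dense in M, its
  preimage under \<ell> is open and nonempty, and density of the generic frameworks supplies one
  inside it. Sard, properness and a finite cover thus carry the weight that a semialgebraic
  stratification of M would otherwise carry.

  Properness of \<ell> on P comes from connectedness of the graph: translating a component that
  misses \<open>w0\<close> would contradict local rigidity. It makes fibres compact and images of
  closed sets closed.

  M has no interior in R^e when t < e. Therefore M is compared with a linear space T = im R_\<rho>
  by orthogonal projection, thickened by the identity on the complement of T, so that "negligible"
  and "open" refer to R^e itself. The same comparison bounds the rank of R_\<rho> by dim P.

  A derivative within M is not unique off the tangent space; ranks are computed after pulling back
  to charts extended to all of R^e.\<close>

lemma times_differentiable_on_cong:
  assumes "open S" "\<And>x. x \<in> S \<Longrightarrow> f x = g x"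
  shows "times_differentiable_on k S f \<longleftrightarrow> times_differentiable_on k S g"
  using assms
proof (induction k arbitrary: f g)
  case 0
  then show ?case by (simp cong: continuous_on_cong)
next
  case (Suc k)
  have der: "(f has_derivative D) (at x) \<longleftrightarrow> (g has_derivative D) (at x)" if "x \<in> S" for x D
    using has_derivative_transform_within_open[OF _ \<open>open S\<close> that, of f D UNIV g]
      has_derivative_transform_within_open[OF _ \<open>open S\<close> that, of g D UNIV f] Suc.prems by auto
  then have "f differentiable (at x) \<longleftrightarrow> g differentiable (at x)" if "x \<in> S" for x
    using that by (simp add: differentiable_def)
  moreover have "frechet_derivative f (at x) = frechet_derivative g (at x)" if "x \<in> S" for x
    using der[OF that] by (simp add: frechet_derivative_def)
  then have "times_differentiable_on k S (\<lambda>x. frechet_derivative f (at x) v) \<longleftrightarrow>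
      times_differentiable_on k S (\<lambda>x. frechet_derivative g (at x) v)" for v
    by (intro Suc.IH[OF \<open>open S\<close>]) simp
  ultimately show ?case
    by simp
qed

text \<open>Derivatives at points of an open set are unique, so the closure lemmas below may exhibit
  an explicit derivative and never have to compute \<open>frechet_derivative\<close>.\<close>

lemma times_differentiable_on_SucI:
  assumes "open S" "\<And>x. x \<in> S \<Longrightarrow> (f has_derivative f' x) (at x)"
    "\<And>v. times_differentiable_on k S (\<lambda>x. f' x v)"
  shows "times_differentiable_on (Suc k) S f"
proof -
  have "frechet_derivative f (at x) = f' x" if "x \<in> S" for x
    using assms(2)[OF that] by (metis frechet_derivative_at)
  then have "times_differentiable_on k S (\<lambda>x. frechet_derivative f (at x) v)" for v
    using assms(3)[of v] times_differentiable_on_cong[OF \<open>open S\<close>,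
        of "\<lambda>x. frechet_derivative f (at x) v" "\<lambda>x. f' x v"] by simp
  then show ?thesis
    using assms(2) by (auto simp: differentiable_def)
qed

lemma times_differentiable_on_SucD:
  assumes "times_differentiable_on (Suc k) S f"
  shows "x \<in> S \<Longrightarrow> (f has_derivative frechet_derivative f (at x)) (at x)"
    and "times_differentiable_on k S (\<lambda>x. frechet_derivative f (at x) v)"
  using assms by (auto simp: frechet_derivative_works)

lemma times_differentiable_on_mono_Suc:
  "times_differentiable_on (Suc k) S f \<Longrightarrow> times_differentiable_on k S f"
proof (induction k arbitrary: f)
  case 0
  then show ?case
    by (auto intro!: continuous_at_imp_continuous_on differentiable_imp_continuous_within)
next
  case (Suc k)
  show ?case
    unfolding times_differentiable_on.simps(2)[of k]
    using Suc.IH Suc.prems by (simp only: times_differentiable_on.simps(2)[of "Suc k"]) blast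
qed

lemma times_differentiable_on_imp_continuous_on:
  "times_differentiable_on k S f \<Longrightarrow> continuous_on S f"
proof (induction k)
  case (Suc k)
  then show ?case using times_differentiable_on_mono_Suc[OF Suc.prems] by simp
qed simp

lemma times_differentiable_on_subset:
  "times_differentiable_on k S f \<Longrightarrow> T \<subseteq> S \<Longrightarrow> times_differentiable_on k T f"
  by (induction k arbitrary: f) (auto intro: continuous_on_subset)

section \<open>Closure properties of k times differentiable maps\<close>

lemma times_differentiable_on_const: "open S \<Longrightarrow> times_differentiable_on k S (\<lambda>x. c)"
proof (induction k arbitrary: c)
  case (Suc k)
  show ?case
    by (rule times_differentiable_on_SucI[OF \<open>open S\<close> has_derivative_const Suc.IH[OF \<open>open S\<close>]])
qed simp

lemma times_differentiable_on_linear: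
  assumes "open S" "bounded_linear h" "times_differentiable_on k S f"
  shows "times_differentiable_on k S (\<lambda>x. h (f x))"
  using assms(3)
proof (induction k arbitrary: f)
  case 0
  then show ?case
    using bounded_linear.continuous_on[OF assms(2)] by simp
next
  case (Suc k)
  note D = times_differentiable_on_SucD[OF Suc.prems]
  show ?case
    by (rule times_differentiable_on_SucI[OF \<open>open S\<close> bounded_linear.has_derivative[OF assms(2) D(1)]])
      (use Suc.IH[OF D(2)] in auto)
qed

lemma times_differentiable_on_ident_linear:
  assumes "open S" "bounded_linear h"
  shows "times_differentiable_on k S h"
proof (cases k)
  case 0
  then show ?thesis using linear_continuous_on[OF assms(2)] by simp
next
  case (Suc n)
  show ?thesis
    unfolding Suc
    by (rule times_differentiable_on_SucI[OF \<open>open S\<close> bounded_linear_imp_has_derivative[OF assms(2)]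
        times_differentiable_on_const[OF \<open>open S\<close>]])
qed

lemma times_differentiable_on_add:
  assumes "open S" "times_differentiable_on k S f" "times_differentiable_on k S g"
  shows "times_differentiable_on k S (\<lambda>x. f x + g x)"
  using assms(2,3)
proof (induction k arbitrary: f g)
  case 0
  then show ?case by (simp add: continuous_on_add)
next
  case (Suc k)
  note D = times_differentiable_on_SucD[OF Suc.prems(1)] times_differentiable_on_SucD[OF Suc.prems(2)]
  show ?case
    by (rule times_differentiable_on_SucI[OF \<open>open S\<close> has_derivative_add[OF D(1) D(3)]])
      (use Suc.IH[OF D(2) D(4)] in auto)
qed

lemma times_differentiable_on_sum:
  assumes "open S" "\<And>i. i \<in> I \<Longrightarrow> times_differentiable_on k S (f i)"
  shows "times_differentiable_on k S (\<lambda>x. \<Sum>i\<in>I. f i x)"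
proof (cases "finite I")
  case True
  then show ?thesis
    using assms(2) by (induction I)
      (auto intro: times_differentiable_on_const[OF \<open>open S\<close>] times_differentiable_on_add[OF \<open>open S\<close>])
qed (simp add: times_differentiable_on_const[OF \<open>open S\<close>])

text \<open>The product rule gives two terms of the same bilinear shape, each with one factor
  differentiated and the other merely lowered by one order; hence the induction runs over all
  \<open>f\<close> and \<open>g\<close>.\<close>

lemma times_differentiable_on_bilinear:
  assumes "open S" "bounded_bilinear h" "times_differentiable_on k S f" "times_differentiable_on k S g"
  shows "times_differentiable_on k S (\<lambda>x. h (f x) (g x))"
  using assms(3,4)
proof (induction k arbitrary: f g)
  case 0
  then show ?case by (simp add: bounded_bilinear.continuous_on[OF assms(2)])
next
  case (Suc k)
  note D = times_differentiable_on_SucD[OF Suc.prems(1)] times_differentiable_on_SucD[OF Suc.prems(2)]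
  note mono = Suc.prems[THEN times_differentiable_on_mono_Suc]
  show ?case
    by (rule times_differentiable_on_SucI[OF \<open>open S\<close> bounded_bilinear.FDERIV[OF assms(2) D(1) D(3)]])
      (auto intro!: times_differentiable_on_add \<open>open S\<close> Suc.IH[OF D(2) mono(2)] Suc.IH[OF mono(1) D(4)])
qed

lemmas times_differentiable_on_mult =
  times_differentiable_on_bilinear[OF _ bounded_bilinear_mult]
lemmas times_differentiable_on_scaleR =
  times_differentiable_on_bilinear[OF _ bounded_bilinear_scaleR]

lemma times_differentiable_on_prod:
  fixes f :: "'i \<Rightarrow> 'a::real_normed_vector \<Rightarrow> real"
  assumes "open S" "\<And>i. i \<in> I \<Longrightarrow> times_differentiable_on k S (f i)"
  shows "times_differentiable_on k S (\<lambda>x. \<Prod>i\<in>I. f i x)"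
proof (cases "finite I")
  case True
  then show ?thesis
    using assms(2) by (induction I)
      (auto intro: times_differentiable_on_const[OF \<open>open S\<close>] times_differentiable_on_mult[OF \<open>open S\<close>])
qed (simp add: times_differentiable_on_const[OF \<open>open S\<close>])

lemma times_differentiable_on_components:
  fixes f :: "'a::real_normed_vector \<Rightarrow> 'b::euclidean_space"
  assumes "open S" "\<And>b. b \<in> Basis \<Longrightarrow> times_differentiable_on k S (\<lambda>x. f x \<bullet> b)"
  shows "times_differentiable_on k S f"
proof -
  have "times_differentiable_on k S (\<lambda>x. \<Sum>b\<in>Basis. (f x \<bullet> b) *\<^sub>R b)"
    by (intro times_differentiable_on_sum times_differentiable_on_linear[OF \<open>open S\<close>
        bounded_linear_scaleR_left] assms)
  then show ?thesis by (simp add: euclidean_representation)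
qed

lemma times_differentiable_on_compose:
  fixes f :: "'b::euclidean_space \<Rightarrow> 'c::real_normed_vector" and g :: "'a::real_normed_vector \<Rightarrow> 'b"
  assumes "open S" "times_differentiable_on k T f" "times_differentiable_on k S g" "g ` S \<subseteq> T"
  shows "times_differentiable_on k S (\<lambda>x. f (g x))"
  using assms(2,3)
proof (induction k arbitrary: f)
  case 0
  then show ?case
    using continuous_on_compose2[of T f S g] assms(4) by auto
next
  case (Suc k)
  note D = times_differentiable_on_SucD[OF Suc.prems(1)] times_differentiable_on_SucD[OF Suc.prems(2)]
  let ?f' = "\<lambda>y. frechet_derivative f (at y)" and ?g' = "\<lambda>x. frechet_derivative g (at x)"
  show ?case
  proof (rule times_differentiable_on_SucI[OF \<open>open S\<close>])
    fix x assume x: "x \<in> S"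
    have gx: "g x \<in> T" using assms(4) x by blast
    have lin: "linear (?f' (g x))"
      using D(1)[OF gx] has_derivative_linear by blast
    have "((\<lambda>x. f (g x)) has_derivative (\<lambda>v. ?f' (g x) (?g' x v))) (at x)"
      using has_derivative_compose[OF D(3)[OF x] D(1)[OF gx]] .
    \<comment> \<open>The induction hypothesis treats derivatives of \<open>f\<close> in a fixed
      direction only, but here the direction moves with \<open>x\<close>. Expanding it in the basis
      makes the directions constant and the coefficients smooth.\<close>
    moreover have "?f' (g x) (?g' x v) = (\<Sum>b\<in>Basis. (?g' x v \<bullet> b) *\<^sub>R ?f' (g x) b)" for v
      by (subst euclidean_representation[symmetric, of "?g' x v"])
        (simp add: linear_sum[OF lin] linear_scale[OF lin])
    ultimately show "((\<lambda>x. f (g x)) has_derivative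
        (\<lambda>v. \<Sum>b\<in>Basis. (?g' x v \<bullet> b) *\<^sub>R ?f' (g x) b)) (at x)"
      by simp
  next
    fix v
    show "times_differentiable_on k S (\<lambda>x. \<Sum>b\<in>Basis. (?g' x v \<bullet> b) *\<^sub>R ?f' (g x) b)"
      using Suc.IH[OF D(2) times_differentiable_on_mono_Suc[OF Suc.prems(2)]] D(4)[of v]
      by (intro times_differentiable_on_sum times_differentiable_on_scaleR \<open>open S\<close>
          times_differentiable_on_linear[OF \<open>open S\<close> bounded_linear_inner_left])
  qed
qed

text \<open>With s = f^(-1/2) the derivative is -(1/2) s^3 f', a polynomial in s and f', so the
  induction closes. This one function yields both reciprocals and the ball charts.\<close>

lemma times_differentiable_on_inverse_sqrt:
  fixes f :: "'a::real_normed_vector \<Rightarrow> real"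
  assumes "open S" "times_differentiable_on k S f" "\<And>x. x \<in> S \<Longrightarrow> f x > 0"
  shows "times_differentiable_on k S (\<lambda>x. inverse (sqrt (f x)))"
  using assms(2)
proof (induction k)
  case 0
  have "inverse (sqrt (f x)) \<noteq> 0" if "x \<in> S" for x using assms(3)[OF that] by simp
  then show ?case
    using 0 assms(3) by (auto intro!: continuous_intros)
next
  case (Suc k)
  note D = times_differentiable_on_SucD[OF Suc.prems]
  let ?f' = "\<lambda>x. frechet_derivative f (at x)"
  let ?s = "\<lambda>x. inverse (sqrt (f x))"
  note IH = Suc.IH[OF times_differentiable_on_mono_Suc[OF Suc.prems]]
  show ?case
  proof (rule times_differentiable_on_SucI[OF \<open>open S\<close>])
    fix x assume x: "x \<in> S"
    have "((\<lambda>y. inverse (sqrt y)) has_field_derivative (- 1 / 2) * (?s x * (?s x * ?s x))) (at (f x))"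
      using assms(3)[OF x]
      by (auto intro!: derivative_eq_intros simp: power2_eq_square field_simps)
    from has_derivative_compose[OF D(1)[OF x] this[unfolded has_field_derivative_def]]
    show "(?s has_derivative (\<lambda>v. (- 1 / 2) * (?s x * (?s x * ?s x)) * ?f' x v)) (at x)" .
  next
    fix v
    show "times_differentiable_on k S (\<lambda>x. (- 1 / 2) * (?s x * (?s x * ?s x)) * ?f' x v)"
      by (intro times_differentiable_on_mult \<open>open S\<close> IH D(2) times_differentiable_on_const)
  qed
qed

text \<open>1/f = f * s^2 with s = (f^2)^(-1/2), which reduces an arbitrary sign to a positive
  radicand.\<close>

lemma times_differentiable_on_inverse:
  fixes f :: "'a::real_normed_vector \<Rightarrow> real"
  assumes "open S" "times_differentiable_on k S f" "\<And>x. x \<in> S \<Longrightarrow> f x \<noteq> 0"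
  shows "times_differentiable_on k S (\<lambda>x. inverse (f x))"
proof -
  let ?s = "\<lambda>x. inverse (sqrt (f x * f x))"
  have "times_differentiable_on k S ?s"
    using assms(3) by (intro times_differentiable_on_inverse_sqrt assms times_differentiable_on_mult)
      (auto simp: zero_less_mult_iff linorder_neq_iff)
  then have "times_differentiable_on k S (\<lambda>x. f x * (?s x * ?s x))"
    by (intro times_differentiable_on_mult assms)
  moreover have "f x * (?s x * ?s x) = inverse (f x)" for x
  proof -
    have "?s x * ?s x = inverse (f x) * inverse (f x)"
      by (simp flip: inverse_mult_distrib)
    then show ?thesis by (cases "f x = 0") simp_all
  qed
  ultimately show ?thesis by simp
qed

section \<open>Determinants, inverses and products of matrices with smooth entries\<close>

lemma matrix_inv_inverse:
  fixes A :: "'a::semiring_1^'n^'n"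
  assumes "invertible A"
  shows "A ** matrix_inv A = mat 1" "matrix_inv A ** A = mat 1"
  using someI_ex[OF assms[unfolded invertible_def]] by (auto simp: matrix_inv_def)

lemma times_differentiable_on_det:
  fixes A :: "'a::real_normed_vector \<Rightarrow> real^'n^'n"
  assumes "open S" "\<And>i j. times_differentiable_on k S (\<lambda>x. A x $ i $ j)"
  shows "times_differentiable_on k S (\<lambda>x. det (A x))"
  unfolding det_def
  by (intro times_differentiable_on_sum times_differentiable_on_mult times_differentiable_on_prod
      times_differentiable_on_const assms)

lemma times_differentiable_on_matrix_inv:
  fixes A :: "'a::real_normed_vector \<Rightarrow> real^'n^'n"
  assumes "open S" "\<And>i j. times_differentiable_on k S (\<lambda>x. A x $ i $ j)"
    "\<And>x. x \<in> S \<Longrightarrow> invertible (A x)"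
  shows "times_differentiable_on k S (\<lambda>x. matrix_inv (A x) $ i $ j)"
proof -
  \<comment> \<open>Cramer's rule: \<open>?C x\<close> is \<open>A x\<close> with column
    \<open>i\<close> replaced by the unit vector \<open>axis j 1\<close>, so each entry of the
    inverse is a quotient of determinants.\<close>
  let ?C = "\<lambda>x. \<chi> i' j'. if j' = i then (if i' = j then 1 else 0) else A x $ i' $ j'"
  have eq: "matrix_inv (A x) $ i $ j = det (?C x) * inverse (det (A x))" if "x \<in> S" for x
  proof -
    have inv: "invertible (A x)" by (rule assms(3)[OF that])
    have "A x *v (matrix_inv (A x) *v axis j 1) = axis j 1"
      by (simp add: matrix_vector_mul_assoc matrix_inv_inverse[OF inv])
    then have "matrix_inv (A x) *v axis j 1
        = (\<chi> k. det (\<chi> i' j'. if j' = k then axis j 1 $ i' else A x $ i' $ j') / det (A x))"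
      using cramer inv invertible_det_nz by blast
    then have "(matrix_inv (A x) *v axis j 1) $ i
        = det (\<chi> i' j'. if j' = i then axis j 1 $ i' else A x $ i' $ j') / det (A x)"
      by simp
    moreover have "(matrix_inv (A x) *v axis j 1) $ i = matrix_inv (A x) $ i $ j"
      by (simp add: matrix_vector_mul_component inner_axis)
    ultimately show ?thesis by (simp add: axis_def divide_inverse cong: if_cong)
  qed
  have "times_differentiable_on k S (\<lambda>x. ?C x $ i' $ j')" for i' j'
    using assms(2)[of i' j'] by (cases "j' = i") (simp_all add: times_differentiable_on_const assms(1))
  then have "times_differentiable_on k S (\<lambda>x. det (?C x) * inverse (det (A x)))"
    using assms by (intro times_differentiable_on_mult times_differentiable_on_inverse
        times_differentiable_on_det) (auto simp: invertible_det_nz)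
  then show ?thesis
    using times_differentiable_on_cong[OF \<open>open S\<close>, of "\<lambda>x. matrix_inv (A x) $ i $ j"] eq by simp
qed

lemma times_differentiable_on_vec_nth:
  assumes "open S" "times_differentiable_on k S f"
  shows "times_differentiable_on k S (\<lambda>x. f x $ i)"
  by (rule times_differentiable_on_linear[OF assms(1) bounded_linear_vec_nth assms(2)])

lemma times_differentiable_on_vec:
  fixes f :: "'a::real_normed_vector \<Rightarrow> 'b::euclidean_space^'n"
  assumes "open S" "\<And>i. times_differentiable_on k S (\<lambda>x. f x $ i)"
  shows "times_differentiable_on k S f"
proof (rule times_differentiable_on_components[OF assms(1)])
  fix b :: "'b^'n" assume "b \<in> Basis"
  then obtain i u where "b = axis i u" by (auto simp: Basis_vec_def)
  then show "times_differentiable_on k S (\<lambda>x. f x \<bullet> b)"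
    using times_differentiable_on_linear[OF assms(1) bounded_linear_inner_left assms(2)]
    by (simp add: inner_axis)
qed

lemma times_differentiable_on_matrix_vector_mult:
  fixes A :: "'a::real_normed_vector \<Rightarrow> real^'n^'m"
  assumes "open S" "times_differentiable_on k S A" "times_differentiable_on k S b"
  shows "times_differentiable_on k S (\<lambda>x. A x *v b x)"
proof (rule times_differentiable_on_vec[OF assms(1)])
  fix i
  show "times_differentiable_on k S (\<lambda>x. (A x *v b x) $ i)"
    unfolding matrix_vector_mult_def vec_lambda_beta
    by (intro times_differentiable_on_sum times_differentiable_on_mult
        times_differentiable_on_vec_nth assms)
qed

lemma times_differentiable_on_matrix_mult:
  fixes A :: "'a::real_normed_vector \<Rightarrow> real^'n^'m" and B :: "'a \<Rightarrow> real^'p^'n"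
  assumes "open S" "times_differentiable_on k S A" "times_differentiable_on k S B"
  shows "times_differentiable_on k S (\<lambda>x. A x ** B x)"
proof (intro times_differentiable_on_vec assms(1))
  fix i j
  show "times_differentiable_on k S (\<lambda>x. (A x ** B x) $ i $ j)"
    unfolding matrix_matrix_mult_def vec_lambda_beta
    by (intro times_differentiable_on_sum times_differentiable_on_mult
        times_differentiable_on_vec_nth assms)
qed

lemma times_differentiable_on_matrix:
  fixes L :: "'a::real_normed_vector \<Rightarrow> real^'n \<Rightarrow> real^'m"
  assumes "open S" "\<And>v. times_differentiable_on k S (\<lambda>x. L x v)"
  shows "times_differentiable_on k S (\<lambda>x. matrix (L x))"
  by (intro times_differentiable_on_vec assms(1))
    (simp add: matrix_def times_differentiable_on_vec_nth[OF assms(1) assms(2)])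

text \<open>The inverse function theorem in terms of plain functions. Both uses arrange for
  derivative \<open>id\<close> at the base point, so the identity serves as the inverse of the
  derivative there.\<close>

lemma C1_local_inverse:
  fixes f :: "'a::euclidean_space \<Rightarrow> 'a"
  assumes der: "\<And>x. (f has_derivative f' x) (at x)" and cont: "\<And>v. continuous_on UNIV (\<lambda>x. f' x v)"
    and x0: "f' x0 = id"
  obtains U V g where "open U" "x0 \<in> U" "open V" "\<And>x. x \<in> U \<Longrightarrow> f x \<in> V \<and> g (f x) = x"
    "\<And>y. y \<in> V \<Longrightarrow> g y \<in> U \<and> f (g y) = y"
    "\<And>y. y \<in> V \<Longrightarrow> bij (f' (g y)) \<and> (g has_derivative inv (f' (g y))) (at y)"
proof -
  have F: "blinfun_apply (Blinfun (f' x)) = f' x" for x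
    using has_derivative_bounded_linear[OF der] by (simp add: bounded_linear_Blinfun_apply)
  have contF: "continuous_on UNIV (\<lambda>x. Blinfun (f' x))"
    by (rule continuous_on_blinfun_componentwise) (simp add: F cont)
  have "id_blinfun o\<^sub>L Blinfun (f' x0) = id_blinfun"
    by (intro blinfun_eqI) (simp add: bounded_linear_Blinfun_apply bounded_linear_ident x0 id_def)
  then obtain U V g g' where U: "open U" "U \<subseteq> UNIV" "x0 \<in> U" "open V" "f x0 \<in> V" "homeomorphism U V f g"
    and g: "\<And>y. y \<in> V \<Longrightarrow> (g has_derivative (g' y)) (at y)"
    and g': "\<And>y. y \<in> V \<Longrightarrow> g' y = inv (blinfun_apply (Blinfun (f' (g y))))"
    and bij: "\<And>y. y \<in> V \<Longrightarrow> bij (blinfun_apply (Blinfun (f' (g y))))"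
    using inverse_function_theorem[OF open_UNIV _ contF UNIV_I, of f] der by (metis F)
  show ?thesis
  proof (rule that[OF U(1,3,4)])
    show "f x \<in> V \<and> g (f x) = x" if "x \<in> U" for x
      using U(6) that by (auto simp: homeomorphism_def)
    show "g y \<in> U \<and> f (g y) = y" if "y \<in> V" for y
      using U(6) that by (auto simp: homeomorphism_def)
    show "bij (f' (g y)) \<and> (g has_derivative inv (f' (g y))) (at y)" if "y \<in> V" for y
      using bij[OF that] g[OF that] unfolding g'[OF that] F by blast
  qed
qed

text \<open>Bootstrapping: the derivative of \<open>g\<close> at y is the inverse of the Jacobian of
  \<open>f\<close> at g y. If \<open>g\<close> is k times differentiable, so is this matrix by
  Cramer's rule, and \<open>g\<close> gains one order.\<close>

lemma smooth_local_inverse: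
  fixes f :: "real^'n \<Rightarrow> real^'n"
  assumes f: "smooth_map_on UNIV f" and x0: "(f has_derivative id) (at x0)"
  obtains U V g where "open U" "x0 \<in> U" "open V" "\<And>x. x \<in> U \<Longrightarrow> f x \<in> V \<and> g (f x) = x"
    "\<And>y. y \<in> V \<Longrightarrow> g y \<in> U \<and> f (g y) = y" "smooth_map_on V g"
proof -
  let ?f' = "\<lambda>x. frechet_derivative f (at x)"
  have td: "times_differentiable_on k UNIV f" for k
    using f by (simp add: smooth_map_on_def)
  have der: "(f has_derivative ?f' x) (at x)" and tdf': "times_differentiable_on k UNIV (\<lambda>x. ?f' x v)" for x v k
    using times_differentiable_on_SucD[OF td[of "Suc k"]] by auto
  have lin: "linear (?f' x)" for x
    using der has_derivative_linear by blast
  have "?f' x0 = id"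
    using frechet_derivative_at[OF x0] by simp
  then obtain U V g where U: "open U" "x0 \<in> U" "open V" "\<And>x. x \<in> U \<Longrightarrow> f x \<in> V \<and> g (f x) = x"
      "\<And>y. y \<in> V \<Longrightarrow> g y \<in> U \<and> f (g y) = y"
    and g: "\<And>y. y \<in> V \<Longrightarrow> bij (?f' (g y)) \<and> (g has_derivative inv (?f' (g y))) (at y)"
    by (rule C1_local_inverse[OF der times_differentiable_on_imp_continuous_on[OF tdf']]) blast
  let ?J = "\<lambda>x. matrix (?f' x)"
  have inv: "invertible (?J (g y))" if "y \<in> V" for y
    using g[OF that] lin by (simp add: matrix_invertible invertible_eq_bij)
  have inv_eq: "inv (?f' (g y)) v = matrix_inv (?J (g y)) *v v" if "y \<in> V" for y v
  proof -
    have "?f' (g y) (matrix_inv (?J (g y)) *v v) = ?J (g y) *v (matrix_inv (?J (g y)) *v v)"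
      using lin by (simp add: matrix_works)
    also have "\<dots> = v"
      by (simp add: matrix_vector_mul_assoc matrix_inv_inverse[OF inv[OF that]])
    finally have "?f' (g y) (matrix_inv (?J (g y)) *v v) = v" .
    then show ?thesis
      by (rule bij_inv_eq_iff[OF conjunct1[OF g[OF that]], THEN iffD2, symmetric])
  qed
  have gV: "g ` V \<subseteq> UNIV" by simp
  have "times_differentiable_on k V g" for k
  proof (induction k)
    case 0
    have "continuous_on V g"
      by (rule has_derivative_continuous_on[OF has_derivative_at_withinI[OF conjunct2[OF g]]])
    then show ?case by simp
  next
    case (Suc k)
    show ?case
    proof (rule times_differentiable_on_SucI[OF \<open>open V\<close> conjunct2[OF g]])
      fix v
      have "times_differentiable_on k V (\<lambda>y. ?J (g y) $ i $ j)" for i j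
        by (intro times_differentiable_on_vec_nth U times_differentiable_on_matrix
            times_differentiable_on_compose[OF U(3) tdf' Suc.IH gV])
      then have "times_differentiable_on k V (\<lambda>y. matrix_inv (?J (g y)) $ i $ j)" for i j
        using inv by (intro times_differentiable_on_matrix_inv U) auto
      then have "times_differentiable_on k V (\<lambda>y. matrix_inv (?J (g y)) *v v)"
        by (intro times_differentiable_on_matrix_vector_mult U times_differentiable_on_vec
            times_differentiable_on_const)
      then show "times_differentiable_on k V (\<lambda>y. inv (?f' (g y)) v)"
        using times_differentiable_on_cong[OF U(3), of "\<lambda>y. inv (?f' (g y)) v"] inv_eq by simp
    qed
  qed
  then show ?thesis
    using that[OF U] by (simp add: smooth_map_on_def)
qed

text \<open>A diffeomorphism from the whole space to the open ball of radius \<open>r\<close>. It is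
  wanted because \<open>smooth_point\<close> asks for a chart defined on an entire linear subspace.
  It only rescales vectors, so it preserves every linear subspace.\<close>

definition ball_chart :: "real \<Rightarrow> 'a::real_inner \<Rightarrow> 'a" where
  "ball_chart r y = (r * inverse (sqrt (1 + y \<bullet> y))) *\<^sub>R y"

definition ball_chart_inv :: "real \<Rightarrow> 'a::real_inner \<Rightarrow> 'a" where
  "ball_chart_inv r z = inverse (sqrt (r * r - z \<bullet> z)) *\<^sub>R z"

lemma norm_ball_chart:
  assumes "r > 0" shows "norm (ball_chart r y) < r"
proof -
  have "norm y < sqrt (1 + y \<bullet> y)"
    by (simp add: norm_eq_sqrt_inner)
  moreover have "sqrt (1 + y \<bullet> y) > 0"
    by (simp add: add_pos_nonneg)
  ultimately show ?thesis
    using assms by (simp add: ball_chart_def field_simps)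
qed

lemma ball_chart_inv_ball_chart:
  assumes "r > 0" shows "ball_chart_inv r (ball_chart r y) = y"
proof -
  have pos: "1 + y \<bullet> y > 0"
    by (simp add: add_pos_nonneg)
  let ?s = "sqrt (1 + y \<bullet> y)"
  have s: "?s > 0" "?s * ?s = 1 + y \<bullet> y" using pos by (simp_all add: real_sqrt_mult_self)
  have "r * r - ball_chart r y \<bullet> ball_chart r y = (r / ?s) * (r / ?s)"
    using s pos by (simp add: ball_chart_def field_simps power2_eq_square)
  then have "sqrt (r * r - ball_chart r y \<bullet> ball_chart r y) = r / ?s"
    using assms s by (simp add: real_sqrt_divide)
  then show ?thesis
    using assms s by (simp add: ball_chart_inv_def ball_chart_def[of r y] field_simps)
qed

lemma ball_chart_ball_chart_inv:
  assumes "norm z < r" shows "ball_chart r (ball_chart_inv r z) = z"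
proof -
  have r: "r > 0" using assms norm_ge_zero[of z] by linarith
  have pos: "r * r - z \<bullet> z > 0"
    using assms power_strict_mono[of "norm z" r 2] by (simp add: power2_norm_eq_inner[symmetric]
        power2_eq_square)
  let ?s = "sqrt (r * r - z \<bullet> z)"
  have s: "?s > 0" "?s * ?s = r * r - z \<bullet> z" using pos by (simp_all add: real_sqrt_mult_self)
  have "1 + ball_chart_inv r z \<bullet> ball_chart_inv r z = (r / ?s) * (r / ?s)"
    using s pos by (simp add: ball_chart_inv_def field_simps power2_eq_square)
  then have "sqrt (1 + ball_chart_inv r z \<bullet> ball_chart_inv r z) = r / ?s"
    using r s by (simp add: real_sqrt_divide)
  then show ?thesis
    using r s by (simp add: ball_chart_def ball_chart_inv_def[of r z] field_simps)
qed

lemma times_differentiable_on_ball_chart: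
  "times_differentiable_on k UNIV (ball_chart r :: 'a::euclidean_space \<Rightarrow> 'a)"
  unfolding ball_chart_def
  by (intro times_differentiable_on_scaleR times_differentiable_on_mult times_differentiable_on_const
      times_differentiable_on_inverse_sqrt times_differentiable_on_add
      times_differentiable_on_bilinear[OF _ bounded_bilinear_inner]
      times_differentiable_on_ident_linear bounded_linear_ident open_UNIV)
    (simp add: add_pos_nonneg)

lemma times_differentiable_on_ball_chart_inv:
  fixes c :: "'a::real_normed_vector \<Rightarrow> 'b::euclidean_space"
  assumes S: "open S" "times_differentiable_on k S c" "\<And>x. x \<in> S \<Longrightarrow> norm (c x) < r"
  shows "times_differentiable_on k S (\<lambda>x. ball_chart_inv r (c x))"
proof -
  have pos: "r * r + - (c x \<bullet> c x) > 0" if "x \<in> S" for x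
    using S(3)[OF that] power_strict_mono[of "norm (c x)" r 2]
    by (simp add: power2_norm_eq_inner[symmetric] power2_eq_square)
  have "times_differentiable_on k S (\<lambda>x. - (c x \<bullet> c x))"
    by (rule times_differentiable_on_linear[OF S(1) bounded_linear_minus[OF bounded_linear_ident]])
      (intro times_differentiable_on_bilinear[OF _ bounded_bilinear_inner] S)
  then have "times_differentiable_on k S (\<lambda>x. inverse (sqrt (r * r + - (c x \<bullet> c x))) *\<^sub>R c x)"
    using pos by (intro times_differentiable_on_scaleR times_differentiable_on_inverse_sqrt
        times_differentiable_on_add times_differentiable_on_const S) auto
  then show ?thesis by (simp add: ball_chart_inv_def)
qed

section \<open>Linear algebra\<close>

lemma dim_image_inj_on:
  fixes f :: "'a::euclidean_space \<Rightarrow> 'b::euclidean_space"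
  assumes "linear f" "subspace S" "inj_on f S"
  shows "dim (f ` S) = dim S"
  by (rule dim_image_eq[OF assms(1)]) (unfold span_eq_iff[THEN iffD2, OF assms(2)], rule assms(3))

lemma inj_on_subspace:
  fixes f :: "'a::real_vector \<Rightarrow> 'b::real_vector"
  assumes "linear f" "subspace S" "\<And>x. x \<in> S \<Longrightarrow> f x = 0 \<Longrightarrow> x = 0"
  shows "inj_on f S"
proof (rule inj_onI)
  fix x y assume "x \<in> S" "y \<in> S" "f x = f y"
  then have "x - y = 0"
    by (intro assms(3) subspace_diff assms(2)) (simp_all add: linear_diff[OF assms(1)])
  then show "x = y" by simp
qed

text \<open>\<open>f\<close> is injective on the orthogonal complement \<open>?C\<close> of the
  kernel inside \<open>S\<close> and already maps it onto the image of \<open>S\<close>.\<close>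

lemma dim_image_kernel:
  fixes f :: "'a::euclidean_space \<Rightarrow> 'b::euclidean_space"
  assumes "linear f" "subspace S"
  shows "dim (f ` S) + dim {x \<in> S. f x = 0} = dim S"
proof -
  interpret linear f by fact
  let ?K = "{x \<in> S. f x = 0}"
  let ?C = "{y \<in> S. \<forall>x \<in> ?K. orthogonal x y}"
  have K: "subspace ?K"
    using assms by (auto simp: subspace_def add scale)
  have C: "subspace ?C"
    using assms by (auto simp: subspace_def orthogonal_def inner_right_distrib)
  have dimC: "dim ?C + dim ?K = dim S"
    by (rule dim_subspace_orthogonal_to_vectors[OF K assms(2)]) auto
  have inj: "inj_on f ?C"
  proof (rule inj_on_subspace[OF assms(1) C])
    fix x assume "x \<in> ?C" "f x = 0"
    then have "orthogonal x x" by simp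
    then show "x = 0" by (simp add: orthogonal_def)
  qed
  have "f ` S \<subseteq> f ` ?C"
  proof (rule image_subsetI)
    fix x assume x: "x \<in> S"
    obtain y z where yz: "y \<in> span ?K" "\<And>w. w \<in> span ?K \<Longrightarrow> orthogonal z w" "x = y + z"
      by (rule orthogonal_subspace_decomp_exists[of ?K x], rule that)
    have y: "y \<in> ?K" using yz(1) unfolding span_eq_iff[THEN iffD2, OF K] .
    then have "z \<in> ?C"
      using yz x subspace_diff[OF assms(2) x, of y] by (auto simp: orthogonal_commute span_base)
    moreover have "f x = f z" using y yz(3) by (simp add: add)
    ultimately show "f x \<in> f ` ?C" by blast
  qed
  moreover have "f ` ?C \<subseteq> f ` S" by (rule image_mono) (rule Collect_restrict)
  ultimately have "f ` S = f ` ?C" by (rule subset_antisym)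
  moreover have "dim (f ` ?C) = dim ?C"
    by (rule dim_image_inj_on[OF assms(1) C inj])
  ultimately show ?thesis using dimC by simp
qed

lemma dim_vec_components:
  fixes S :: "'a::euclidean_space set"
  assumes "subspace S"
  shows "dim {x :: 'a^'n. \<forall>i. x $ i \<in> S} = CARD('n) * dim S"
proof -
  obtain B where B: "B \<subseteq> S" "pairwise orthogonal B" "\<And>x. x \<in> B \<Longrightarrow> norm x = 1"
    "independent B" "card B = dim S" "span B = S"
    using orthonormal_basis_subspace[OF assms] by metis
  let ?V = "{x :: 'a^'n. \<forall>i. x $ i \<in> S}"
  let ?a = "\<lambda>(i::'n, b::'a). axis i b"
  let ?A = "?a ` (UNIV \<times> B)"
  have nz: "b \<noteq> 0" if "b \<in> B" for b using B(3)[OF that] by auto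
  have inj: "inj_on ?a (UNIV \<times> B)"
    using nz by (auto simp: inj_on_def axis_eq_axis)
  have "pairwise orthogonal ?A"
    using B(2) by (auto simp: pairwise_def orthogonal_def inner_axis_axis)
  moreover have "0 \<notin> ?A" using nz by (auto simp: axis_eq_0_iff)
  ultimately have ind: "independent ?A" by (rule pairwise_orthogonal_independent)
  have sub: "?A \<subseteq> ?V"
    using B(1) subspace_0[OF assms] by (auto simp: axis_def)
  have "?V \<subseteq> span ?A"
  proof
    fix x assume x: "x \<in> ?V"
    have axis: "axis i u \<in> span ?A" if "u \<in> span B" for i u
      using that
    proof (induction rule: span_induct_alt)
      case base
      have "axis i (0::'a) = 0" by (simp add: axis_eq_0_iff)
      then show ?case by (metis span_zero)
    next
      case (step c b y)
      have "axis i (c *\<^sub>R b + y) = c *\<^sub>R axis i b + axis i y"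
        by (simp add: vec_eq_iff axis_def)
      moreover have "axis i b \<in> span ?A" using step(1) by (intro span_base) force
      ultimately show ?case using step(2) by (simp add: span_add span_scale)
    qed
    have "x = (\<Sum>i\<in>UNIV. axis i (x $ i))"
      by (simp add: vec_eq_iff axis_def sum.delta)
    also have "\<dots> \<in> span ?A"
      using x B(6) by (intro span_sum axis) auto
    finally show "x \<in> span ?A" .
  qed
  then have "dim ?V = card ?A"
    using basis_card_eq_dim[OF sub _ ind] by simp
  then show ?thesis
    using card_image[OF inj] B(5) by (simp add: card_cartesian_product)
qed

text \<open>A linear left inverse of an isometric embedding of \<open>P\<close> into
  \<open>T\<close>. It lets \<open>T\<close> serve as a parameter space for
  \<open>P\<close>.\<close>

lemma linear_subset_exists_basis_map:
  fixes P :: "'a::euclidean_space set" and T :: "'b::euclidean_space set"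
  assumes "subspace P" "subspace T" "dim P \<le> dim T"
  obtains g where "linear g" "g ` T = P" "range g = P"
proof -
  obtain f :: "'a \<Rightarrow> 'b" where f: "linear f" "f ` P \<subseteq> T" "\<And>x. x \<in> P \<Longrightarrow> norm (f x) = norm x"
    using isometry_subset_subspace[OF assms] by (metis image_subset_iff_funcset)
  have "inj_on f P"
    using f(3) by (intro inj_on_subspace f assms) force
  then obtain g where g: "range g \<subseteq> P" "linear g" "\<And>v. v \<in> P \<Longrightarrow> g (f v) = v"
    using linear_exists_left_inverse_on[OF f(1) assms(1)] by blast
  have "P \<subseteq> g ` T"
    using g(3) f(2) by force
  then have "g ` T = P" "range g = P" using g(1) by blast+
  then show ?thesis using that[OF g(2)] by blast
qed

text \<open>Let \<open>R\<close> be a right inverse of \<open>A x0\<close> on its range T. For w in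
  T, \<open>A x (R w)\<close> differs from w by at most \<epsilon> x times the norm of w; where
  \<epsilon> x < 1 the map is therefore injective on T.\<close>

lemma rank_lower_semicontinuous:
  fixes A :: "'a::topological_space \<Rightarrow> 'b::euclidean_space \<Rightarrow> 'c::euclidean_space"
  assumes lin: "\<And>x. linear (A x)" and cont: "\<And>v. continuous_on S (\<lambda>x. A x v)"
    and S: "open S" "x0 \<in> S"
  obtains U where "open U" "x0 \<in> U" "U \<subseteq> S" "\<And>x. x \<in> U \<Longrightarrow> dim (range (A x0)) \<le> dim (range (A x))"
proof -
  obtain R where R: "linear R" "\<And>w. w \<in> range (A x0) \<Longrightarrow> A x0 (R w) = w"
    using linear_exists_right_inverse_on[OF lin[of x0] subspace_UNIV] by blast
  define \<epsilon> where "\<epsilon> x = (\<Sum>b\<in>Basis. norm (A x (R b) - A x0 (R b)))" for x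
  have "continuous_on S \<epsilon>"
    unfolding \<epsilon>_def by (intro continuous_intros cont)
  then have "open (\<epsilon> -` {..<1} \<inter> S)"
    using continuous_on_open_vimage[OF S(1)] open_lessThan by blast
  moreover have "x0 \<in> \<epsilon> -` {..<1} \<inter> S"
    using S by (simp add: \<epsilon>_def)
  moreover have "dim (range (A x0)) \<le> dim (range (A x))" if x: "\<epsilon> x < 1" for x
  proof -
    have bound: "norm (A x (R w) - A x0 (R w)) \<le> \<epsilon> x * norm w" for w
    proof -
      have lin': "linear (\<lambda>w. A x (R w) - A x0 (R w))"
        using linear_compose[OF R(1) lin] by (intro linear_compose_sub) (simp_all add: o_def)
      have "A x (R w) - A x0 (R w) = (\<Sum>b\<in>Basis. (w \<bullet> b) *\<^sub>R (A x (R b) - A x0 (R b)))"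
        using linear_sum[OF lin', of "\<lambda>b. (w \<bullet> b) *\<^sub>R b" Basis] linear_scale[OF lin']
        by (simp add: euclidean_representation)
      also have "norm \<dots> \<le> (\<Sum>b\<in>Basis. norm w * norm (A x (R b) - A x0 (R b)))"
        by (intro sum_norm_le) (simp add: Basis_le_norm mult_right_mono)
      finally show ?thesis by (simp add: \<epsilon>_def sum_distrib_left mult.commute)
    qed
    let ?T = "range (A x0)"
    have T: "subspace ?T" using lin linear_subspace_image subspace_UNIV by blast
    have linAR: "linear (\<lambda>w. A x (R w))"
      using linear_compose[OF R(1) lin] by (simp add: o_def)
    have "inj_on (\<lambda>w. A x (R w)) ?T"
    proof (rule inj_on_subspace[OF linAR T])
      fix u assume "u \<in> ?T" "A x (R u) = 0"
      then have "norm u \<le> \<epsilon> x * norm u"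
        using bound[of u] R(2) by simp
      then show "u = 0"
        using x mult_less_cancel_right_disj[of "\<epsilon> x" "norm u" 1] by (cases "u = 0") auto
    qed
    then have "dim ?T = dim ((\<lambda>w. A x (R w)) ` ?T)"
      using dim_image_inj_on[OF linAR T] by simp
    also have "\<dots> \<le> dim (range (A x))"
      by (intro dim_subset) auto
    finally show ?thesis .
  qed
  ultimately show ?thesis
    using that[of "\<epsilon> -` {..<1} \<inter> S"] by auto
qed

section \<open>Orthogonal projections\<close>

lemma closest_point_eq_orthogonal:
  fixes V :: "'a::euclidean_space set"
  assumes "subspace V" "p \<in> V" "\<And>v. v \<in> V \<Longrightarrow> (x - p) \<bullet> v = 0"
  shows "closest_point V x = p"
proof (rule closest_point_unique[symmetric])
  show "\<forall>z\<in>V. dist x p \<le> dist x z"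
  proof
    fix z assume "z \<in> V"
    then have "(x - p) \<bullet> (p - z) = 0"
      using assms by (intro assms(3) subspace_diff)
    then have "(norm (x - z))\<^sup>2 = (norm (x - p))\<^sup>2 + (norm (p - z))\<^sup>2"
      using norm_add_Pythagorean[of "x - p" "p - z"] by (simp add: orthogonal_def)
    then have "(norm (x - p))\<^sup>2 \<le> (norm (x - z))\<^sup>2" by simp
    then show "dist x p \<le> dist x z"
      by (simp add: dist_norm power2_le_iff_abs_le)
  qed
qed (use assms in \<open>auto simp: subspace_imp_convex closed_subspace\<close>)

lemma closest_point_subspace:
  fixes V :: "'a::euclidean_space set"
  assumes V: "subspace V"
  shows "closest_point V x \<in> V" "v \<in> V \<Longrightarrow> (x - closest_point V x) \<bullet> v = 0"
proof -
  obtain y z where yz: "y \<in> span V" "\<And>w. w \<in> span V \<Longrightarrow> orthogonal z w" "x = y + z"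
    using orthogonal_subspace_decomp_exists[of V x] by metis
  have span: "span V = V" using V span_eq_iff by blast
  have "closest_point V x = y"
    using yz V unfolding span by (intro closest_point_eq_orthogonal) (auto simp: orthogonal_def)
  then show "closest_point V x \<in> V" "v \<in> V \<Longrightarrow> (x - closest_point V x) \<bullet> v = 0"
    using yz unfolding span by (auto simp: orthogonal_def)
qed

lemma closest_point_subspace_ident:
  fixes V :: "'a::euclidean_space set"
  shows "subspace V \<Longrightarrow> v \<in> V \<Longrightarrow> closest_point V v = v"
  by (rule closest_point_eq_orthogonal) auto

lemma linear_closest_point:
  fixes V :: "'a::euclidean_space set"
  assumes V: "subspace V"
  shows "linear (closest_point V)"
proof (rule linearI)
  note cp = closest_point_subspace[OF V]
  show "closest_point V (x + y) = closest_point V x + closest_point V y" for x y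
    using cp(2)[of _ x] cp(2)[of _ y]
    by (intro closest_point_eq_orthogonal V subspace_add cp) (simp add: algebra_simps)
  show "closest_point V (c *\<^sub>R x) = c *\<^sub>R closest_point V x" for c x
    using cp(2)[of _ x]
    by (intro closest_point_eq_orthogonal V subspace_scale cp) (simp add: algebra_simps)
qed

lemma closest_point_inner_commute:
  fixes V :: "'a::euclidean_space set"
  assumes V: "subspace V"
  shows "closest_point V x \<bullet> y = x \<bullet> closest_point V y"
  using closest_point_subspace(2)[OF V closest_point_subspace(1)[OF V], of x y]
    closest_point_subspace(2)[OF V closest_point_subspace(1)[OF V], of y x]
  by (simp add: inner_diff_left inner_diff_right inner_commute)

lemma range_closest_point:
  fixes V :: "'a::euclidean_space set"
  assumes V: "subspace V"
  shows "range (closest_point V) = V"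
  using closest_point_subspace(1)[OF V] closest_point_subspace_ident[OF V] by (metis image_subset_iff
      rangeI subsetI subset_antisym)

lemma projection_matrix_mult:
  "subspace V \<Longrightarrow> projection_matrix V *v x = closest_point V x"
  by (simp add: projection_matrix_def matrix_works linear_closest_point)

lemma inner_transpose_matrix_vector:
  fixes A :: "real^'n^'m"
  shows "(transpose A *v x) \<bullet> y = x \<bullet> (A *v y)"
  by (simp add: dot_lmul_matrix flip: vector_transpose_matrix)

lemma transpose_projection_matrix:
  assumes "subspace V" shows "transpose (projection_matrix V) = projection_matrix V"
proof -
  have "transpose (projection_matrix V) *v x = projection_matrix V *v x" for x
    by (rule vector_eq_rdot[THEN iffD1], rule allI)
      (simp del: transpose_matrix_vector add: inner_transpose_matrix_vector projection_matrix_mult[OF assms]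
        closest_point_inner_commute[OF assms])
  then show ?thesis by (simp add: matrix_eq)
qed

text \<open>The Gram matrix \<open>A\<^sup>T A\<close> is only invertible on \<open>L\<close>; the summand \<open>1 - Q\<close> makes it so everywhere.\<close>

lemma projection_matrix_image:
  fixes A :: "real^'n^'n"
  assumes L: "subspace L" and AQ: "A ** projection_matrix L = A"
    and inj: "\<And>x. x \<in> L \<Longrightarrow> A *v x = 0 \<Longrightarrow> x = 0"
  defines "G \<equiv> transpose A ** A + (mat 1 - projection_matrix L)"
  shows "invertible G" "projection_matrix ((*v) A ` L) = A ** matrix_inv G ** transpose A"
proof -
  let ?q = "closest_point L"
  note q = projection_matrix_mult[OF L]
  have Aq: "A *v ?q x = A *v x" for x
    using AQ by (metis matrix_vector_mul_assoc q)
  have G: "G *v x = transpose A *v (A *v x) + (x - ?q x)" for x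
    by (simp del: transpose_matrix_vector add: G_def matrix_vector_mult_add_rdistrib
        matrix_vector_mult_diff_rdistrib q flip: matrix_vector_mul_assoc)
  have qA: "?q (transpose A *v x) = transpose A *v x" for x
  proof (rule vector_eq_rdot[THEN iffD1], rule allI)
    fix z
    show "?q (transpose A *v x) \<bullet> z = (transpose A *v x) \<bullet> z"
      by (simp del: transpose_matrix_vector add: closest_point_inner_commute[OF L]
          inner_transpose_matrix_vector Aq)
  qed
  have qG: "?q (x - ?q x) = 0" for x
    using linear_diff[OF linear_closest_point[OF L]]
      closest_point_subspace_ident[OF L closest_point_subspace(1)[OF L]] by simp
  have "x = 0" if "G *v x = 0" for x
  proof -
    \<comment> \<open>Pairing \<open>G *v x = 0\<close> with \<open>x\<close> makes the sum of the
      squared norms of \<open>A *v x\<close> and \<open>x - ?q x\<close> vanish.\<close>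
    have "0 = (A *v x) \<bullet> (A *v x) + (x - ?q x) \<bullet> x"
      using arg_cong[OF that, of "\<lambda>u. u \<bullet> x"]
      by (simp del: transpose_matrix_vector add: G inner_add_left inner_transpose_matrix_vector)
    also have "(x - ?q x) \<bullet> x = (x - ?q x) \<bullet> (x - ?q x)"
      using closest_point_subspace[OF L] by (simp add: inner_diff_right)
    finally have "A *v x = 0" "x - ?q x = 0"
      by (smt (verit) inner_ge_zero inner_eq_zero_iff)+
    then show ?thesis
      using inj[of x] closest_point_subspace(1)[OF L, of x] by simp
  qed
  then show inv: "invertible G"
    by (metis invertible_left_inverse matrix_left_invertible_ker)
  show "projection_matrix ((*v) A ` L) = A ** matrix_inv G ** transpose A"
  proof -
    have V: "subspace ((*v) A ` L)"
      by (rule linear_subspace_image[OF matrix_vector_mul_linear L])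
    have "closest_point ((*v) A ` L) x = A *v (matrix_inv G *v (transpose A *v x))" for x
    proof (rule closest_point_eq_orthogonal[OF V])
      let ?y = "matrix_inv G *v (transpose A *v x)"
      have Gy: "G *v ?y = transpose A *v x"
        by (simp add: matrix_vector_mul_assoc matrix_inv_inverse[OF inv])
      \<comment> \<open>The part of \<open>?y\<close> orthogonal to \<open>L\<close> equals that of
        \<open>G *v ?y\<close>, which lies in \<open>L\<close>. So \<open>?y\<close> is in
        \<open>L\<close>, where \<open>G\<close> acts as the Gram matrix.\<close>
      have "?y - ?q ?y = G *v ?y - ?q (G *v ?y)"
        by (simp del: transpose_matrix_vector add: G linear_add[OF linear_closest_point[OF L]] qA qG)
      also have "\<dots> = 0" by (simp del: transpose_matrix_vector add: Gy qA)
      finally have y: "?q ?y = ?y" by simp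
      show "A *v ?y \<in> (*v) A ` L"
        using closest_point_subspace(1)[OF L, of ?y] y by auto
      fix v assume "v \<in> (*v) A ` L"
      then obtain w where w: "v = A *v w" by blast
      have "(x - A *v ?y) \<bullet> v = (transpose A *v x - transpose A *v (A *v ?y)) \<bullet> w"
        by (simp del: transpose_matrix_vector add: w inner_diff_left inner_transpose_matrix_vector)
      also have "transpose A *v (A *v ?y) = transpose A *v x"
        using Gy G[of ?y] y by (simp del: transpose_matrix_vector)
      finally show "(x - A *v ?y) \<bullet> v = 0" by simp
    qed
    then have "projection_matrix ((*v) A ` L) *v x = (A ** matrix_inv G ** transpose A) *v x" for x
      by (simp del: transpose_matrix_vector add: projection_matrix_mult[OF V] matrix_vector_mul_assoc
          matrix_mul_assoc)
    then show ?thesis by (simp add: matrix_eq)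
  qed
qed

section \<open>Smooth charts and the Gauss map\<close>

locale smooth_chart =
  fixes t :: nat and M U L W :: "'a::euclidean_space set" and f g :: "'a \<Rightarrow> 'a"
  assumes U: "openin (top_of_set M) U" and L: "subspace L" "dim L = t"
    and W: "open W" "U \<subseteq> W"
    and f: "smooth_map_on UNIV f" and g: "smooth_map_on W g"
    and fL: "f ` L = U" and gf: "\<And>y. y \<in> L \<Longrightarrow> g (f y) = y"

lemma smooth_point_iff_chart:
  "smooth_point t M x \<longleftrightarrow> (\<exists>U L W f g. x \<in> U \<and> smooth_chart t M U L W f g)"
  by (simp add: smooth_point_def smooth_chart_def Ball_def)

lemma smooth_point_in: "smooth_point t M x \<Longrightarrow> x \<in> M"
  using openin_imp_subset by (fastforce simp: smooth_point_def)

context smooth_chart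
begin

abbreviation "f' z \<equiv> frechet_derivative f (at z)"
abbreviation "g' y \<equiv> frechet_derivative g (at y)"

lemma has_derivative_f: "(f has_derivative f' z) (at z)"
  using times_differentiable_on_SucD(1)[of 0 UNIV f] f unfolding smooth_map_on_def by blast

lemma has_derivative_g: "y \<in> W \<Longrightarrow> (g has_derivative g' y) (at y)"
  using times_differentiable_on_SucD(1)[of 0 W g] g unfolding smooth_map_on_def by blast

lemma linear_f': "linear (f' z)"
  using has_derivative_f has_derivative_linear by blast

lemma U_subset: "U \<subseteq> M"
  using U openin_imp_subset by blast

lemma f_in_U: "z \<in> L \<Longrightarrow> f z \<in> U"
  using fL by blast

lemma smooth_point_chart: "z \<in> L \<Longrightarrow> smooth_point t M (f z)"
  using f_in_U smooth_chart_axioms smooth_point_iff_chart by blast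

text \<open>Since \<open>g\<close> inverts \<open>f\<close> on \<open>L\<close> only, the identity
  is differentiated along the lines z + s v, which stay in \<open>L\<close>.\<close>

lemma g'_f': 
  assumes "z \<in> L" "v \<in> L"
  shows "g' (f z) (f' z v) = v"
proof -
  have fz: "f (z + 0 *\<^sub>R v) \<in> W" using assms(1) W f_in_U by auto
  have "((\<lambda>s::real. z + s *\<^sub>R v) has_derivative (\<lambda>s. s *\<^sub>R v)) (at 0)"
    by (auto intro!: derivative_eq_intros)
  from has_derivative_compose[OF has_derivative_compose[OF this has_derivative_f] has_derivative_g[OF fz]]
  have 1: "((\<lambda>s. g (f (z + s *\<^sub>R v))) has_derivative (\<lambda>s. g' (f z) (f' z (s *\<^sub>R v)))) (at 0)"
    by simp
  have "g (f (z + s *\<^sub>R v)) = z + s *\<^sub>R v" for s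
    using assms L(1) by (intro gf subspace_add subspace_scale)
  then have "((\<lambda>s. g (f (z + s *\<^sub>R v))) has_derivative (\<lambda>s. s *\<^sub>R v)) (at 0)"
    by (auto intro!: derivative_eq_intros)
  from has_derivative_unique[OF 1 this] show ?thesis
    by (metis scaleR_one)
qed

text \<open>A curve in \<open>M\<close> through \<open>f z\<close> stays in \<open>U\<close> for
  small times, because \<open>U\<close> is relatively open. There it equals f \<circ> g \<circ>
  \<gamma>, and the chain rule exhibits its velocity as an image under \<open>f' z\<close>.\<close>

lemma tangent_space_eq:
  assumes z: "z \<in> L"
  shows "tangent_space M (f z) = f' z ` L"
proof (intro subset_antisym subsetI)
  fix w assume "w \<in> f' z ` L"
  then obtain v where v: "v \<in> L" "w = f' z v" by blast
  let ?\<gamma> = "\<lambda>s. f (z + s *\<^sub>R v)"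
  have "((\<lambda>s::real. z + s *\<^sub>R v) has_derivative (\<lambda>s. s *\<^sub>R v)) (at 0)"
    by (auto intro!: derivative_eq_intros)
  from has_derivative_compose[OF this, of f "f' z"] has_derivative_f[of z]
  have "(?\<gamma> has_vector_derivative w) (at 0)"
    by (simp add: has_vector_derivative_def v linear_scale[OF linear_f'])
  moreover have "?\<gamma> s \<in> M" for s
    using z v(1) L(1) f_in_U U_subset by (auto intro: subspace_add subspace_scale)
  ultimately show "w \<in> tangent_space M (f z)"
    unfolding tangent_space_def by (intro CollectI exI[of _ ?\<gamma>]) auto
next
  fix w assume "w \<in> tangent_space M (f z)"
  then obtain \<gamma> where \<gamma>: "\<gamma> 0 = f z" "\<forall>\<^sub>F s in nhds (0::real). \<gamma> s \<in> M"
    "(\<gamma> has_vector_derivative w) (at 0)"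
    by (auto simp: tangent_space_def)
  obtain X where X: "open X" "U = M \<inter> X"
    using U by (auto simp: openin_open)
  have "isCont \<gamma> 0"
    using \<gamma>(3) by (simp add: has_vector_derivative_continuous)
  moreover have "\<gamma> 0 \<in> X" using \<gamma>(1) f_in_U[OF z] X by auto
  ultimately have "\<forall>\<^sub>F s in nhds 0. \<gamma> s \<in> X"
    using X(1) by (metis isCont_def tendsto_at_iff_tendsto_nhds topological_tendstoD)
  then have ev: "\<forall>\<^sub>F s in nhds 0. \<gamma> s \<in> U"
    using \<gamma>(2) by eventually_elim (simp add: X)
  have W0: "\<gamma> 0 \<in> W" using \<gamma>(1) f_in_U[OF z] W by auto
  have gder: "((\<lambda>s. g (\<gamma> s)) has_derivative (\<lambda>s. g' (f z) (s *\<^sub>R w))) (at 0)"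
    using has_derivative_compose[OF \<gamma>(3)[unfolded has_vector_derivative_def] has_derivative_g[OF W0]] \<gamma>(1)
    by simp
  then have gv: "((\<lambda>s. g (\<gamma> s)) has_vector_derivative g' (f z) w) (at 0)"
    using linear_scale[OF has_derivative_linear[OF has_derivative_g[OF W0]]] \<gamma>(1)
    by (simp add: has_vector_derivative_def)
  have gL: "g y \<in> L \<and> f (g y) = y" if "y \<in> U" for y
    using that fL gf by force
  \<comment> \<open>Orthogonal projection onto \<open>L\<close> fixes the curve g \<circ> \<gamma>
    near 0, hence also its velocity.\<close>
  have in_L: "g' (f z) w \<in> L"
  proof -
    let ?p = "closest_point L"
    have "bounded_linear ?p"
      using linear_closest_point[OF L(1)] by (simp add: linear_conv_bounded_linear)
    from bounded_linear.has_vector_derivative[OF this gv]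
    have "((\<lambda>s. ?p (g (\<gamma> s))) has_vector_derivative ?p (g' (f z) w)) (at 0)" .
    moreover have "((\<lambda>s. ?p (g (\<gamma> s))) has_vector_derivative g' (f z) w) (at 0)"
      unfolding has_vector_derivative_def
    proof (rule has_derivative_transform_eventually[OF gv[unfolded has_vector_derivative_def]])
      show "\<forall>\<^sub>F s in at 0. g (\<gamma> s) = ?p (g (\<gamma> s))"
        using ev unfolding eventually_at_filter
        by eventually_elim (simp add: gL closest_point_subspace_ident L)
      show "g (\<gamma> 0) = ?p (g (\<gamma> 0))"
        using eventually_nhds_x_imp_x[OF ev] by (simp add: gL closest_point_subspace_ident L)
    qed simp
    ultimately have "?p (g' (f z) w) = g' (f z) w"
      by (rule vector_derivative_unique_at)
    then show ?thesis
      using closest_point_subspace(1)[OF L(1)] by metis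
  qed
  have "((\<lambda>s. f (g (\<gamma> s))) has_derivative (\<lambda>s. f' z (g' (f z) (s *\<^sub>R w)))) (at 0)"
    using has_derivative_compose[OF gder has_derivative_f] \<gamma>(1) gf[OF z] by simp
  then have "(\<gamma> has_derivative (\<lambda>s. f' z (g' (f z) (s *\<^sub>R w)))) (at 0)"
    by (rule has_derivative_transform_eventually)
      (use ev gL eventually_nhds_x_imp_x[OF ev] in \<open>auto simp: eventually_at_filter elim: eventually_mono\<close>)
  from has_derivative_unique[OF this \<gamma>(3)[unfolded has_vector_derivative_def]]
  have "f' z (g' (f z) w) = w" by (metis scaleR_one)
  then show "w \<in> f' z ` L" using in_L by (metis imageI)
qed

lemma subspace_tangent_space: "z \<in> L \<Longrightarrow> subspace (tangent_space M (f z))"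
  by (simp add: tangent_space_eq linear_subspace_image linear_f' L)

lemma dim_tangent_space:
  assumes "z \<in> L" shows "dim (tangent_space M (f z)) = t"
proof -
  have "inj_on (f' z) L"
    using g'_f'[OF assms] by (rule inj_on_inverseI)
  then show ?thesis
    using dim_image_inj_on[OF linear_f' L(1)] L(2) tangent_space_eq[OF assms] by simp
qed

end

lemma dim_tangent_space_smooth_point:
  assumes "smooth_point t M x"
  shows "dim (tangent_space M x) = t" "subspace (tangent_space M x)"
proof -
  from assms obtain U L W f g where x: "x \<in> U" and chart: "smooth_chart t M U L W f g"
    by (auto simp: smooth_point_iff_chart)
  interpret smooth_chart t M U L W f g by fact
  from x fL show "dim (tangent_space M x) = t" "subspace (tangent_space M x)"
    using dim_tangent_space subspace_tangent_space by blast+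
qed

lemma openin_smooth_points: "openin (top_of_set M) {x. smooth_point t M x}"
proof (subst openin_subopen, intro ballI)
  fix x assume "x \<in> {x. smooth_point t M x}"
  then obtain U L W f g where "x \<in> U" and chart: "smooth_chart t M U L W f g"
    by (auto simp: smooth_point_iff_chart)
  moreover have "U \<subseteq> {x. smooth_point t M x}"
    using chart smooth_point_iff_chart by blast
  ultimately show "\<exists>T. openin (top_of_set M) T \<and> x \<in> T \<and> T \<subseteq> {x. smooth_point t M x}"
    using smooth_chart.U[OF chart] by blast
qed

lemma tangent_space_openin:
  assumes "openin (top_of_set M) N" "x \<in> N"
  shows "tangent_space N x = tangent_space M x"
proof -
  obtain X where X: "open X" "N = M \<inter> X"
    using assms(1) by (auto simp: openin_open)
  have "(\<forall>\<^sub>F s in nhds (0::real). \<gamma> s \<in> N) \<longleftrightarrow> (\<forall>\<^sub>F s in nhds 0. \<gamma> s \<in> M)"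
    if \<gamma>: "\<gamma> 0 = x" "(\<gamma> has_vector_derivative v) (at 0)" for \<gamma> v
  proof -
    have "isCont \<gamma> 0"
      using \<gamma>(2) by (simp add: has_vector_derivative_continuous)
    moreover have "\<gamma> 0 \<in> X" using \<gamma>(1) assms(2) X by auto
    ultimately have "\<forall>\<^sub>F s in nhds 0. \<gamma> s \<in> X"
      using X(1) by (metis isCont_def tendsto_at_iff_tendsto_nhds topological_tendstoD)
    then show ?thesis
      by (simp add: X eventually_conj_iff)
  qed
  then show ?thesis
    unfolding tangent_space_def by blast
qed

section \<open>The Gauss map in chart coordinates\<close>

locale euclidean_smooth_chart = smooth_chart t M U L W f g
  for t and M U L W :: "(real^'e::finite) set" and f g :: "real^'e \<Rightarrow> real^'e"
begin

text \<open>The Gauss map read in the chart. Precomposing with the projection onto \<open>L\<close>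
  extends it to all of R^e, so that ordinary derivatives replace derivatives within
  \<open>M\<close>.\<close>

definition \<Phi> :: "real^'e \<Rightarrow> real^'e^'e" where
  "\<Phi> z = projection_matrix (f' (closest_point L z) ` L)"

abbreviation "\<Phi>' z \<equiv> frechet_derivative \<Phi> (at z)"

lemma \<Phi>_eq: "z \<in> L \<Longrightarrow> \<Phi> z = projection_matrix (tangent_space M (f z))"
  by (simp add: \<Phi>_def tangent_space_eq closest_point_subspace_ident L)

text \<open>The matrix \<open>A z\<close> of f'(p z) \<circ> p, where p projects onto
  \<open>L\<close>, depends smoothly on z and is injective on \<open>L\<close>.
  \<open>projection_matrix_image\<close> then writes \<Phi> z through products, a transpose and an
  inverse of smooth matrices.\<close>

lemma times_differentiable_on_\<Phi>: "times_differentiable_on k UNIV \<Phi>"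
proof -
  let ?p = "closest_point L" and ?Q = "projection_matrix L"
  define A where "A z = matrix (\<lambda>v. f' (?p z) (?p v))" for z
  define G where "G z = transpose (A z) ** A z + (mat 1 - ?Q)" for z
  note p = linear_closest_point[OF L(1)]
  note p_in = closest_point_subspace(1)[OF L(1)]
  have lin: "linear (\<lambda>v. f' (?p z) (?p v))" for z
    using linear_compose[OF p linear_f'] by (simp add: o_def)
  have A: "A z *v v = f' (?p z) (?p v)" for z v
    using lin by (simp add: A_def matrix_works)
  have AQ: "A z ** ?Q = A z" for z
    by (simp add: matrix_eq A projection_matrix_mult L closest_point_subspace_ident p_in
        flip: matrix_vector_mul_assoc)
  have inj: "v = 0" if "v \<in> L" "A z *v v = 0" for z v
  proof -
    have "f' (?p z) v = 0" using that by (simp add: A closest_point_subspace_ident L)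
    then have "v = g' (f (?p z)) 0"
      using g'_f'[OF p_in that(1), of z] by simp
    moreover have "f (?p z) \<in> W" using f_in_U[OF p_in] W by blast
    then have "g' (f (?p z)) 0 = 0"
      using has_derivative_g has_derivative_linear linear_0 by blast
    ultimately show ?thesis by simp
  qed
  have image: "(*v) (A z) ` L = f' (?p z) ` L" for z
    by (rule image_cong[OF refl]) (simp add: A closest_point_subspace_ident L)
  have inv: "invertible (G z)" and \<Phi>_mat: "\<Phi> z = A z ** matrix_inv (G z) ** transpose (A z)" for z
    using projection_matrix_image[of L "A z", OF L(1) AQ inj] image[of z] by (auto simp: \<Phi>_def G_def)
  have tdf': "times_differentiable_on k UNIV (\<lambda>z. f' z v)" for v
    using times_differentiable_on_SucD(2)[of k UNIV f v] f unfolding smooth_map_on_def by blast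
  have tdp: "times_differentiable_on k UNIV ?p"
    using p by (intro times_differentiable_on_ident_linear) (auto simp: linear_conv_bounded_linear)
  have tdA: "times_differentiable_on k UNIV A"
    unfolding A_def
    by (intro times_differentiable_on_matrix open_UNIV
        times_differentiable_on_compose[OF open_UNIV tdf' tdp]) simp
  have tdAT: "times_differentiable_on k UNIV (\<lambda>z. transpose (A z))"
    by (intro times_differentiable_on_vec open_UNIV)
      (simp add: transpose_def times_differentiable_on_vec_nth[OF open_UNIV]
        times_differentiable_on_vec_nth[OF open_UNIV tdA])
  have tdG: "times_differentiable_on k UNIV G"
    unfolding G_def
    by (rule times_differentiable_on_add[OF open_UNIV times_differentiable_on_matrix_mult[OF open_UNIV tdAT tdA]
          times_differentiable_on_const[OF open_UNIV]])
  have inv_td: "times_differentiable_on k UNIV (\<lambda>z. matrix_inv (G z))"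
    by (rule times_differentiable_on_vec[OF open_UNIV times_differentiable_on_vec[OF open_UNIV
          times_differentiable_on_matrix_inv[OF open_UNIV times_differentiable_on_vec_nth[OF open_UNIV
          times_differentiable_on_vec_nth[OF open_UNIV tdG]] inv]]])
  show ?thesis
    unfolding \<Phi>_mat[abs_def]
    by (rule times_differentiable_on_matrix_mult[OF open_UNIV times_differentiable_on_matrix_mult[OF
        open_UNIV tdA inv_td] tdAT])
qed

lemma has_derivative_\<Phi>: "(\<Phi> has_derivative \<Phi>' z) (at z)"
  and continuous_\<Phi>': "continuous_on UNIV (\<lambda>z. \<Phi>' z v)"
  using times_differentiable_on_SucD[OF times_differentiable_on_\<Phi>[of "Suc 0"]] by auto

lemma projection_matrix_gauss_map:
  "y \<in> U \<Longrightarrow> projection_matrix (gauss_map M y) = \<Phi> (g y)"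
  using \<Phi>_eq gf fL by (auto simp: gauss_map_def)

lemma gauss_map_has_derivative:
  assumes "z \<in> L"
  shows "((\<lambda>y. projection_matrix (gauss_map M y)) has_derivative (\<lambda>w. \<Phi>' z (g' (f z) w)))
    (at (f z) within {x. smooth_point t M x})"
proof -
  obtain X where X: "open X" "U = M \<inter> X"
    using U by (auto simp: openin_open)
  have fz: "f z \<in> W" "f z \<in> X" using f_in_U[OF assms] W X by auto
  obtain d where d: "d > 0" "ball (f z) d \<subseteq> X"
    using X(1) fz(2) openE by blast
  have "((\<lambda>y. \<Phi> (g y)) has_derivative (\<lambda>w. \<Phi>' z (g' (f z) w))) (at (f z))"
    using has_derivative_compose[OF has_derivative_g[OF fz(1)] has_derivative_\<Phi>] gf[OF assms] by simp
  note D = has_derivative_at_withinI[OF this]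
  show ?thesis
  proof (rule has_derivative_transform_within[OF D d(1)])
    show "f z \<in> {x. smooth_point t M x}" using smooth_point_chart[OF assms] by simp
    fix y assume "y \<in> {x. smooth_point t M x}" "dist y (f z) < d"
    then have "y \<in> U" using d(2) X(2) smooth_point_in by (auto simp: dist_commute)
    then show "\<Phi> (g y) = projection_matrix (gauss_map M y)" by (simp add: projection_matrix_gauss_map)
  qed
qed

text \<open>\<open>D\<close> is determined only on the tangent space. Composing with the
  parametrisation f \<circ> p gives the honest derivative of \<Phi>, and f' z \<circ> p has exactly
  the tangent space as its range.\<close>

lemma gauss_map_derivative_image:
  assumes z: "z \<in> L"
    and D: "((\<lambda>y. projection_matrix (gauss_map M y)) has_derivative D)
      (at (f z) within {x. smooth_point t M x})"
  shows "D ` tangent_space {x. smooth_point t M x} (f z) = range (\<Phi>' z)"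
proof -
  let ?p = "closest_point L"
  note p = linear_closest_point[OF L(1)] and p_in = closest_point_subspace(1)[OF L(1)]
  have pz: "?p z = z" using z L closest_point_subspace_ident by blast
  have "(?p has_derivative ?p) (at z)"
    using p by (simp add: linear_conv_bounded_linear bounded_linear_imp_has_derivative)
  then have "((\<lambda>z. f (?p z)) has_derivative (\<lambda>v. f' z (?p v))) (at z)"
    using has_derivative_compose[of ?p ?p z UNIV f "f' z"] has_derivative_f[of z] pz by simp
  moreover have "range (\<lambda>z. f (?p z)) \<subseteq> {x. smooth_point t M x}"
    using smooth_point_chart[OF p_in] by auto
  then have "((\<lambda>y. projection_matrix (gauss_map M y)) has_derivative D)
      (at (f (?p z)) within range (\<lambda>z. f (?p z)))"
    using has_derivative_subset[OF D] pz by simp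
  ultimately have "((\<lambda>z. projection_matrix (gauss_map M (f (?p z)))) has_derivative
      (\<lambda>v. D (f' z (?p v)))) (at z)"
    using has_derivative_in_compose[of "\<lambda>z. f (?p z)" _ z UNIV] by blast
  moreover have "projection_matrix (gauss_map M (f (?p z))) = \<Phi> z" for z
    using \<Phi>_eq[OF p_in] closest_point_subspace_ident[OF L(1) p_in] by (simp add: gauss_map_def \<Phi>_def)
  ultimately have "(\<Phi> has_derivative (\<lambda>v. D (f' z (?p v)))) (at z)" by simp
  then have "\<Phi>' z = (\<lambda>v. D (f' z (?p v)))"
    using has_derivative_\<Phi> has_derivative_unique by blast
  then have "range (\<Phi>' z) = D ` f' z ` range ?p" by auto
  moreover have "tangent_space {x. smooth_point t M x} (f z) = f' z ` L"
    using smooth_point_chart[OF z]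
    by (subst tangent_space_openin[OF openin_smooth_points]) (simp_all only: mem_Collect_eq
        tangent_space_eq[OF z])
  ultimately show ?thesis
    by (simp only: range_closest_point[OF L(1)])
qed

end

section \<open>Generic frameworks\<close>

definition monomial :: "('v \<times> 'd \<Rightarrow> nat) \<Rightarrow> ('v::finite, 'd::finite) framework \<Rightarrow> real" where
  "monomial m \<rho> = (\<Prod>c\<in>UNIV. (\<rho> $ fst c $ snd c) ^ m c)"

text \<open>A list of terms may repeat exponents, so addition and multiplication need no collecting
  of like terms. Collecting is done once, when \<open>generic\<close> is applied.\<close>

definition poly_terms :: "(rat \<times> ('v \<times> 'd \<Rightarrow> nat)) list \<Rightarrow> ('v::finite, 'd::finite) framework \<Rightarrow> real" where
  "poly_terms ts \<rho> = (\<Sum>(c, m)\<leftarrow>ts. of_rat c * monomial m \<rho>)"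

definition rational_polynomial :: "(('v::finite, 'd::finite) framework \<Rightarrow> real) \<Rightarrow> bool" where
  "rational_polynomial F \<longleftrightarrow> (\<exists>ts. F = poly_terms ts)"

lemma poly_terms_simps [simp]:
  "poly_terms [] \<rho> = 0"
  "poly_terms ((c, m) # ts) \<rho> = of_rat c * monomial m \<rho> + poly_terms ts \<rho>"
  "poly_terms (ts @ us) \<rho> = poly_terms ts \<rho> + poly_terms us \<rho>"
  by (simp_all add: poly_terms_def)

lemma monomial_add: "monomial (\<lambda>c. m c + m' c) \<rho> = monomial m \<rho> * monomial m' \<rho>"
  by (simp add: monomial_def power_add prod.distrib)

lemma rational_polynomial_const: "rational_polynomial (\<lambda>\<rho>. of_rat c)"
  unfolding rational_polynomial_def
  by (intro exI[of _ "[(c, \<lambda>_. 0)]"]) (simp add: fun_eq_iff monomial_def)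

lemma rational_polynomial_0: "rational_polynomial (\<lambda>\<rho>. 0)"
  and rational_polynomial_1: "rational_polynomial (\<lambda>\<rho>. 1)"
  using rational_polynomial_const[of 0] rational_polynomial_const[of 1] by simp_all

lemma rational_polynomial_coordinate:
  "rational_polynomial (\<lambda>\<rho> :: ('v::finite, 'd::finite) framework. \<rho> $ u $ j)"
proof -
  define m where "m c = (if c = (u, j) then 1 else 0 :: nat)" for c
  have "monomial m \<rho> = (\<Prod>c\<in>UNIV. if c = (u, j) then \<rho> $ u $ j else 1)" for \<rho> :: "('v, 'd) framework"
    unfolding monomial_def by (rule prod.cong) (auto simp: m_def)
  then have "poly_terms [(1, m)] = (\<lambda>\<rho> :: ('v, 'd) framework. \<rho> $ u $ j)"
    by (intro ext) (simp only: poly_terms_simps prod.delta finite UNIV_I if_True of_rat_1 mult_1 add_0_right)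
  then show ?thesis
    unfolding rational_polynomial_def by (intro exI[of _ "[(1, m)]"]) (rule sym)
qed

lemma rational_polynomial_add:
  "rational_polynomial F \<Longrightarrow> rational_polynomial G \<Longrightarrow> rational_polynomial (\<lambda>\<rho>. F \<rho> + G \<rho>)"
  unfolding rational_polynomial_def
proof (elim exE)
  fix ts us assume "F = poly_terms ts" "G = poly_terms us"
  then show "\<exists>vs. (\<lambda>\<rho>. F \<rho> + G \<rho>) = poly_terms vs"
    by (intro exI[of _ "ts @ us"]) (simp add: fun_eq_iff)
qed

lemma rational_polynomial_mult:
  assumes "rational_polynomial F" "rational_polynomial G"
  shows "rational_polynomial (\<lambda>\<rho>. F \<rho> * G \<rho>)"
proof -
  obtain ts us where F: "F = poly_terms ts" and G: "G = poly_terms us"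
    using assms by (auto simp: rational_polynomial_def)
  have "poly_terms (map (\<lambda>(c', m'). (c * c', \<lambda>x. m x + m' x)) us) \<rho>
      = of_rat c * monomial m \<rho> * poly_terms us \<rho>" for c m \<rho>
    by (induction us) (auto simp: monomial_add of_rat_mult algebra_simps)
  then have "rational_polynomial (\<lambda>\<rho>. of_rat c * monomial m \<rho> * poly_terms us \<rho>)" for c m
    unfolding rational_polynomial_def
    by (intro exI[of _ "map (\<lambda>(c', m'). (c * c', \<lambda>x. m x + m' x)) us"] ext) (rule sym)
  then have "rational_polynomial (\<lambda>\<rho>. poly_terms ts \<rho> * poly_terms us \<rho>)"
    by (induction ts) (auto simp: distrib_right intro!: rational_polynomial_add rational_polynomial_0)
  then show ?thesis by (simp add: F G)
qed

lemma rational_polynomial_diff: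
  assumes "rational_polynomial F" "rational_polynomial G"
  shows "rational_polynomial (\<lambda>\<rho>. F \<rho> - G \<rho>)"
  using rational_polynomial_add[OF assms(1) rational_polynomial_mult[OF rational_polynomial_const[of
      "-1"] assms(2)]]
  by (simp add: of_rat_minus)

lemma rational_polynomial_sum:
  "(\<And>i. i \<in> I \<Longrightarrow> rational_polynomial (F i)) \<Longrightarrow> rational_polynomial (\<lambda>\<rho>. \<Sum>i\<in>I. F i \<rho>)"
  by (induction I rule: infinite_finite_induct)
    (auto intro: rational_polynomial_add rational_polynomial_0)

lemma rational_polynomial_prod:
  "(\<And>i. i \<in> I \<Longrightarrow> rational_polynomial (F i)) \<Longrightarrow> rational_polynomial (\<lambda>\<rho>. \<Prod>i\<in>I. F i \<rho>)"
  by (induction I rule: infinite_finite_induct)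
    (auto intro: rational_polynomial_mult rational_polynomial_1)

lemma rational_polynomial_det:
  fixes A :: "('v::finite, 'd::finite) framework \<Rightarrow> real^'n^'n"
  assumes "\<And>i j. rational_polynomial (\<lambda>\<rho>. A \<rho> $ i $ j)"
  shows "rational_polynomial (\<lambda>\<rho>. det (A \<rho>))"
proof -
  have "rational_polynomial (\<lambda>\<rho> :: ('v, 'd) framework. of_int (sign p))" for p :: "'n \<Rightarrow> 'n"
    using rational_polynomial_const[of "of_int (sign p)"] by simp
  then show ?thesis
    unfolding det_def
    by (intro rational_polynomial_sum rational_polynomial_mult rational_polynomial_prod assms)
qed

text \<open>\<open>p\<close> collects like terms. If the polynomial vanished at the generic \<rho>,
  all collected coefficients would be 0, and then it would vanish at \<rho>0 too.\<close>

lemma generic_poly_terms: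
  fixes \<rho> \<rho>0 :: "('v::finite, 'd::finite) framework"
  assumes gen: "generic \<rho>" and nz: "poly_terms ts \<rho>0 \<noteq> 0"
  shows "poly_terms ts \<rho> \<noteq> 0"
proof
  assume 0: "poly_terms ts \<rho> = 0"
  define p where "p us m = (\<Sum>(c, m')\<leftarrow>us. if m' = m then c else 0)" for us :: "(rat \<times> ('v \<times> 'd \<Rightarrow> nat))
      list" and m
  have out: "p us m = 0" if "m \<notin> snd ` set us" for us m
    using that by (induction us) (auto simp: p_def)
  have fin: "finite {m. p ts m \<noteq> 0}"
    by (rule finite_subset[of _ "snd ` set ts"]) (use out in blast, simp)
  have eq: "(\<Sum>m\<in>S. of_rat (p us m) * monomial m \<sigma>) = poly_terms us \<sigma>"
    if "finite S" "snd ` set us \<subseteq> S" for S us \<sigma>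
    using that(2)
  proof (induction us)
    case Nil
    then show ?case by (simp add: p_def)
  next
    case (Cons x us)
    obtain c m' where x: "x = (c, m')" by force
    have "(\<Sum>m\<in>S. of_rat (p (x # us) m) * monomial m \<sigma>)
        = (\<Sum>m\<in>S. (if m = m' then of_rat c * monomial m' \<sigma> else 0) + of_rat (p us m) * monomial m \<sigma>)"
      by (rule sum.cong) (auto simp: p_def x of_rat_add algebra_simps)
    then show ?case
      using Cons x that(1) by (simp add: sum.distrib)
  qed
  have "(\<Sum>m | p ts m \<noteq> 0. of_rat (p ts m) * monomial m \<sigma>) = poly_terms ts \<sigma>" for \<sigma>
  proof -
    have "(\<Sum>m | p ts m \<noteq> 0. of_rat (p ts m) * monomial m \<sigma>)
        = (\<Sum>m\<in>snd ` set ts. of_rat (p ts m) * monomial m \<sigma>)"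
      using out by (intro sum.mono_neutral_left) auto
    then show ?thesis using eq[of "snd ` set ts" ts] by simp
  qed
  note eq' = this
  have "(\<Sum>m | p ts m \<noteq> 0. of_rat (p ts m) * monomial m \<rho>) = 0"
    using eq'[of \<rho>] 0 by simp
  then have "p ts m = 0" for m
    by (rule gen[unfolded generic_def monomial_def[symmetric], rule_format, OF fin])
  then have "poly_terms ts \<rho>0 = 0" using eq'[of \<rho>0] by simp
  then show False using nz by simp
qed

text \<open>The digits below position n contribute less than N^n (\<open>less\<close>), so division
  by N^n isolates the top digit; the rest is induction.\<close>

lemma digits_unique:
  fixes a b :: "nat \<Rightarrow> nat"
  assumes "\<And>i. i < n \<Longrightarrow> a i < N" "\<And>i. i < n \<Longrightarrow> b i < N"
    "(\<Sum>i<n. a i * N ^ i) = (\<Sum>i<n. b i * N ^ i)" "i < n"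
  shows "a i = b i"
  using assms
proof (induction n arbitrary: i)
  case (Suc n)
  have less: "(\<Sum>i<n. c i * N ^ i) < N ^ n" if "\<And>i. i < n \<Longrightarrow> c i < N" for c n
    using that
  proof (induction n)
    case (Suc n)
    have "(\<Sum>i<Suc n. c i * N ^ i) < N ^ n + c n * N ^ n"
      using Suc by simp
    also have "\<dots> = (1 + c n) * N ^ n" by simp
    also have "\<dots> \<le> N * N ^ n"
      using Suc.prems[of n] by (intro mult_right_mono) auto
    finally show ?case by simp
  qed simp
  let ?A = "\<Sum>i<n. a i * N ^ i" and ?B = "\<Sum>i<n. b i * N ^ i"
  have A: "?A < N ^ n" and B: "?B < N ^ n"
    using less[of n a] less[of n b] Suc.prems(1,2) by auto
  have eq: "?A + a n * N ^ n = ?B + b n * N ^ n"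
    using Suc.prems(3) by simp
  have pos: "N ^ n \<noteq> 0" using A by linarith
  have "a n = (?A + a n * N ^ n) div N ^ n" using div_mult_self1[OF pos] A by simp
  also have "\<dots> = b n" unfolding eq using div_mult_self1[OF pos] B by simp
  finally have n: "a n = b n" .
  then have "?A = ?B" using eq by simp
  then show ?case
    using Suc.IH[OF Suc.prems(1,2)] Suc.prems(4) n by (cases "i = n") auto
qed simp

text \<open>Kronecker substitution \<open>x\<^sub>i = s ^ (N ^ i)\<close> with \<open>N\<close> above all exponents keeps the monomials apart.\<close>

lemma nonzero_coefficient_imp_nonzero_value:
  fixes p :: "('v::finite \<times> 'd::finite \<Rightarrow> nat) \<Rightarrow> rat"
  assumes fin: "finite {m. p m \<noteq> 0}" and m0: "p m0 \<noteq> 0"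
  shows "\<exists>\<rho>. (\<Sum>m | p m \<noteq> 0. of_rat (p m) * monomial m \<rho>) \<noteq> 0"
proof -
  let ?S = "{m. p m \<noteq> 0}"
  obtain idx :: "'v \<times> 'd \<Rightarrow> nat" where idx: "bij_betw idx UNIV {..<CARD('v \<times> 'd)}"
    using ex_bij_betw_finite_nat[of "UNIV :: ('v \<times> 'd) set"] by (auto simp: lessThan_atLeast0)
  define N where "N = Suc (Max ((\<lambda>(m, c). m c) ` (?S \<times> UNIV)))"
  have N: "m c < N" if "m \<in> ?S" for m c
    unfolding N_def less_Suc_eq_le using fin that by (intro Max_ge) auto
  define e where "e m = (\<Sum>c\<in>UNIV. m c * N ^ idx c)" for m
  have inj: "m = m'" if m: "m \<in> ?S" "m' \<in> ?S" "e m = e m'" for m m'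
  proof
    fix c
    let ?j = "inv_into UNIV idx"
    have j: "?j (idx c) = c" for c
      using idx by (simp add: bij_betw_def)
    have e: "e m = (\<Sum>i<CARD('v \<times> 'd). m (?j i) * N ^ i)" for m
      unfolding e_def using sum.reindex_bij_betw[OF idx, of "\<lambda>i. m (?j i) * N ^ i"] by (simp only: j)
    have "idx c < CARD('v \<times> 'd)" using bij_betwE[OF idx] by blast
    then have "m (?j (idx c)) = m' (?j (idx c))"
      using digits_unique[of "CARD('v \<times> 'd)" "\<lambda>i. m (?j i)" N "\<lambda>i. m' (?j i)" "idx c"]
        N m(1,2) m(3)[unfolded e] by blast
    then show "m c = m' c" by (simp only: j)
  qed
  define q where "q = (\<Sum>m\<in>?S. monom (of_rat (p m) :: real) (e m))"
  have "coeff q (e m0) = (\<Sum>m\<in>?S. if m = m0 then of_rat (p m0) else 0)"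
    unfolding q_def coeff_sum using inj m0 by (intro sum.cong) auto
  then have "q \<noteq> 0" using m0 fin by auto
  then obtain s where s: "poly q s \<noteq> 0" using poly_all_0_iff_0 by blast
  let ?\<rho> = "(\<chi> u j. s ^ (N ^ idx (u, j))) :: real^'d^'v"
  have "monomial m ?\<rho> = s ^ e m" for m
    unfolding monomial_def e_def power_sum
    by (rule prod.cong) (simp_all add: power_mult[symmetric] mult.commute)
  then have "(\<Sum>m\<in>?S. of_rat (p m) * monomial m ?\<rho>) = poly q s"
    by (simp add: q_def poly_sum poly_monom)
  then show ?thesis using s by metis
qed

section \<open>Density of the generic frameworks\<close>

lemma poly_terms_line:
  "\<exists>q. \<forall>s. poly_terms ts (a + s *\<^sub>R b) = poly q s"
proof (intro exI allI)
  fix s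
  show "poly_terms ts (a + s *\<^sub>R b) = poly (\<Sum>(c, m)\<leftarrow>ts. smult (of_rat c)
      (\<Prod>x\<in>UNIV. [:a $ fst x $ snd x, b $ fst x $ snd x:] ^ m x)) s"
    by (induction ts) (auto simp: monomial_def poly_prod)
qed

text \<open>Baire category for the countably many rational polynomials that are not identically zero
  as functions. Their nonvanishing sets are open. They are dense because on the line from any point
  a to a point of nonvanishing there are only finitely many zeros, so a is a limit of nonzeros. A
  common nonvanishing point is generic since a nonzero coefficient forces a nonzero value
  somewhere.\<close>

lemma closure_generic: "closure {\<rho> :: ('v::finite, 'd::finite) framework. generic \<rho>} = UNIV"
proof -
  let ?G = "(\<lambda>ts. {\<rho> :: ('v, 'd) framework. poly_terms ts \<rho> \<noteq> 0}) ` {ts. \<exists>\<rho> :: ('v, 'd) framework.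
      poly_terms ts \<rho> \<noteq> 0}"
  have countable: "countable ?G"
  proof -
    have "\<exists>h :: 'v \<times> 'd \<Rightarrow> nat. inj h"
      using finite_imp_inj_to_nat_seg[of "UNIV :: ('v \<times> 'd) set"] by auto
    then have "countable (UNIV :: ('v \<times> 'd) set)" by (simp add: countable_def)
    have "countable (UNIV :: ('v \<times> 'd \<Rightarrow> nat) set)"
      using countable_PiE[of "UNIV :: ('v \<times> 'd) set" "\<lambda>_. UNIV :: nat set"]
      by (simp add: PiE_UNIV_domain)
    then have "countable ((UNIV :: rat set) \<times> (UNIV :: ('v \<times> 'd \<Rightarrow> nat) set))"
      by (intro countable_SIGMA) auto
    then have "countable (lists ((UNIV :: rat set) \<times> (UNIV :: ('v \<times> 'd \<Rightarrow> nat) set)))"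
      by (rule countable_lists)
    then show ?thesis
      by (intro countable_image) (simp add: countable_subset[OF subset_UNIV])
  qed
  have cont: "continuous_on UNIV (poly_terms ts)" for ts :: "(rat \<times> ('v \<times> 'd \<Rightarrow> nat)) list"
  proof (induction ts)
    case (Cons x ts)
    obtain c m where x: "x = (c, m)" by force
    have "poly_terms (x # ts) = (\<lambda>\<rho>. of_rat c * monomial m \<rho> + poly_terms ts \<rho>)"
      by (simp add: x fun_eq_iff)
    then show ?case
      unfolding monomial_def using Cons by (auto intro!: continuous_intros)
  qed (simp add: poly_terms_def)
  have "UNIV \<subseteq> closure (\<Inter>?G)"
  proof (rule Baire[OF closed_UNIV countable])
    fix T assume "T \<in> ?G"
    then obtain ts \<rho>0 where T: "T = {\<rho>. poly_terms ts \<rho> \<noteq> 0}" and \<rho>0: "poly_terms ts \<rho>0 \<noteq> 0" by blast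
    have "open T"
      unfolding T by (intro open_Collect_neq cont continuous_on_const)
    moreover have "a \<in> closure T" for a
    proof -
      obtain q where q: "\<And>s. poly_terms ts (a + s *\<^sub>R (\<rho>0 - a)) = poly q s"
        using poly_terms_line by blast
      have "poly q 1 \<noteq> 0" using q[of 1] \<rho>0 by simp
      then have "finite {s. poly q s = 0}" by (intro poly_roots_finite) auto
      from islimpt_finite[OF this, of 0]
      have "\<forall>\<^sub>F s in at 0. poly q s \<noteq> 0"
        by (simp add: islimpt_iff_eventually)
      then have ev: "\<forall>\<^sub>F s in at 0. a + s *\<^sub>R (\<rho>0 - a) \<in> closure T"
        by eventually_elim (rule subsetD[OF closure_subset], simp add: T q)
      have "((\<lambda>s::real. a + s *\<^sub>R (\<rho>0 - a)) \<longlongrightarrow> a + 0 *\<^sub>R (\<rho>0 - a)) (at 0)"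
        by (intro tendsto_intros)
      then show ?thesis
        using Lim_in_closed_set[OF closed_closure ev] by simp
    qed
    ultimately show "openin (top_of_set UNIV) T \<and> UNIV \<subseteq> closure T" by auto
  qed
  moreover have "\<Inter>?G \<subseteq> {\<rho>. generic \<rho>}"
  proof
    fix \<rho> assume \<rho>: "\<rho> \<in> \<Inter>?G"
    show "\<rho> \<in> {\<rho>. generic \<rho>}"
    proof (intro CollectI, unfold generic_def monomial_def[symmetric], intro allI impI, rule ccontr)
      fix p :: "('v \<times> 'd \<Rightarrow> nat) \<Rightarrow> rat" and m
      assume fin: "finite {m. p m \<noteq> 0}" and 0: "(\<Sum>m | p m \<noteq> 0. of_rat (p m) * monomial m \<rho>) = 0"
        and m: "p m \<noteq> 0"
      obtain ms where ms: "set ms = {m. p m \<noteq> 0}" "distinct ms"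
        using finite_distinct_list[OF fin] by blast
      let ?ts = "map (\<lambda>m. (p m, m)) ms"
      have eq: "poly_terms ?ts \<sigma> = (\<Sum>m | p m \<noteq> 0. of_rat (p m) * monomial m \<sigma>)" for \<sigma>
        using ms by (simp add: poly_terms_def o_def sum_list_distinct_conv_sum_set)
      then have "\<exists>\<sigma>. poly_terms ?ts \<sigma> \<noteq> 0"
        using nonzero_coefficient_imp_nonzero_value[OF fin m] by metis
      then have "poly_terms ?ts \<rho> \<noteq> 0" using \<rho> by blast
      then show False using eq 0 by simp
    qed
  qed
  ultimately show ?thesis
    using closure_mono by blast
qed

text \<open>Choose a basis \<open>B0\<close> of the range at \<rho>0 among the images of basis
  vectors and complete it by standard unit vectors. Replacing \<rho>0 by a variable \<sigma> in the
  rows from \<open>B0\<close> gives a matrix \<open>C\<close> whose determinant is a rational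
  polynomial, nonzero at \<rho>0 and hence at \<rho>. So the range at \<rho> together with the added
  unit vectors spans everything, which bounds its dimension from below.\<close>

lemma generic_rank_maximal:
  fixes A :: "('v::finite, 'd::finite) framework \<Rightarrow> 'b::euclidean_space \<Rightarrow> real^'m"
  assumes lin: "\<And>\<rho>. linear (A \<rho>)" and pol: "\<And>b i. b \<in> Basis \<Longrightarrow> rational_polynomial (\<lambda>\<rho>. A \<rho> b $ i)"
    and gen: "generic \<rho>"
  shows "dim (range (A \<rho>0)) \<le> dim (range (A \<rho>))"
proof -
  have range: "range (A \<sigma>) = span (A \<sigma> ` Basis)" for \<sigma>
    using linear_span_image[OF lin] by (metis span_Basis)
  obtain B0 where B0: "B0 \<subseteq> A \<rho>0 ` Basis" "independent B0" "A \<rho>0 ` Basis \<subseteq> span B0"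
    using maximal_independent_subset by metis
  have "span B0 = range (A \<rho>0)"
    unfolding range using B0(1,3) by (metis span_mono span_span subset_antisym)
  then have card_B0: "card B0 = dim (range (A \<rho>0))"
    using B0(2) by (metis dim_eq_card_independent dim_span)
  obtain B where B: "B0 \<subseteq> B" "B \<subseteq> B0 \<union> Basis" "independent B" "B0 \<union> Basis \<subseteq> span B"
    using maximal_independent_subset_extend[OF Un_upper1 B0(2), of Basis] by metis
  have "span (Basis :: (real^'m) set) \<subseteq> span B" using B(4) by (intro span_minimal) auto
  then have spanB: "span B = UNIV" by auto
  then have "card B = CARD('m)"
    using B(3) by (metis dim_UNIV dim_span dim_eq_card_independent DIM_cart DIM_real mult.right_neutral)
  moreover have finB: "finite B" using B(3) independent_imp_finite by blast
  ultimately obtain h :: "'m \<Rightarrow> real^'m" where h: "bij_betw h UNIV B"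
    using finite_same_card_bij[of "UNIV :: 'm set" B] by auto
  define pre where "pre = inv_into Basis (A \<rho>0)"
  have pre: "pre w \<in> Basis" "A \<rho>0 (pre w) = w" if "w \<in> B0" for w
    using subsetD[OF B0(1) that] by (simp_all add: pre_def inv_into_into f_inv_into_f)
  define C where "C \<sigma> = (\<chi> i. if h i \<in> B0 then A \<sigma> (pre (h i)) else h i)" for \<sigma>
  have rows_C: "rows (C \<sigma>) = (\<lambda>i. if h i \<in> B0 then A \<sigma> (pre (h i)) else h i) ` UNIV" for \<sigma>
    by (auto simp: rows_def row_def C_def)
  have det_iff: "det (C \<sigma>) \<noteq> 0 \<longleftrightarrow> span (rows (C \<sigma>)) = UNIV" for \<sigma>
    using matrix_left_invertible_span_rows[of "C \<sigma>"] invertible_left_inverse[of "C \<sigma>"]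
    by (simp add: invertible_det_nz)
  have "rows (C \<rho>0) = range h"
    unfolding rows_C by (rule image_cong) (use pre in auto)
  then have "det (C \<rho>0) \<noteq> 0"
    using h spanB by (simp add: det_iff bij_betw_def)
  moreover have "rational_polynomial (\<lambda>\<sigma>. det (C \<sigma>))"
  proof (rule rational_polynomial_det)
    fix i j
    show "rational_polynomial (\<lambda>\<sigma>. C \<sigma> $ i $ j)"
    proof (cases "h i \<in> B0")
      case True
      then show ?thesis using pol pre by (simp add: C_def)
    next
      case False
      then have "h i \<in> Basis" using h B(2) by (auto simp: bij_betw_def)
      then have "h i $ j = 0 \<or> h i $ j = 1" by (auto simp: Basis_vec_def axis_def)
      then show ?thesis using False rational_polynomial_0 rational_polynomial_1 by (auto simp: C_def)
    qed
  qed
  ultimately have "det (C \<rho>) \<noteq> 0"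
    using generic_poly_terms[OF gen] by (auto simp: rational_polynomial_def fun_eq_iff)
  then have span_C: "span (rows (C \<rho>)) = UNIV" by (simp add: det_iff)
  obtain E where E: "independent E" "range (A \<rho>) \<subseteq> span E" "card E = dim (range (A \<rho>))"
    using basis_exists[of "range (A \<rho>)"] by metis
  have "rows (C \<rho>) \<subseteq> span (E \<union> (B - B0))"
  proof
    fix w assume "w \<in> rows (C \<rho>)"
    then obtain i where w: "w = (if h i \<in> B0 then A \<rho> (pre (h i)) else h i)" unfolding rows_C by blast
    show "w \<in> span (E \<union> (B - B0))"
    proof (cases "h i \<in> B0")
      case True
      then have "w \<in> span E" using w E(2) by auto
      then show ?thesis using span_mono[of E "E \<union> (B - B0)"] by blast
    next
      case False
      then show ?thesis using w h by (auto simp: bij_betw_def intro: span_base)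
    qed
  qed
  then have "UNIV \<subseteq> span (E \<union> (B - B0))"
    using span_C by (metis span_minimal subspace_span)
  then have "dim (UNIV :: (real^'m) set) \<le> card (E \<union> (B - B0))"
    using E(1) finB by (intro dim_le_card) (auto dest: independent_imp_finite)
  also have "\<dots> \<le> card E + card (B - B0)" by (rule card_Un_le)
  also have "card (B - B0) = card B - card B0"
    using B(1) finB finite_subset by (intro card_Diff_subset) auto
  finally have "CARD('m) \<le> dim (range (A \<rho>)) + (CARD('m) - card B0)"
    using E(3) \<open>card B = CARD('m)\<close> by simp
  moreover have "card B0 \<le> CARD('m)"
    using card_mono[OF finB B(1)] \<open>card B = CARD('m)\<close> by simp
  ultimately show ?thesis using card_B0 by linarith
qed

section \<open>Negligible sets of critical values\<close>

text \<open>The library's version of Sard's theorem wants the coordinates to be indexed by a well-ordered type.\<close>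

typedef ('a::finite) windex = "{..<CARD('a)}"
  by (rule exI[of _ 0]) simp

instantiation windex :: (finite) wellorder
begin

definition "x \<le> y \<longleftrightarrow> Rep_windex x \<le> Rep_windex y"
definition "x < y \<longleftrightarrow> Rep_windex x < Rep_windex y"

instance
proof
  fix P :: "'a windex \<Rightarrow> bool" and x
  assume step: "\<And>x. (\<And>y. y < x \<Longrightarrow> P y) \<Longrightarrow> P x"
  show "P x"
  proof (induction x rule: measure_induct_rule[of Rep_windex])
    case (less x)
    show ?case by (rule step) (rule less.IH, simp only: less_windex_def)
  qed
qed (auto simp: less_eq_windex_def less_windex_def Rep_windex_inject)

end

lemma bij_betw_windex: "bij_betw Rep_windex (UNIV :: 'a::finite windex set) {..<CARD('a)}"
  by (simp add: bij_betw_def inj_def Rep_windex_inject type_definition.Rep_range[OF type_definition_windex])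

instance windex :: (finite) finite
proof
  show "finite (UNIV :: 'a windex set)"
    using bij_betw_finite[OF bij_betw_windex] by blast
qed

text \<open>\<open>A\<close> and \<open>B\<close> are mutually inverse relabellings of coordinates;
  conjugating by them preserves both criticality and negligibility.\<close>

lemma negligible_critical_values:
  fixes H :: "real^'n \<Rightarrow> real^'n"
  assumes der: "\<And>x. x \<in> S \<Longrightarrow> (H has_derivative H' x) (at x)"
    and crit: "\<And>x. x \<in> S \<Longrightarrow> \<not> surj (H' x)"
  shows "negligible (H ` S)"
proof -
  have "card (UNIV :: 'n windex set) = card (UNIV :: 'n set)"
    using bij_betw_same_card[OF bij_betw_windex[where 'a='n]] by simp
  then obtain h :: "'n \<Rightarrow> 'n windex" where h: "bij h"
    using finite_same_card_bij[of "UNIV :: 'n set" "UNIV :: 'n windex set"] by auto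
  define A where "A x = (\<chi> i. x $ inv h i)" for x :: "real^'n"
  define B where "B y = (\<chi> i. y $ h i)" for y :: "real^'n windex"
  have AB: "A (B y) = y" and BA: "B (A x) = x" for x y
    using h by (simp_all add: A_def B_def vec_eq_iff bij_is_surj surj_f_inv_f bij_is_inj)
  have linA: "bounded_linear A" and linB: "bounded_linear B"
    unfolding A_def B_def linear_conv_bounded_linear[symmetric]
    by (auto intro!: linearI simp: vec_eq_iff)
  have "negligible ((\<lambda>y. A (H (B y))) ` A ` S)"
  proof (rule baby_Sard)
    fix y assume "y \<in> A ` S"
    then have By: "B y \<in> S" using BA by auto
    have "((\<lambda>y. A (H (B y))) has_derivative (\<lambda>v. A (H' (B y) (B v)))) (at y)"
      by (intro bounded_linear.has_derivative[OF linA]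
          has_derivative_compose[OF bounded_linear_imp_has_derivative[OF linB] der[OF By]])
    then show D: "((\<lambda>y. A (H (B y))) has_derivative (\<lambda>v. A (H' (B y) (B v)))) (at y within A ` S)"
      by (rule has_derivative_at_withinI)
    let ?D = "\<lambda>v. A (H' (B y) (B v))"
    have lin: "linear ?D" using D has_derivative_linear by blast
    have "\<not> surj ?D"
    proof
      assume s: "surj ?D"
      have "surj (H' (B y))"
      proof (rule surjI)
        fix w
        have "?D (inv ?D (A w)) = A w" by (rule surj_f_inv_f[OF s])
        then show "H' (B y) (B (inv ?D (A w))) = w" by (metis BA)
      qed
      then show False using crit[OF By] by blast
    qed
    then have "rank (matrix ?D) \<noteq> CARD('n windex)"
      using full_rank_surjective[of "matrix ?D"] lin by (simp add: matrix_works)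
    then show "rank (matrix ?D) < CARD('n windex)"
      using rank_bound[of "matrix ?D"] by simp
  qed simp
  moreover have "B differentiable_on (\<lambda>y. A (H (B y))) ` A ` S"
    using linB by (simp add: differentiable_on_def bounded_linear_imp_differentiable)
  moreover have "DIM(real^'n windex) \<le> DIM(real^'n)"
    using \<open>card (UNIV :: 'n windex set) = card (UNIV :: 'n set)\<close> by simp
  ultimately have "negligible (B ` (\<lambda>y. A (H (B y))) ` A ` S)"
    using negligible_differentiable_image_negligible by blast
  moreover have "B ` (\<lambda>y. A (H (B y))) ` A ` S = H ` S"
    by (simp add: image_image BA)
  ultimately show ?thesis by simp
qed

text \<open>Sard for \<pi> \<circ> F on \<open>P\<close>. The map \<open>H\<close> transports it to
  R^e: it is \<pi> \<circ> F on \<open>T\<close>, with \<open>P\<close> parametrised by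
  \<open>k\<close>, and the identity on the complement of \<open>T\<close>. A surjective
  \<open>H'\<close> would make the projected derivative of \<open>F\<close> carry \<open>P\<close>
  onto \<open>T\<close>.\<close>

lemma negligible_projected_critical_values:
  fixes F :: "'a::euclidean_space \<Rightarrow> real^'e" and T :: "(real^'e) set"
  assumes P: "subspace P" and T: "subspace T" and dim: "dim P \<le> dim T" and S: "S \<subseteq> P"
    and der: "\<And>p. (F has_derivative F' p) (at p)"
    and crit: "\<And>p. p \<in> S \<Longrightarrow> (\<lambda>v. closest_point T (F' p v)) ` P \<noteq> T"
  shows "negligible {x. closest_point T x \<in> closest_point T ` F ` S}"
proof -
  let ?\<pi> = "closest_point T"
  have lin\<pi>: "linear ?\<pi>" by (rule linear_closest_point[OF T])
  have \<pi>T: "?\<pi> x \<in> T" for x by (rule closest_point_subspace(1)[OF T])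
  have \<pi>_id: "?\<pi> x = x" if "x \<in> T" for x by (rule closest_point_subspace_ident[OF T that])
  have \<pi>0: "?\<pi> (x - ?\<pi> x) = 0" for x by (simp add: linear_diff[OF lin\<pi>] \<pi>_id \<pi>T)
  obtain k where k: "linear k" "k ` T = P" "range k = P"
    by (rule linear_subset_exists_basis_map[OF P T dim])
  define H where "H y = ?\<pi> (F (k (?\<pi> y))) + (y - ?\<pi> y)" for y
  define H' where "H' y v = ?\<pi> (F' (k (?\<pi> y)) (k (?\<pi> v))) + (v - ?\<pi> v)" for y v
  define S' where "S' = {y. k (?\<pi> y) \<in> S}"
  have bl: "bounded_linear ?\<pi>" "bounded_linear k"
    using lin\<pi> k(1) by (simp_all add: linear_conv_bounded_linear)
  have "negligible (H ` S')"
  proof (rule negligible_critical_values)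
    fix y assume y: "y \<in> S'"
    have "((\<lambda>y. k (?\<pi> y)) has_derivative (\<lambda>v. k (?\<pi> v))) (at y)"
      using bounded_linear_compose[OF bl(2,1)] bounded_linear_imp_has_derivative by blast
    then show "(H has_derivative H' y) (at y)"
      unfolding H_def[abs_def] H'_def[abs_def]
      by (intro has_derivative_add has_derivative_diff has_derivative_ident
          bounded_linear.has_derivative[OF bl(1)] has_derivative_compose[OF _ der])
    show "\<not> surj (H' y)"
    proof
      assume surj: "surj (H' y)"
      have "(\<lambda>v. ?\<pi> (F' (k (?\<pi> y)) v)) ` P = T"
      proof (intro subset_antisym subsetI)
        fix w assume w: "w \<in> T"
        obtain v where "H' y v = w" using surj by (metis surj_def)
        then have "?\<pi> (H' y v) = w" using \<pi>_id[OF w] by simp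
        then have "?\<pi> (F' (k (?\<pi> y)) (k (?\<pi> v))) = w"
          by (simp add: H'_def linear_add[OF lin\<pi>] \<pi>0 \<pi>_id \<pi>T)
        moreover have "k (?\<pi> v) \<in> P" using k(3) by blast
        ultimately show "w \<in> (\<lambda>v. ?\<pi> (F' (k (?\<pi> y)) v)) ` P" by force
      qed (use \<pi>T in auto)
      then show False using crit y by (simp add: S'_def)
    qed
  qed
  moreover have "{x. ?\<pi> x \<in> ?\<pi> ` F ` S} \<subseteq> H ` S'"
  proof
    fix x assume "x \<in> {x. ?\<pi> x \<in> ?\<pi> ` F ` S}"
    then obtain p where p: "p \<in> S" "?\<pi> x = ?\<pi> (F p)" by auto
    then obtain \<tau> where \<tau>: "\<tau> \<in> T" "p = k \<tau>" using S k(2) by blast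
    let ?y = "\<tau> + (x - ?\<pi> x)"
    have y: "?\<pi> ?y = \<tau>" by (simp only: linear_add[OF lin\<pi>] \<pi>0 \<pi>_id[OF \<tau>(1)]) simp
    then have "H ?y = x" using p \<tau> by (simp add: H_def)
    moreover have "?y \<in> S'" using y p \<tau> by (simp add: S'_def)
    ultimately show "x \<in> H ` S'" by (metis imageI)
  qed
  ultimately show ?thesis by (rule negligible_subset)
qed

text \<open>The map \<open>J\<close> adds the complement of \<open>T\<close> as extra variables. Its
  derivative at (\<rho>, 0) has the right inverse w \<mapsto> (B (\<pi> w), w), so the open mapping
  theorem gives \<open>J\<close> an image with interior.\<close>

lemma projected_image_not_negligible:
  fixes F :: "'a::euclidean_space \<Rightarrow> 'b::euclidean_space" and T :: "'b set"
  assumes T: "subspace T" and N: "open N" "\<rho> \<in> N"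
    and der: "\<And>p. (F has_derivative F' p) (at p)"
    and surj: "range (\<lambda>v. closest_point T (F' \<rho> v)) = T"
  shows "\<not> negligible {x. closest_point T x \<in> closest_point T ` F ` N}"
proof -
  let ?\<pi> = "closest_point T"
  have lin\<pi>: "linear ?\<pi>" by (rule linear_closest_point[OF T])
  have \<pi>T: "?\<pi> x \<in> T" for x by (rule closest_point_subspace(1)[OF T])
  have \<pi>_id: "?\<pi> x = x" if "x \<in> T" for x by (rule closest_point_subspace_ident[OF T that])
  have bl: "bounded_linear ?\<pi>" using lin\<pi> by (simp add: linear_conv_bounded_linear)
  have "linear (\<lambda>v. ?\<pi> (F' \<rho> v))"
    using linear_compose[OF has_derivative_linear[OF der] lin\<pi>] by (simp add: o_def)
  from linear_exists_right_inverse_on[OF this subspace_UNIV]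
  obtain B where B: "linear B" "\<And>w. w \<in> T \<Longrightarrow> ?\<pi> (F' \<rho> (B w)) = w"
    unfolding surj by blast
  define J where "J = (\<lambda>(p, n). ?\<pi> (F p) + (n - ?\<pi> n))"
  let ?J' = "\<lambda>(v, n). ?\<pi> (F' \<rho> v) + (n - ?\<pi> n)"
  let ?X = "{x. ?\<pi> x \<in> ?\<pi> ` F ` N}"
  have contF: "continuous_on UNIV F"
    using der by (meson continuous_at_imp_continuous_on has_derivative_continuous)
  have "J (\<rho>, 0) \<in> interior (J ` (N \<times> UNIV))"
  proof (rule sussmann_open_mapping[where S = UNIV and f' = ?J' and g' = "\<lambda>w. (B (?\<pi> w), w)"])
    show "continuous_on UNIV J"
      unfolding J_def case_prod_unfold
      by (intro continuous_intros continuous_on_compose2[OF contF]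
          continuous_on_compose2[OF linear_continuous_on[OF bl]]) auto
    have "((\<lambda>z. ?\<pi> (F (fst z)) + (snd z - ?\<pi> (snd z))) has_derivative
        (\<lambda>z. ?\<pi> (F' \<rho> (fst z)) + (snd z - ?\<pi> (snd z)))) (at (\<rho>, 0))"
      by (intro has_derivative_add has_derivative_diff bounded_linear.has_derivative[OF bl]
          has_derivative_compose[OF has_derivative_fst[OF has_derivative_ident], of F "F' \<rho>"]
          has_derivative_snd has_derivative_ident) (simp add: der)
    then show "(J has_derivative ?J') (at (\<rho>, 0))"
      by (simp add: J_def case_prod_unfold)
    show "bounded_linear (\<lambda>w. (B (?\<pi> w), w))"
      using linear_compose[OF lin\<pi> B(1)]
      by (intro bounded_linear_Pair bounded_linear_ident) (simp add: linear_conv_bounded_linear o_def)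
    show "?J' \<circ> (\<lambda>w. (B (?\<pi> w), w)) = id"
      by (simp add: fun_eq_iff B(2) \<pi>T)
    show "(\<rho>, 0) \<in> interior (N \<times> UNIV)"
      using N by (simp add: interior_open open_Times)
  qed auto
  moreover have "J ` (N \<times> UNIV) \<subseteq> ?X"
  proof
    fix x assume "x \<in> J ` (N \<times> UNIV)"
    then obtain p n where p: "p \<in> N" "x = ?\<pi> (F p) + (n - ?\<pi> n)" by (auto simp: J_def)
    then have "?\<pi> x = ?\<pi> (F p)" by (simp add: linear_add[OF lin\<pi>] linear_diff[OF lin\<pi>] \<pi>_id \<pi>T)
    then show "x \<in> ?X" using p(1) by auto
  qed
  ultimately have "interior ?X \<noteq> {}" using interior_mono by blast
  then show ?thesis
    using negligible_subset[OF _ interior_subset] open_not_negligible[OF open_interior] by blast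
qed

section \<open>A linear slice for congruence\<close>

lemma compact_orthogonal_matrices: "compact {Q :: real^'n^'n. orthogonal_matrix Q}"
proof -
  let ?S = "{Q :: real^'n^'n. orthogonal_matrix Q}"
  have "norm Q \<le> real CARD('n) * real CARD('n)" if "Q \<in> ?S" for Q
  proof -
    have "\<bar>Q $ i $ j\<bar> \<le> 1" for i j
    proof -
      have "norm (row i Q) = 1"
        using that by (simp add: orthogonal_matrix_orthonormal_rows)
      then show ?thesis
        using component_le_norm_cart[of "row i Q" j] by (simp add: row_def)
    qed
    then have "norm (Q $ i) \<le> real CARD('n)" for i
      using norm_le_l1_cart[of "Q $ i"] sum_mono[of UNIV "\<lambda>j. \<bar>Q $ i $ j\<bar>" "\<lambda>_. 1"] by fastforce
    then have "(\<Sum>i\<in>UNIV. norm (Q $ i)) \<le> (\<Sum>i\<in>(UNIV :: 'n set). real CARD('n))"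
      by (intro sum_mono)
    moreover have "norm Q \<le> (\<Sum>i\<in>UNIV. norm (Q $ i))"
      unfolding norm_vec_def by (rule L2_set_le_sum) simp
    ultimately show ?thesis by simp
  qed
  then have "bounded ?S" by (auto simp: bounded_iff)
  moreover have "?S = (\<Inter>i. \<Inter>j. {Q. (\<Sum>k\<in>UNIV. Q $ k $ i * Q $ k $ j) = (if i = j then 1 else 0)})"
    by (auto simp: orthogonal_matrix vec_eq_iff matrix_matrix_mult_def transpose_def mat_def)
  then have "closed ?S"
    by (auto intro!: closed_INT closed_Collect_eq continuous_intros)
  ultimately show ?thesis by (simp add: compact_eq_bounded_closed)
qed

text \<open>These rotations are the variations against which a maximiser of the trace will be
  tested.\<close>

lemma ex_orthogonal_plane_rotation:
  fixes p q :: "'n::finite"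
  assumes "p \<noteq> q"
  obtains R :: "real^'n^'n" where "orthogonal_matrix R"
    "\<And>x k. (R *v x) $ k = (if k = p then cos \<theta> * x $ p - sin \<theta> * x $ q
      else if k = q then sin \<theta> * x $ p + cos \<theta> * x $ q else x $ k)"
proof -
  define f where "f x = (\<chi> k. if k = p then cos \<theta> * x $ p - sin \<theta> * x $ q
      else if k = q then sin \<theta> * x $ p + cos \<theta> * x $ q else x $ k)" for x :: "real^'n"
  have lin: "linear f"
    by (rule linearI) (simp_all add: f_def vec_eq_iff algebra_simps)
  have split: "(\<Sum>k\<in>UNIV. h k) = h p + h q + (\<Sum>k\<in>UNIV - {p, q}. h k)" for h :: "'n \<Rightarrow> real"
    using sum.subset_diff[of "{p, q}" UNIV h] assms by simp
  have "(cos \<theta> * u - sin \<theta> * v) * (cos \<theta> * u - sin \<theta> * v) + (sin \<theta> * u + cos \<theta> * v) * (sin \<theta> * u + cos \<theta> * v)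
      = ((sin \<theta>)\<^sup>2 + (cos \<theta>)\<^sup>2) * (u * u + v * v)" for u v
    unfolding power2_eq_square by algebra
  then have "(cos \<theta> * u - sin \<theta> * v) * (cos \<theta> * u - sin \<theta> * v) + (sin \<theta> * u + cos \<theta> * v) * (sin \<theta> * u +
      cos \<theta> * v)
      = u * u + v * v" for u v
    by simp
  then have "f x \<bullet> f x = x \<bullet> x" for x
    using assms by (simp add: inner_vec_def split f_def)
  then have "orthogonal_transformation f"
    using lin by (simp add: orthogonal_transformation norm_eq_sqrt_inner)
  then have "orthogonal_matrix (matrix f)" by (simp add: orthogonal_transformation_matrix)
  moreover have "(matrix f *v x) $ k = (if k = p then cos \<theta> * x $ p - sin \<theta> * x $ q
      else if k = q then sin \<theta> * x $ p + cos \<theta> * x $ q else x $ k)" for x k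
    using lin by (simp add: matrix_works f_def)
  ultimately show ?thesis using that by blast
qed

text \<open>An orthogonal \<open>Q\<close> that maximises the trace of \<open>Q X\<close> makes \<open>Q X\<close> symmetric.\<close>

lemma ex_orthogonal_symmetrize:
  fixes x :: "'n::finite \<Rightarrow> real^'n"
  obtains Q :: "real^'n^'n" where "orthogonal_matrix Q" "\<And>i j. (Q *v x i) $ j = (Q *v x j) $ i"
proof -
  let ?S = "{Q :: real^'n^'n. orthogonal_matrix Q}"
  let ?tr = "\<lambda>Q :: real^'n^'n. \<Sum>i\<in>UNIV. (Q *v x i) $ i"
  have "mat 1 \<in> ?S" by (simp add: orthogonal_matrix_id)
  moreover have "continuous_on ?S ?tr"
    unfolding matrix_vector_mult_def vec_lambda_beta by (intro continuous_intros)
  ultimately obtain Q where Q: "Q \<in> ?S" "\<And>R. R \<in> ?S \<Longrightarrow> ?tr R \<le> ?tr Q"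
    using continuous_attains_sup[OF compact_orthogonal_matrices] by blast
  have "(Q *v x p) $ q = (Q *v x q) $ p" for p q
  proof (cases "p = q")
    case False
    let ?y = "\<lambda>i. Q *v x i"
    \<comment> \<open>The change of the trace when \<open>Q\<close> is replaced by
      \<open>R ** Q\<close>. Its derivative at 0 is the asymmetry
      \<open>?y q $ p - ?y p $ q\<close>, which must vanish at a maximum.\<close>
    define h where "h \<theta> = (cos \<theta> - 1) * (?y p $ p + ?y q $ q) + sin \<theta> * (?y q $ p - ?y p $ q)" for \<theta>
    have "h \<theta> \<le> h 0" for \<theta>
    proof -
      obtain R :: "real^'n^'n" where R: "orthogonal_matrix R"
        "\<And>x k. (R *v x) $ k = (if k = p then cos \<theta> * x $ p - sin \<theta> * x $ q
          else if k = q then sin \<theta> * x $ p + cos \<theta> * x $ q else x $ k)"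
        by (rule ex_orthogonal_plane_rotation[OF False, where \<theta> = \<theta>], rule that)
      have "?tr (R ** Q) \<le> ?tr Q"
        using Q(1) R(1) by (intro Q(2)) (simp add: orthogonal_matrix_mul)
      moreover have split: "(\<Sum>k\<in>UNIV. h k) = h p + h q + (\<Sum>k\<in>UNIV - {p, q}. h k)" for h :: "'n \<Rightarrow> real"
        using sum.subset_diff[of "{p, q}" UNIV h] False by simp
      moreover have "((R ** Q) *v x i) $ i = (R *v ?y i) $ i" for i
        by (simp add: matrix_vector_mul_assoc)
      ultimately show ?thesis
        using False by (simp add: split R(2) h_def algebra_simps)
    qed
    moreover have "(h has_field_derivative (?y q $ p - ?y p $ q)) (at 0)"
      unfolding h_def by (auto intro!: derivative_eq_intros)
    ultimately show ?thesis
      using DERIV_local_max[of h _ 0 1] by fastforce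
  qed simp
  then show ?thesis using that[of Q] Q(1) by blast
qed

text \<open>Pinning \<open>w0\<close> removes the d translations. Symmetry of the d by d matrix of
  coordinates of the vertices \<open>w i\<close> removes the (d choose 2) rotations. Both conditions
  are linear.\<close>

definition congruence_slice :: "'v \<Rightarrow> ('d \<Rightarrow> 'v) \<Rightarrow> ('v::finite, 'd::finite) framework set" where
  "congruence_slice w0 w = {\<rho>. \<rho> $ w0 = 0 \<and> (\<forall>i j. \<rho> $ w i $ j = \<rho> $ w j $ i)}"

lemma subspace_congruence_slice: "subspace (congruence_slice w0 w)"
  by (auto simp: congruence_slice_def subspace_def)

lemma congruence_slice_representative:
  fixes \<rho> :: "('v::finite, 'd::finite) framework" and w :: "'d \<Rightarrow> 'v"
  obtains \<sigma> where "\<sigma> \<in> congruence_slice w0 w"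
    "\<And>u u'. norm (\<sigma> $ u - \<sigma> $ u') = norm (\<rho> $ u - \<rho> $ u')"
proof -
  obtain Q :: "real^'d^'d" where Q: "orthogonal_matrix Q"
    "\<And>i j. (Q *v (\<rho> $ w i - \<rho> $ w0)) $ j = (Q *v (\<rho> $ w j - \<rho> $ w0)) $ i"
    by (rule ex_orthogonal_symmetrize[of "\<lambda>i. \<rho> $ w i - \<rho> $ w0"], rule that)
  define \<sigma> where "\<sigma> = (\<chi> u. Q *v (\<rho> $ u - \<rho> $ w0))"
  have slice: "\<sigma> \<in> congruence_slice w0 w"
    using Q(2) by (simp add: congruence_slice_def \<sigma>_def)
  have "\<sigma> $ u - \<sigma> $ u' = Q *v (\<rho> $ u - \<rho> $ u')" for u u'
    by (simp add: \<sigma>_def matrix_vector_mult_diff_distrib)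
  moreover have "orthogonal_transformation ((*v) Q)"
    using Q(1) by (simp add: orthogonal_transformation_matrix)
  ultimately have norm: "norm (\<sigma> $ u - \<sigma> $ u') = norm (\<rho> $ u - \<rho> $ u')" for u u'
    by (simp add: orthogonal_transformation)
  show ?thesis by (rule that[OF slice norm])
qed

text \<open>The indicator vectors of the labels form an orthogonal basis.\<close>

lemma dim_labelled_coordinates:
  fixes \<kappa> :: "'v::finite \<times> 'd::finite \<Rightarrow> 'k" and A :: "('v \<times> 'd) set"
  shows "dim {x :: real^'d^'v. (\<forall>c. c \<notin> A \<longrightarrow> x $ fst c $ snd c = 0) \<and>
    (\<forall>c\<in>A. \<forall>c'\<in>A. \<kappa> c = \<kappa> c' \<longrightarrow> x $ fst c $ snd c = x $ fst c' $ snd c')} = card (\<kappa> ` A)"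
    (is "dim ?V = _")
proof -
  define e :: "'k \<Rightarrow> real^'d^'v"
    where "e k = (\<chi> u j. if (u, j) \<in> A \<and> \<kappa> (u, j) = k then 1 else 0)" for k
  have comp: "e k $ u $ j = (if (u, j) \<in> A \<and> \<kappa> (u, j) = k then 1 else 0)" for k u j
    by (simp add: e_def)
  have orth: "e k \<bullet> e k' = 0" if "k \<noteq> k'" for k k'
    using that by (auto simp: inner_vec_def comp intro!: sum.neutral)
  have nz: "e k \<noteq> 0" if "k \<in> \<kappa> ` A" for k
  proof -
    obtain c where "c \<in> A" "\<kappa> c = k" using \<open>k \<in> \<kappa> ` A\<close> by blast
    then have "e k $ fst c $ snd c = 1" by (simp add: comp)
    then show ?thesis by (metis zero_index zero_neq_one)
  qed
  have inj: "inj_on e (\<kappa> ` A)"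
    using orth nz by (intro inj_onI) (metis inner_eq_zero_iff)
  have "pairwise orthogonal (e ` \<kappa> ` A)"
    unfolding pairwise_def orthogonal_def
  proof (intro ballI impI)
    fix x y assume "x \<in> e ` \<kappa> ` A" "y \<in> e ` \<kappa> ` A" "x \<noteq> y"
    then obtain k k' where "x = e k" "y = e k'" by blast
    then show "x \<bullet> y = 0" using orth[of k k'] \<open>x \<noteq> y\<close> by (cases "k = k'") simp_all
  qed
  then have ind: "independent (e ` \<kappa> ` A)"
    by (rule pairwise_orthogonal_independent) (use nz in force)
  have sub: "e ` \<kappa> ` A \<subseteq> ?V" by (auto simp: comp)
  have "?V \<subseteq> span (e ` \<kappa> ` A)"
  proof
    fix x assume x: "x \<in> ?V"
    define c where "c = inv_into A \<kappa>"
    have c: "c k \<in> A" "\<kappa> (c k) = k" if "k \<in> \<kappa> ` A" for k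
      using that by (simp_all add: c_def inv_into_into f_inv_into_f)
    have "x = (\<Sum>k\<in>\<kappa> ` A. (x $ fst (c k) $ snd (c k)) *\<^sub>R e k)"
    proof (simp only: vec_eq_iff, intro allI)
      fix u j
      have "(\<Sum>k\<in>\<kappa> ` A. (x $ fst (c k) $ snd (c k)) *\<^sub>R e k) $ u $ j
          = (\<Sum>k\<in>\<kappa> ` A. if k = \<kappa> (u, j) then (if (u, j) \<in> A then x $ fst (c k) $ snd (c k) else 0) else 0)"
        unfolding sum_component by (rule sum.cong) (auto simp: comp)
      also have "\<dots> = x $ u $ j"
      proof (cases "(u, j) \<in> A")
        case True
        then have "\<kappa> (u, j) \<in> \<kappa> ` A" by blast
        moreover from c[OF this] True
        have "x $ fst (c (\<kappa> (u, j))) $ snd (c (\<kappa> (u, j))) = x $ fst (u, j) $ snd (u, j)"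
          using x by blast
        ultimately show ?thesis using True by (simp add: sum.delta)
      next
        case False
        then show ?thesis using x by auto
      qed
      finally show "x $ u $ j = (\<Sum>k\<in>\<kappa> ` A. (x $ fst (c k) $ snd (c k)) *\<^sub>R e k) $ u $ j" by simp
    qed
    also have "\<dots> \<in> span (e ` \<kappa> ` A)"
      by (intro span_sum span_scale span_base) auto
    finally show "x \<in> span (e ` \<kappa> ` A)" .
  qed
  then have "dim ?V = card (e ` \<kappa> ` A)"
    using basis_card_eq_dim[OF sub _ ind] by simp
  then show ?thesis by (simp add: card_image[OF inj])
qed

lemma dim_congruence_slice:
  fixes w0 :: "'v::finite" and w :: "'d::finite \<Rightarrow> 'v"
  assumes w: "inj w" "w0 \<notin> range w"
  shows "dim (congruence_slice w0 w) = CARD('v) * CARD('d) - (CARD('d) + 1 choose 2)"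
proof -
  let ?d = "CARD('d)"
  \<comment> \<open>Coordinates forced to agree share a label: (w i, j) and (w j, i) both get the
    unordered pair {i, j}, every other coordinate labels itself. The pairs are the subsets of size 1
    or 2, d + (d choose 2) in number.\<close>
  define \<kappa> where "\<kappa> = (\<lambda>(u, j :: 'd). if u \<in> range w then Inl {inv w u, j} else Inr (u, j))"
  let ?A = "(UNIV - {w0}) \<times> (UNIV :: 'd set)"
  have \<kappa>w: "\<kappa> (w i, j) = Inl {i, j}" for i j
    using w(1) by (simp add: \<kappa>_def)
  have "congruence_slice w0 w = {x :: real^'d^'v. (\<forall>c. c \<notin> ?A \<longrightarrow> x $ fst c $ snd c = 0) \<and>
    (\<forall>c\<in>?A. \<forall>c'\<in>?A. \<kappa> c = \<kappa> c' \<longrightarrow> x $ fst c $ snd c = x $ fst c' $ snd c')}" (is "_ = ?V")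
  proof (intro subset_antisym subsetI)
    fix x assume x: "x \<in> congruence_slice w0 w"
    have eq: "x $ u $ j = x $ u' $ j'" if \<kappa>: "\<kappa> (u, j) = \<kappa> (u', j')" for u j u' j'
    proof (cases "u \<in> range w")
      case True
      then obtain i where i: "u = w i" by blast
      then obtain i' where i': "u' = w i'"
        using \<kappa> by (auto simp: \<kappa>_def split: if_splits)
      have "{i, j} = {i', j'}" using \<kappa> by (simp add: i i' \<kappa>w)
      then have "i = i' \<and> j = j' \<or> i = j' \<and> j = i'" by (simp add: doubleton_eq_iff)
      then show ?thesis using x by (auto simp: congruence_slice_def i i')
    next
      case False
      then show ?thesis using \<kappa> by (auto simp: \<kappa>_def split: if_splits)
    qed
    show "x \<in> ?V"
    proof (intro CollectI conjI allI ballI impI)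
      fix c assume "c \<notin> ?A"
      then have "fst c = w0" by (cases c) auto
      then show "x $ fst c $ snd c = 0" using x by (simp add: congruence_slice_def)
    next
      fix c c' assume "\<kappa> c = \<kappa> c'"
      then show "x $ fst c $ snd c = x $ fst c' $ snd c'"
        using eq[of "fst c" "snd c" "fst c'" "snd c'"] by simp
    qed
  next
    fix x assume x: "x \<in> ?V"
    have "x $ w0 $ j = 0" for j using x by auto
    moreover have "x $ w i $ j = x $ w j $ i" for i j
    proof -
      have "(w i, j) \<in> ?A" "(w j, i) \<in> ?A" using w(2) by auto
      moreover have "\<kappa> (w i, j) = \<kappa> (w j, i)" by (simp add: \<kappa>w insert_commute)
      ultimately have "x $ fst (w i, j) $ snd (w i, j) = x $ fst (w j, i) $ snd (w j, i)"
        using x by blast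
      then show ?thesis by simp
    qed
    ultimately show "x \<in> congruence_slice w0 w" by (simp add: congruence_slice_def vec_eq_iff)
  qed
  then have dim: "dim (congruence_slice w0 w) = card (\<kappa> ` ?A)"
    using dim_labelled_coordinates[of ?A \<kappa>] by simp
  let ?B = "(UNIV - {w0} - range w) \<times> (UNIV :: 'd set)"
  let ?E = "{A :: 'd set. card A = 1} \<union> {A. card A = 2}"
  have "\<kappa> ` ?A = Inl ` ?E \<union> Inr ` ?B"
  proof (intro subset_antisym subsetI)
    fix y assume "y \<in> \<kappa> ` ?A"
    then obtain u j where y: "u \<noteq> w0" "y = \<kappa> (u, j)" by auto
    show "y \<in> Inl ` ?E \<union> Inr ` ?B"
    proof (cases "u \<in> range w")
      case True
      then obtain i where "u = w i" by blast
      then have "y = Inl {i, j}" by (simp add: y \<kappa>w)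
      moreover have "card {i, j} = 1 \<or> card {i, j} = 2" by (cases "i = j") auto
      ultimately show ?thesis by blast
    qed (use y in \<open>auto simp: \<kappa>_def\<close>)
  next
    fix y assume "y \<in> Inl ` ?E \<union> Inr ` ?B"
    then consider A where "y = Inl A" "card A = 1" | A where "y = Inl A" "card A = 2"
      | u j where "y = Inr (u, j)" "u \<noteq> w0" "u \<notin> range w" by auto
    then show "y \<in> \<kappa> ` ?A"
    proof cases
      case 1
      then obtain i where "y = Inl {i, i}" by (auto simp: card_1_singleton_iff)
      then show ?thesis using \<kappa>w[of i i] w(2) by (intro image_eqI[of _ _ "(w i, i)"]) auto
    next
      case 2
      then obtain i j where "y = Inl {i, j}" by (auto simp: card_2_iff)
      then show ?thesis using \<kappa>w[of i j] w(2) by (intro image_eqI[of _ _ "(w i, j)"]) auto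
    next
      case 3
      then show ?thesis by (intro image_eqI[of _ _ "(u, j)"]) (auto simp: \<kappa>_def)
    qed
  qed
  moreover have "card (Inl ` ?E \<union> Inr ` ?B :: ('d set + 'v \<times> 'd) set) = card ?E + card ?B"
    by (subst card_Un_disjoint) (auto simp: card_image)
  moreover have "card ?E = ?d + (?d choose 2)"
    using n_subsets[of "UNIV :: 'd set" 1] n_subsets[of "UNIV :: 'd set" 2]
    by (subst card_Un_disjoint) auto
  moreover have "card ?B = (CARD('v) - 1 - ?d) * ?d"
  proof -
    have "card (UNIV - {w0} - range w) = CARD('v) - 1 - ?d"
      using w by (subst card_Diff_subset) (auto simp: card_image)
    then show ?thesis by (simp add: card_cartesian_product)
  qed
  ultimately have card: "dim (congruence_slice w0 w) = ?d + (?d choose 2) + (CARD('v) - 1 - ?d) * ?d"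
    using dim by simp
  have "card (insert w0 (range w)) \<le> CARD('v)" by (intro card_mono) auto
  then have v: "?d + 1 \<le> CARD('v)" using w by (simp add: card_image)
  have choose: "2 * (?d choose 2) + ?d = ?d * ?d"
    by (cases ?d) (simp_all add: choose_two)
  \<comment> \<open>Writing v = r + (d + 1) removes the truncated subtractions.\<close>
  obtain r where r: "CARD('v) = r + (?d + 1)" using v by (metis le_add_diff_inverse2)
  have "?d + 1 choose 2 = ?d + (?d choose 2)"
    by (simp add: numeral_2_eq_2)
  moreover have "CARD('v) * ?d = ?d + (?d choose 2) + r * ?d + (?d + (?d choose 2))"
    using choose by (simp add: r algebra_simps)
  ultimately show ?thesis using card r by simp
qed

section \<open>The rigidity map\<close>

text \<open>Edges are given by their end points \<open>a i\<close> and \<open>b i\<close>; the derivative of the squared lengths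
  \<open>rigidity_map a b \<rho> \<rho>\<close> is \<open>2 *\<^sub>R rigidity_map a b \<rho>\<close>.\<close>

definition rigidity_map ::
    "('e::finite \<Rightarrow> 'v) \<Rightarrow> ('e \<Rightarrow> 'v) \<Rightarrow> ('v::finite, 'd::finite) framework \<Rightarrow> ('v, 'd) framework \<Rightarrow> real^'e" where
  "rigidity_map a b \<rho> \<sigma> = (\<chi> i. (\<rho> $ a i - \<rho> $ b i) \<bullet> (\<sigma> $ a i - \<sigma> $ b i))"

lemma rigidity_map_commute: "rigidity_map a b \<rho> \<sigma> = rigidity_map a b \<sigma> \<rho>"
  by (simp add: rigidity_map_def inner_commute)

lemma rigidity_map_self: "rigidity_map a b \<rho> \<rho> $ i = (norm (\<rho> $ a i - \<rho> $ b i))\<^sup>2"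
  by (simp add: rigidity_map_def power2_norm_eq_inner)

lemma bounded_bilinear_rigidity_map: "bounded_bilinear (rigidity_map a b)"
  unfolding bilinear_conv_bounded_bilinear[symmetric] bilinear_def
  by (auto intro!: linearI simp: rigidity_map_def vec_eq_iff algebra_simps)

lemma linear_rigidity_map: "linear (rigidity_map a b \<rho>)"
  using bounded_bilinear.bounded_linear_right[OF bounded_bilinear_rigidity_map]
  by (simp add: linear_conv_bounded_linear)

lemma has_derivative_rigidity_map_self:
  "((\<lambda>\<rho>. rigidity_map a b \<rho> \<rho>) has_derivative (\<lambda>v. 2 *\<^sub>R rigidity_map a b \<rho> v)) (at \<rho> within S)"
proof -
  have "((\<lambda>\<rho>. rigidity_map a b \<rho> \<rho>) has_derivative
      (\<lambda>v. rigidity_map a b \<rho> v + rigidity_map a b v \<rho>)) (at \<rho> within S)"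
    by (intro bounded_bilinear.FDERIV[OF bounded_bilinear_rigidity_map] has_derivative_ident)
  moreover have "rigidity_map a b \<rho> v + rigidity_map a b v \<rho> = 2 *\<^sub>R rigidity_map a b \<rho> v" for v
    by (simp add: rigidity_map_commute[of a b v] scaleR_2)
  ultimately show ?thesis by simp
qed

lemma continuous_on_rigidity_map_self: "continuous_on S (\<lambda>\<rho>. rigidity_map a b \<rho> \<rho>)"
  by (intro bounded_bilinear.continuous_on[OF bounded_bilinear_rigidity_map] continuous_on_id)

lemma continuous_on_rigidity_map: "continuous_on S (\<lambda>\<rho>. rigidity_map a b \<rho> v)"
  by (intro bounded_bilinear.continuous_on[OF bounded_bilinear_rigidity_map] continuous_on_id
      continuous_on_const)

lemma times_differentiable_on_rigidity_map_self:
  "open S \<Longrightarrow> times_differentiable_on k S (\<lambda>\<rho>. rigidity_map a b \<rho> \<rho>)"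
  by (intro times_differentiable_on_bilinear[OF _ bounded_bilinear_rigidity_map]
      times_differentiable_on_ident_linear bounded_linear_ident)

lemma rigidity_map_self_slice:
  fixes w :: "'d::finite \<Rightarrow> 'v::finite"
  shows "(\<lambda>\<rho>. rigidity_map a b \<rho> \<rho>) ` congruence_slice w0 w =
    range (\<lambda>\<rho> :: ('v, 'd) framework. rigidity_map a b \<rho> \<rho>)"
proof (intro subset_antisym image_subsetI)
  fix \<rho> :: "('v, 'd) framework"
  obtain \<sigma> where \<sigma>: "\<sigma> \<in> congruence_slice w0 w"
    "\<And>u u'. norm (\<sigma> $ u - \<sigma> $ u') = norm (\<rho> $ u - \<rho> $ u')"
    by (rule congruence_slice_representative[of w0 w \<rho>], rule that)
  then have "rigidity_map a b \<rho> \<rho> = rigidity_map a b \<sigma> \<sigma>"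
    by (simp add: vec_eq_iff rigidity_map_self)
  then show "rigidity_map a b \<rho> \<rho> \<in> (\<lambda>\<rho>. rigidity_map a b \<rho> \<rho>) ` congruence_slice w0 w"
    using \<sigma>(1) by blast
qed auto

lemma subspace_range_rigidity_map: "subspace (range (rigidity_map a b \<rho>))"
  by (rule linear_subspace_image[OF linear_rigidity_map subspace_UNIV])

lemma range_scaled_rigidity_map: "range (\<lambda>v. 2 *\<^sub>R rigidity_map a b \<rho> v) = range (rigidity_map a b \<rho>)"
proof -
  have "surj (\<lambda>v :: real^'b^'c. 2 *\<^sub>R v)"
    by (rule surjI[of _ "\<lambda>v. (1/2) *\<^sub>R v"]) simp
  then have "range (\<lambda>v. rigidity_map a b \<rho> (2 *\<^sub>R v)) = range (rigidity_map a b \<rho>)"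
    by (metis image_image)
  then show ?thesis by (simp only: linear_scale[OF linear_rigidity_map])
qed

lemma closest_point_range_rigidity_map:
  "range (\<lambda>v. closest_point (range (rigidity_map a b \<rho>)) (2 *\<^sub>R rigidity_map a b \<rho> v)) =
    range (rigidity_map a b \<rho>)"
proof -
  have "2 *\<^sub>R rigidity_map a b \<rho> v \<in> range (rigidity_map a b \<rho>)" for v
    unfolding range_scaled_rigidity_map[symmetric] by (rule rangeI)
  then show ?thesis
    by (simp only: closest_point_subspace_ident[OF subspace_range_rigidity_map] range_scaled_rigidity_map)
qed

text \<open>This replaces a computation of the trivial infinitesimal motions. If the rank exceeded
  dim \<open>P\<close>, every point of \<open>P\<close> would be critical for the projection of
  \<ell> to \<open>T\<close>, so the projected measurement set would be negligible; but \<ell>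
  projected to \<open>T\<close> is a submersion at \<rho>.\<close>

lemma rigidity_map_rank_le:
  fixes w :: "'d::finite \<Rightarrow> 'v::finite" and \<rho> :: "('v, 'd) framework"
  shows "dim (range (rigidity_map a b \<rho>)) \<le> dim (congruence_slice w0 w)"
proof (rule ccontr)
  let ?L = "\<lambda>\<rho> :: ('v, 'd) framework. rigidity_map a b \<rho> \<rho>" and ?P = "congruence_slice w0 w"
  define T where "T = range (rigidity_map a b \<rho>)"
  assume "\<not> dim (range (rigidity_map a b \<rho>)) \<le> dim ?P"
  then have less: "dim ?P < dim T" by (simp add: T_def)
  have T: "subspace T"
    unfolding T_def by (rule subspace_range_rigidity_map)
  have neg: "negligible {x. closest_point T x \<in> closest_point T ` ?L ` ?P}"
  proof (rule negligible_projected_critical_values[OF subspace_congruence_slice T _ order_refl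
        has_derivative_rigidity_map_self])
    fix p :: "('v, 'd) framework"
    have lin: "linear (\<lambda>v. closest_point T (2 *\<^sub>R rigidity_map a b p v))"
      using linear_compose[OF linear_compose_scale_right[OF linear_rigidity_map] linear_closest_point[OF T]]
      by (simp add: o_def)
    then have "dim ((\<lambda>v. closest_point T (2 *\<^sub>R rigidity_map a b p v)) ` ?P) < dim T"
      using dim_image_le[OF lin, of ?P] less by simp
    then show "(\<lambda>v. closest_point T (2 *\<^sub>R rigidity_map a b p v)) ` ?P \<noteq> T" by force
  qed (use less in simp)
  have "range (\<lambda>v. closest_point T (2 *\<^sub>R rigidity_map a b \<rho> v)) = T"
    unfolding T_def by (rule closest_point_range_rigidity_map)
  then have "\<not> negligible {x. closest_point T x \<in> closest_point T ` ?L ` UNIV}"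
    by (rule projected_image_not_negligible[OF T open_UNIV UNIV_I has_derivative_rigidity_map_self])
  then show False using neg by (simp add: rigidity_map_self_slice)
qed

lemma rational_polynomial_rigidity_map:
  assumes "\<And>u j. \<sigma> $ u $ j \<in> \<rat>"
  shows "rational_polynomial (\<lambda>\<rho>. rigidity_map a b \<rho> \<sigma> $ i)"
proof -
  have "rational_polynomial (\<lambda>\<rho> :: ('a, 'b) framework. \<sigma> $ a i $ j - \<sigma> $ b i $ j)" for j
    using assms[of "a i" j] assms[of "b i" j] rational_polynomial_const
    by (metis Rats_cases Rats_diff)
  then show ?thesis
    unfolding rigidity_map_def inner_vec_def vec_lambda_beta vector_minus_component inner_real_def
    by (intro rational_polynomial_sum rational_polynomial_mult[OF rational_polynomial_diff[OF
            rational_polynomial_coordinate rational_polynomial_coordinate]])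
qed

lemma Basis_vec_vec_Rats:
  fixes v :: "real^'d^'v"
  assumes "v \<in> Basis" shows "v $ u $ j \<in> \<rat>"
  using assms by (auto simp: Basis_vec_def axis_def)

lemma generic_rigidity_map_rank_maximal:
  fixes \<rho> \<sigma> :: "('v::finite, 'd::finite) framework"
  assumes "generic \<rho>"
  shows "dim (range (rigidity_map a b \<sigma>)) \<le> dim (range (rigidity_map a b \<rho>))"
  by (rule generic_rank_maximal[OF linear_rigidity_map
        rational_polynomial_rigidity_map[OF Basis_vec_vec_Rats] assms])

text \<open>By maximality of the generic rank one framework suffices. In \<rho>0 the vertices
  \<open>w i\<close> sit at the unit vectors and all others at the origin, and its rigidity map is
  injective on the slice.\<close>

lemma complete_graph_rank_ge:
  fixes \<rho> :: "('v::finite, 'd::finite) framework"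
  assumes w: "inj w" "w0 \<notin> range w" and gen: "generic \<rho>"
  shows "dim (congruence_slice w0 (w :: 'd \<Rightarrow> 'v)) \<le> dim (range (rigidity_map fst snd \<rho> :: _ \<Rightarrow> real^('v \<times> 'v)))"
proof -
  let ?P = "congruence_slice w0 w :: ('v, 'd) framework set"
  define \<rho>0 :: "('v, 'd) framework" where "\<rho>0 = (\<chi> u. if u \<in> range w then axis (inv w u) 1 else 0)"
  have \<rho>0: "\<rho>0 $ w0 = 0" "\<rho>0 $ w i = axis i 1" for i
    using w by (auto simp: \<rho>0_def)
  let ?R = "rigidity_map fst snd \<rho>0 :: ('v, 'd) framework \<Rightarrow> real^('v \<times> 'v)"
  have "\<sigma> = 0" if \<sigma>: "\<sigma> \<in> ?P" "?R \<sigma> = 0" for \<sigma>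
  proof -
    have R: "(\<rho>0 $ u - \<rho>0 $ u') \<bullet> (\<sigma> $ u - \<sigma> $ u') = 0" for u u'
      using arg_cong[OF \<sigma>(2), of "\<lambda>x. x $ (u, u')"] by (simp add: rigidity_map_def)
    have s0: "\<sigma> $ w0 = 0" and sym: "\<sigma> $ w i $ j = \<sigma> $ w j $ i" for i j
      using \<sigma>(1) by (auto simp: congruence_slice_def)
    have diag: "\<sigma> $ w i $ i = 0" for i
      using R[of "w i" w0] by (simp add: \<rho>0 s0 inner_axis_axis inner_axis')
    \<comment> \<open>With zero diagonal, the edge from \<open>w i\<close> to \<open>w j\<close>
      makes the matrix of \<sigma> antisymmetric, while the slice makes it symmetric.\<close>
    have "\<sigma> $ w i $ j = 0" for i j
    proof -
      have "\<sigma> $ w i $ i - \<sigma> $ w j $ i - (\<sigma> $ w i $ j - \<sigma> $ w j $ j) = 0"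
        using R[of "w i" "w j"] by (simp add: \<rho>0 inner_diff_left inner_axis')
      then show ?thesis using sym[of i j] diag by simp
    qed
    then have sw: "\<sigma> $ w i = 0" for i by (simp add: vec_eq_iff)
    have "\<sigma> $ u = 0" for u
    proof (cases "u \<in> range w")
      case False
      then have "\<rho>0 $ u = 0" by (simp add: \<rho>0_def)
      then have "\<sigma> $ u $ i = 0" for i
        using R[of u "w i"] by (simp add: \<rho>0 sw inner_axis' inner_minus_left)
      then show ?thesis by (simp add: vec_eq_iff)
    qed (use sw in auto)
    then show ?thesis by (simp add: vec_eq_iff)
  qed
  then have "inj_on ?R ?P"
    by (rule inj_on_subspace[OF linear_rigidity_map subspace_congruence_slice])
  then have "dim ?P = dim (?R ` ?P)"
    using dim_image_inj_on[OF linear_rigidity_map subspace_congruence_slice] by metis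
  also have "\<dots> \<le> dim (range ?R)" by (intro dim_subset) auto
  also have "\<dots> \<le> dim (range (rigidity_map fst snd \<rho> :: _ \<Rightarrow> real^('v \<times> 'v)))"
    by (rule generic_rigidity_map_rank_maximal[OF gen])
  finally show ?thesis .
qed

text \<open>Where the rank is locally constant, every infinitesimal motion \<open>\<tau>\<close> integrates to a curve in the
  fibre; local rigidity forces that curve to preserve all pairwise distances.\<close>

lemma locally_rigid_imp_infinitesimally_rigid:
  fixes \<rho> \<tau> :: "('v::finite, 'd::finite) framework"
  assumes N: "open N" "\<rho> \<in> N"
    and rigid: "\<And>\<sigma> u u'. \<sigma> \<in> N \<Longrightarrow> rigidity_map a b \<sigma> \<sigma> = rigidity_map a b \<rho> \<rho> \<Longrightarrow>
      norm (\<sigma> $ u - \<sigma> $ u') = norm (\<rho> $ u - \<rho> $ u')"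
    and max: "\<And>\<sigma> :: ('v, 'd) framework. dim (range (rigidity_map a b \<sigma>)) \<le> dim (range (rigidity_map a b \<rho>))"
    and \<tau>: "rigidity_map a b \<rho> \<tau> = 0"
  shows "rigidity_map fst snd \<rho> \<tau> = (0 :: real^('v \<times> 'v))"
proof -
  let ?R = "rigidity_map a b :: ('v, 'd) framework \<Rightarrow> _"
  let ?L = "\<lambda>\<rho>. ?R \<rho> \<rho>"
  define T where "T = range (?R \<rho>)"
  let ?\<pi> = "closest_point T"
  note linR = linear_rigidity_map
  have T: "subspace T"
    unfolding T_def by (rule linear_subspace_image[OF linR subspace_UNIV])
  have lin\<pi>: "linear ?\<pi>" by (rule linear_closest_point[OF T])
  have \<pi>T: "?\<pi> x \<in> T" for x by (rule closest_point_subspace(1)[OF T])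
  have \<pi>R: "?\<pi> (?R \<rho> v) = ?R \<rho> v" for v
    by (rule closest_point_subspace_ident[OF T]) (simp add: T_def)
  have bl\<pi>: "bounded_linear ?\<pi>" using lin\<pi> by (simp add: linear_conv_bounded_linear)
  obtain B where B: "linear B" "\<And>w. w \<in> T \<Longrightarrow> ?R \<rho> (B w) = w"
    using linear_exists_right_inverse_on[OF linR subspace_UNIV, of a b \<rho>] unfolding T_def by blast
  have blB: "bounded_linear B" using B(1) by (simp add: linear_conv_bounded_linear)
  have blR: "bounded_linear (?R \<rho>)" using linR by (simp add: linear_conv_bounded_linear)
  \<comment> \<open>\<open>F\<close> straightens the projected length map: R_\<rho>(F \<sigma>) is
    half of \<pi>(\<ell> \<sigma>), see \<open>RF\<close>. Its derivative at \<rho> is the identity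
    because \<pi> fixes im R_\<rho>.\<close>
  define F where "F \<sigma> = \<sigma> - B (?R \<rho> \<sigma>) + (1/2) *\<^sub>R B (?\<pi> (?L \<sigma>))" for \<sigma>
  define F' where "F' \<sigma> v = v - B (?R \<rho> v) + B (?\<pi> (?R \<sigma> v))" for \<sigma> v
  have derF: "(F has_derivative F' \<sigma>) (at \<sigma>)" for \<sigma>
  proof -
    have "(F has_derivative (\<lambda>v. v - B (?R \<rho> v) + (1/2) *\<^sub>R B (?\<pi> (2 *\<^sub>R ?R \<sigma> v)))) (at \<sigma>)"
      unfolding F_def[abs_def]
      by (intro has_derivative_add has_derivative_diff has_derivative_ident has_derivative_scaleR_right
          bounded_linear.has_derivative[OF blB] bounded_linear.has_derivative[OF blR]
          bounded_linear.has_derivative[OF bl\<pi>] has_derivative_rigidity_map_self)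
    then show ?thesis
      by (simp add: F'_def[abs_def] linear_scale[OF B(1)] linear_scale[OF lin\<pi>])
  qed
  have "continuous_on UNIV (\<lambda>\<sigma>. F' \<sigma> v)" for v
    unfolding F'_def
    by (intro continuous_intros bounded_linear.continuous_on[OF blB] bounded_linear.continuous_on[OF bl\<pi>]
        continuous_on_rigidity_map)
  moreover have F'\<rho>: "F' \<rho> = id"
    by (simp add: F'_def fun_eq_iff \<pi>R)
  ultimately obtain U V g where U: "open U" "\<rho> \<in> U" "open V"
    and fg: "\<And>x. x \<in> U \<Longrightarrow> F x \<in> V \<and> g (F x) = x"
    and gf: "\<And>y. y \<in> V \<Longrightarrow> g y \<in> U \<and> F (g y) = y"
    and bijg: "\<And>y. y \<in> V \<Longrightarrow> bij (F' (g y)) \<and> (g has_derivative inv (F' (g y))) (at y)"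
    by (rule C1_local_inverse[OF derF]) (assumption | blast)+
  define g' where "g' y = inv (F' (g y))" for y
  have derg: "(g has_derivative g' y) (at y)" if "y \<in> V" for y
    using bijg[OF that] by (simp add: g'_def)
  have g'0: "g' (F \<rho>) = id"
    using fg[OF U(2)] by (simp add: g'_def F'\<rho>)
  have "?R \<rho> (B (?\<pi> x)) = ?\<pi> x" and "?R \<rho> (B (?R \<rho> v)) = ?R \<rho> v" for x v
    by (rule B(2)[OF \<pi>T], rule B(2)) (simp add: T_def)
  then have RF: "?R \<rho> (F \<sigma>) = (1/2) *\<^sub>R ?\<pi> (?L \<sigma>)" for \<sigma>
    by (simp add: F_def linear_add[OF linR] linear_diff[OF linR] linear_scale[OF linR])
  have lin\<pi>R: "linear (\<lambda>v. ?\<pi> (?R \<sigma> v))" for \<sigma>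
    using linear_compose[OF linR lin\<pi>] by (simp add: o_def)
  have cont\<pi>R: "continuous_on UNIV (\<lambda>\<sigma>. ?\<pi> (?R \<sigma> v))" for v
    by (intro bounded_linear.continuous_on[OF bl\<pi>] continuous_on_rigidity_map)
  obtain U1 where U1: "open U1" "\<rho> \<in> U1"
    "\<And>\<sigma>. \<sigma> \<in> U1 \<Longrightarrow> dim (range (\<lambda>v. ?\<pi> (?R \<rho> v))) \<le> dim (range (\<lambda>v. ?\<pi> (?R \<sigma> v)))"
    by (rule rank_lower_semicontinuous[of "\<lambda>\<sigma> v. ?\<pi> (?R \<sigma> v)", OF lin\<pi>R cont\<pi>R open_UNIV UNIV_I], rule that)
  \<comment> \<open>Near \<rho> the projected map has rank at least dim \<open>T\<close>, the
    unprojected one at most dim \<open>T\<close> by maximality. So \<pi> is injective on im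
    R_\<sigma>, and constancy of \<pi> \<circ> \<ell> along a curve will force constancy of
    \<ell>.\<close>
  have \<pi>_inj: "?R \<sigma> v = 0" if "\<sigma> \<in> U1" "?\<pi> (?R \<sigma> v) = 0" for \<sigma> v
  proof -
    have sub: "subspace (range (?R \<sigma>))" by (rule linear_subspace_image[OF linR subspace_UNIV])
    have "range (\<lambda>v. ?\<pi> (?R \<rho> v)) = T"
      unfolding \<pi>R by (rule T_def[symmetric])
    then have "dim T \<le> dim (?\<pi> ` range (?R \<sigma>))"
      using U1(3)[OF that(1)] by (simp add: image_image)
    moreover have "dim (range (?R \<sigma>)) \<le> dim T" using max by (simp add: T_def)
    ultimately have "dim {x \<in> range (?R \<sigma>). ?\<pi> x = 0} = 0"
      using dim_image_kernel[OF lin\<pi> sub] by linarith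
    then have "{x \<in> range (?R \<sigma>). ?\<pi> x = 0} \<subseteq> {0}" by (simp add: dim_eq_0)
    then show ?thesis using that(2) by blast
  qed
  \<comment> \<open>A straight line in direction \<tau> in the coordinates given by
    \<open>F\<close>. As \<tau> is in ker R_\<rho>, its pullback \<gamma> keeps
    \<pi>(\<ell>(\<gamma> s)) fixed; it leaves \<rho> with velocity \<tau>.\<close>
  define c where "c s = F \<rho> + s *\<^sub>R \<tau>" for s :: real
  define \<gamma> where "\<gamma> s = g (c s)" for s
  have c0: "c 0 = F \<rho>" and \<gamma>0: "\<gamma> 0 = \<rho>" using fg[OF U(2)] by (simp_all add: c_def \<gamma>_def)
  have derc: "(c has_vector_derivative \<tau>) (at s)" for s
    unfolding c_def by (auto intro!: derivative_eq_intros)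
  have cV: "c 0 \<in> V" using fg[OF U(2)] c0 by simp
  have der\<gamma>: "(\<gamma> has_vector_derivative g' (c s) \<tau>) (at s)" if "c s \<in> V" for s
    using has_derivative_compose[OF derc[unfolded has_vector_derivative_def] derg[OF that]]
    unfolding \<gamma>_def has_vector_derivative_def
    by (simp add: linear_scale[OF has_derivative_linear[OF derg[OF that]]])
  have "\<forall>\<^sub>F s in nhds 0. c s \<in> V"
    using has_vector_derivative_continuous[OF derc[of 0]] cV U(3)
    by (metis isCont_def tendsto_at_iff_tendsto_nhds topological_tendstoD)
  moreover have "\<forall>\<^sub>F s in nhds 0. \<gamma> s \<in> U1 \<inter> N"
    using has_vector_derivative_continuous[OF der\<gamma>[OF cV]] \<gamma>0 U1 N
    by (metis IntI isCont_def open_Int tendsto_at_iff_tendsto_nhds topological_tendstoD)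
  ultimately have "\<forall>\<^sub>F s in nhds 0. c s \<in> V \<and> \<gamma> s \<in> U1 \<inter> N" by (rule eventually_conj)
  then obtain \<delta> where \<delta>: "\<delta> > 0" "\<And>s. dist s 0 < \<delta> \<Longrightarrow> c s \<in> V \<and> \<gamma> s \<in> U1 \<inter> N"
    unfolding eventually_nhds_metric by blast
  let ?J = "ball (0::real) \<delta>"
  have J: "c s \<in> V" "\<gamma> s \<in> U1" "\<gamma> s \<in> N" if "s \<in> ?J" for s
    using \<delta>(2)[of s] that by (auto simp: dist_commute)
  have der_L: "((\<lambda>s. ?L (\<gamma> s)) has_derivative (\<lambda>h. 0)) (at s)" if s: "s \<in> ?J" for s
  proof -
    let ?v = "g' (c s) \<tau>"
    have D: "((\<lambda>s. ?L (\<gamma> s)) has_derivative (\<lambda>h. 2 *\<^sub>R ?R (\<gamma> s) (h *\<^sub>R ?v))) (at s)"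
      by (rule has_derivative_compose[OF der\<gamma>[OF J(1)[OF s], unfolded has_vector_derivative_def]
            has_derivative_rigidity_map_self])
    from bounded_linear.has_derivative[OF bl\<pi> this]
    have D1: "((\<lambda>s. ?\<pi> (?L (\<gamma> s))) has_derivative (\<lambda>h. ?\<pi> (2 *\<^sub>R ?R (\<gamma> s) (h *\<^sub>R ?v)))) (at s)" .
    have "?\<pi> (?L (\<gamma> r)) = 2 *\<^sub>R ?R \<rho> (F \<rho>)" if "r \<in> ?J" for r
    proof -
      have "F (\<gamma> r) = F \<rho> + r *\<^sub>R \<tau>" using gf[OF J(1)[OF that]] by (simp add: \<gamma>_def c_def)
      then have "(1/2) *\<^sub>R ?\<pi> (?L (\<gamma> r)) = ?R \<rho> (F \<rho>)"
        unfolding RF[symmetric] by (simp add: linear_add[OF linR] linear_scale[OF linR] \<tau>)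
      from arg_cong[OF this, of "\<lambda>x. 2 *\<^sub>R x"] show ?thesis by simp
    qed
    then have "((\<lambda>s. ?\<pi> (?L (\<gamma> s))) has_derivative (\<lambda>h. 0)) (at s)"
      by (intro has_derivative_transform_within_open[OF has_derivative_const open_ball s]) simp
    from has_derivative_unique[OF D1 this]
    have "?\<pi> (2 *\<^sub>R ?R (\<gamma> s) (1 *\<^sub>R ?v)) = 0" by (rule fun_cong)
    then have "?\<pi> (?R (\<gamma> s) ?v) = 0" by (simp add: linear_scale[OF lin\<pi>])
    then have "?R (\<gamma> s) ?v = 0" using \<pi>_inj J(2)[OF s] by blast
    then have "(\<lambda>h. 2 *\<^sub>R ?R (\<gamma> s) (h *\<^sub>R ?v)) = (\<lambda>h. 0)"
      by (simp add: linear_scale[OF linR])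
    then show ?thesis using D by simp
  qed
  obtain k where k: "\<And>s. s \<in> ?J \<Longrightarrow> ?L (\<gamma> s) = k"
    using has_derivative_zero_constant[OF convex_ball, of 0 \<delta> "\<lambda>s. ?L (\<gamma> s)"]
      has_derivative_at_withinI[OF der_L] by blast
  have J0: "0 \<in> ?J" using \<delta>(1) by simp
  have "?L (\<gamma> s) = ?L \<rho>" if "s \<in> ?J" for s
    using k[OF that] k[OF J0] \<gamma>0 by simp
  then have "norm (\<gamma> s $ u - \<gamma> s $ u') = norm (\<rho> $ u - \<rho> $ u')" if "s \<in> ?J" for s u u'
    using rigid J(3) that by blast
  then have const: "rigidity_map fst snd (\<gamma> s) (\<gamma> s) = (rigidity_map fst snd \<rho> \<rho> :: real^('v \<times> 'v))"
    if "s \<in> ?J" for s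
    using that by (simp add: vec_eq_iff rigidity_map_self)
  have "((\<lambda>s. rigidity_map fst snd (\<gamma> s) (\<gamma> s) :: real^('v \<times> 'v)) has_derivative
      (\<lambda>h. 2 *\<^sub>R rigidity_map fst snd (\<gamma> 0) (h *\<^sub>R g' (c 0) \<tau>))) (at 0)"
    by (rule has_derivative_compose[OF der\<gamma>[OF cV, unfolded has_vector_derivative_def]
          has_derivative_rigidity_map_self])
  moreover have "((\<lambda>s. rigidity_map fst snd (\<gamma> s) (\<gamma> s) :: real^('v \<times> 'v)) has_derivative (\<lambda>h. 0)) (at 0)"
    by (intro has_derivative_transform_within_open[OF has_derivative_const open_ball J0]) (simp add: const)
  ultimately have "(\<lambda>h. 2 *\<^sub>R rigidity_map fst snd (\<gamma> 0) (h *\<^sub>R g' (c 0) \<tau>)) = (\<lambda>h :: real. 0 ::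
      real^('v \<times> 'v))"
    by (rule has_derivative_unique)
  from fun_cong[OF this, of 1]
  have "2 *\<^sub>R rigidity_map fst snd (\<gamma> 0) (1 *\<^sub>R g' (c 0) \<tau>) = (0 :: real^('v \<times> 'v))" .
  then show ?thesis by (simp add: \<gamma>0 c0 g'0)
qed

text \<open>Rank-nullity turns the inclusion of the kernel in that of the complete graph into the
  lower bound on the rank.\<close>

lemma generic_locally_rigid_rank:
  fixes \<rho> :: "('v::finite, 'd::finite) framework" and w :: "'d \<Rightarrow> 'v"
  assumes w: "inj w" "w0 \<notin> range w" and gen: "generic \<rho>"
    and N: "open N" "\<rho> \<in> N"
    and rigid: "\<And>\<sigma> u u'. \<sigma> \<in> N \<Longrightarrow> rigidity_map a b \<sigma> \<sigma> = rigidity_map a b \<rho> \<rho> \<Longrightarrow>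
      norm (\<sigma> $ u - \<sigma> $ u') = norm (\<rho> $ u - \<rho> $ u')"
  shows "dim (range (rigidity_map a b \<rho>)) = dim (congruence_slice w0 w)"
proof (rule antisym)
  show "dim (range (rigidity_map a b \<rho>)) \<le> dim (congruence_slice w0 w)"
    by (rule rigidity_map_rank_le)
  let ?K = "rigidity_map fst snd \<rho> :: _ \<Rightarrow> real^('v \<times> 'v)"
  have "{\<tau> \<in> UNIV. rigidity_map a b \<rho> \<tau> = 0} \<subseteq> {\<tau> \<in> UNIV. ?K \<tau> = 0}"
    using locally_rigid_imp_infinitesimally_rigid[OF N rigid generic_rigidity_map_rank_maximal[OF gen]]
    by blast
  then have "dim {\<tau> \<in> UNIV. rigidity_map a b \<rho> \<tau> = 0} \<le> dim {\<tau> \<in> UNIV. ?K \<tau> = 0}"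
    by (rule dim_subset)
  then have "dim (range ?K) \<le> dim (range (rigidity_map a b \<rho>))"
    using dim_image_kernel[OF linear_rigidity_map[of a b \<rho>] subspace_UNIV]
      dim_image_kernel[of ?K, OF linear_rigidity_map subspace_UNIV] by linarith
  then show "dim (congruence_slice w0 w) \<le> dim (range (rigidity_map a b \<rho>))"
    using complete_graph_rank_ge[OF w gen] by linarith
qed

section \<open>Smooth points of the measurement set\<close>

text \<open>A finite Baire argument: remove the closed sets one at a time while the remaining open
  set still meets \<open>M\<close>. The first set whose removal leaves nothing of \<open>M\<close>
  covers the current piece.\<close>

lemma open_subset_finite_closed_cover:
  assumes "finite I" "open X" "X \<inter> M \<noteq> {}" "X \<inter> M \<subseteq> (\<Union>i\<in>I. S i)" "\<And>i. i \<in> I \<Longrightarrow> closed (S i)"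
  shows "\<exists>i\<in>I. \<exists>Y. open Y \<and> Y \<subseteq> X \<and> Y \<inter> M \<noteq> {} \<and> Y \<inter> M \<subseteq> S i"
  using assms
proof (induction I arbitrary: X)
  case (insert i I)
  show ?case
  proof (cases "(X - S i) \<inter> M = {}")
    case True
    then show ?thesis using insert.prems by blast
  next
    case False
    have "open (X - S i)" using insert.prems by (intro open_Diff) auto
    moreover have "(X - S i) \<inter> M \<subseteq> (\<Union>i\<in>I. S i)" using insert.prems(3) by blast
    ultimately obtain j Y where "j \<in> I" "open Y" "Y \<subseteq> X - S i" "Y \<inter> M \<noteq> {}" "Y \<inter> M \<subseteq> S j"
      using insert.IH[of "X - S i"] False insert.prems(4) by blast
    then show ?thesis by blast
  qed
qed simp

text \<open>Edges are oriented from \<open>a i\<close> to \<open>b i\<close>, and congruence enters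
  as equality of all pairwise distances. \<open>w0\<close> and \<open>w\<close> select the d + 1
  vertices of the slice.\<close>

locale rigid_graph =
  fixes a b :: "'e::finite \<Rightarrow> 'v::finite" and w0 :: 'v and w :: "'d::finite \<Rightarrow> 'v"
  assumes w: "inj w" "w0 \<notin> range w"
    and rigid: "\<And>\<rho> :: ('v, 'd) framework. generic \<rho> \<Longrightarrow> \<exists>N. open N \<and> \<rho> \<in> N \<and>
      (\<forall>\<sigma>\<in>N. rigidity_map a b \<sigma> \<sigma> = rigidity_map a b \<rho> \<rho> \<longrightarrow>
        (\<forall>u u'. norm (\<sigma> $ u - \<sigma> $ u') = norm (\<rho> $ u - \<rho> $ u')))"
begin

abbreviation R :: "('v, 'd) framework \<Rightarrow> ('v, 'd) framework \<Rightarrow> real^'e" where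
  "R \<equiv> rigidity_map a b"

abbreviation len :: "('v, 'd) framework \<Rightarrow> real^'e" where
  "len \<rho> \<equiv> R \<rho> \<rho>"

abbreviation P :: "('v, 'd) framework set" where
  "P \<equiv> congruence_slice w0 w"

abbreviation t :: nat where
  "t \<equiv> dim P"

lemma generic_rank:
  assumes gen: "generic \<rho>"
  shows "dim (range (R \<rho>)) = t"
proof -
  from rigid[OF gen] obtain N where N: "open N" "\<rho> \<in> N" and rig: "\<forall>\<sigma>\<in>N. len \<sigma> = len \<rho> \<longrightarrow>
      (\<forall>u u'. norm (\<sigma> $ u - \<sigma> $ u') = norm (\<rho> $ u - \<rho> $ u'))"
    by (elim exE conjE)
  show ?thesis
    by (rule generic_locally_rigid_rank[OF w gen N]) (rule rig[rule_format])
qed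

section \<open>Connectedness of the graph and properness of the length map\<close>

lemma ex_generic:
  assumes "open N" "N \<noteq> {}"
  obtains \<rho> :: "('v, 'd) framework" where "generic \<rho>" "\<rho> \<in> N"
  using assms closure_generic[where 'v='v and 'd='d] open_Int_closure_eq_empty[of N "{\<rho>. generic \<rho>}"]
  by fastforce

text \<open>Otherwise a small translation of the set \<open>A\<close> of unreachable vertices would
  preserve all edge lengths but change the distance from \<open>u\<close> to
  \<open>w0\<close>.\<close>

lemma reachable:
  "(w0, u) \<in> {(u, u'). \<exists>i. {a i, b i} = {u, u'}}\<^sup>*"
proof (rule ccontr)
  let ?E = "{(u, u'). \<exists>i. {a i, b i} = {u, u'}}"
  assume u: "(w0, u) \<notin> ?E\<^sup>*"
  define A where "A = {u. (w0, u) \<notin> ?E\<^sup>*}"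
  have edges: "a i \<in> A \<longleftrightarrow> b i \<in> A" for i
  proof -
    have "(a i, b i) \<in> ?E" "(b i, a i) \<in> ?E" by (auto simp: insert_commute)
    then show ?thesis unfolding A_def by (blast intro: rtrancl_into_rtrancl)
  qed
  obtain \<rho> :: "('v, 'd) framework" where gen: "generic \<rho>"
    using ex_generic[of UNIV] by auto
  from rigid[OF gen] obtain N where N: "open N" "\<rho> \<in> N" and rig: "\<forall>\<sigma>\<in>N. len \<sigma> = len \<rho> \<longrightarrow>
      (\<forall>u u'. norm (\<sigma> $ u - \<sigma> $ u') = norm (\<rho> $ u - \<rho> $ u'))"
    by (elim exE conjE)
  define x where "x = \<rho> $ u - \<rho> $ w0"
  \<comment> \<open>The sign condition guarantees that moving \<open>u\<close> by a positive
    multiple of \<open>e\<close> strictly increases its distance from \<open>w0\<close>.\<close>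
  obtain e :: "real^'d" where e: "e \<noteq> 0" "x \<bullet> e \<ge> 0"
  proof (cases "x = 0")
    case True
    then show ?thesis using that[of "axis undefined 1"] by (simp add: axis_eq_0_iff)
  next
    case False
    then show ?thesis using that[of x] by simp
  qed
  define \<eta> :: "('v, 'd) framework" where "\<eta> = (\<chi> u. if u \<in> A then e else 0)"
  obtain \<delta> where \<delta>: "\<delta> > 0" "ball \<rho> \<delta> \<subseteq> N" using N openE by blast
  \<comment> \<open>Keeps the displacement below \<delta>; the summand 1 guards the
    denominator.\<close>
  define \<epsilon> where "\<epsilon> = \<delta> / (2 * (norm \<eta> + 1))"
  have \<epsilon>: "\<epsilon> > 0" using \<delta>(1) by (simp add: \<epsilon>_def add_nonneg_pos)
  have "\<epsilon> * norm \<eta> < \<delta>"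
  proof -
    have "\<epsilon> * norm \<eta> \<le> \<epsilon> * (norm \<eta> + 1)" using \<epsilon> by simp
    also have "\<dots> = \<delta> / 2"
      using norm_ge_zero[of \<eta>] by (simp add: \<epsilon>_def field_simps add_nonneg_eq_0_iff)
    finally show ?thesis using \<delta>(1) by simp
  qed
  then have "\<rho> + \<epsilon> *\<^sub>R \<eta> \<in> N" using \<delta>(2) \<epsilon> by (auto simp: dist_norm)
  moreover have "len (\<rho> + \<epsilon> *\<^sub>R \<eta>) = len \<rho>"
    using edges by (simp add: vec_eq_iff rigidity_map_self \<eta>_def)
  ultimately have "norm ((\<rho> + \<epsilon> *\<^sub>R \<eta>) $ u - (\<rho> + \<epsilon> *\<^sub>R \<eta>) $ w0) = norm (\<rho> $ u - \<rho> $ w0)"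
    by (rule rig[rule_format])
  moreover have "u \<in> A" "w0 \<notin> A" using u by (auto simp: A_def)
  ultimately have "norm (x + \<epsilon> *\<^sub>R e) = norm x"
    by (simp add: \<eta>_def x_def algebra_simps)
  then have "(x + \<epsilon> *\<^sub>R e) \<bullet> (x + \<epsilon> *\<^sub>R e) = x \<bullet> x" by (simp add: norm_eq)
  then have "2 * \<epsilon> * (x \<bullet> e) + \<epsilon> * \<epsilon> * (e \<bullet> e) = 0"
    by (simp add: inner_add_left inner_add_right inner_commute algebra_simps)
  moreover have "2 * \<epsilon> * (x \<bullet> e) \<ge> 0" "\<epsilon> * \<epsilon> * (e \<bullet> e) > 0" using e \<epsilon> by simp_all
  ultimately show False by linarith
qed

text \<open>\<open>k\<close> is the number of edges of a walk from \<open>w0\<close> to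
  \<open>u\<close>, hence uniform in the framework.\<close>

lemma norm_difference_bound:
  "\<exists>k::nat. \<forall>(\<rho> :: ('v, 'd) framework) r. (\<forall>i. norm (\<rho> $ a i - \<rho> $ b i) \<le> r) \<longrightarrow> norm (\<rho> $ u - \<rho> $ w0) \<le>
      real k * r"
  using reachable[of u]
proof (induction rule: rtrancl_induct)
  case base
  show ?case by (rule exI[of _ 0]) simp
next
  case (step u u')
  obtain k where k: "\<And>(\<rho> :: ('v, 'd) framework) r.
      (\<forall>i. norm (\<rho> $ a i - \<rho> $ b i) \<le> r) \<Longrightarrow> norm (\<rho> $ u - \<rho> $ w0) \<le> real k * r"
    using step.IH by blast
  obtain i where "{a i, b i} = {u, u'}" using step.hyps by blast
  then have i: "norm (\<rho> $ u' - \<rho> $ u) = norm (\<rho> $ a i - \<rho> $ b i)" for \<rho> :: "('v, 'd) framework"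
    by (auto simp: doubleton_eq_iff norm_minus_commute)
  have "norm (\<rho> $ u' - \<rho> $ w0) \<le> real (Suc k) * r"
    if r: "\<forall>i. norm (\<rho> $ a i - \<rho> $ b i) \<le> r" for \<rho> :: "('v, 'd) framework" and r
  proof -
    have "norm (\<rho> $ u' - \<rho> $ w0) \<le> norm (\<rho> $ u' - \<rho> $ u) + norm (\<rho> $ u - \<rho> $ w0)"
      using norm_triangle_ineq[of "\<rho> $ u' - \<rho> $ u" "\<rho> $ u - \<rho> $ w0"] by simp
    also have "\<dots> \<le> r + real k * r" using k[OF r] r by (intro add_mono) (simp_all add: i)
    finally show ?thesis by (simp add: algebra_simps)
  qed
  then show ?case by blast
qed

text \<open>Properness of \<ell> on the slice: \<open>w0\<close> is pinned at the origin, and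
  bounded edges along walks bound every vertex.\<close>

lemma slice_norm_bound: "\<exists>C. \<forall>\<rho>\<in>P. norm (len \<rho>) \<le> s \<longrightarrow> norm \<rho> \<le> C"
proof -
  obtain k :: "'v \<Rightarrow> nat" where k: "\<And>u (\<rho> :: ('v, 'd) framework) r.
      \<forall>i. norm (\<rho> $ a i - \<rho> $ b i) \<le> r \<Longrightarrow> norm (\<rho> $ u - \<rho> $ w0) \<le> real (k u) * r"
    using norm_difference_bound by metis
  have "norm \<rho> \<le> (\<Sum>u\<in>UNIV. real (k u) * sqrt s)" if \<rho>: "\<rho> \<in> P" "norm (len \<rho>) \<le> s" for \<rho>
  proof -
    have "norm (\<rho> $ a i - \<rho> $ b i) \<le> sqrt s" for i
      using component_le_norm_cart[of "len \<rho>" i] \<rho>(2) by (intro real_le_rsqrt) (simp add: rigidity_map_self)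
    then have "norm (\<rho> $ u - \<rho> $ w0) \<le> real (k u) * sqrt s" for u by (intro k) simp
    then have "(\<Sum>u\<in>UNIV. norm (\<rho> $ u)) \<le> (\<Sum>u\<in>UNIV. real (k u) * sqrt s)"
      using \<rho>(1) by (intro sum_mono) (simp add: congruence_slice_def)
    moreover have "norm \<rho> \<le> (\<Sum>u\<in>UNIV. norm (\<rho> $ u))"
      unfolding norm_vec_def[of \<rho>] by (rule L2_set_le_sum) simp
    ultimately show ?thesis by linarith
  qed
  then show ?thesis by blast
qed

text \<open>A convergent sequence of measurements is bounded, so by properness its preimages may be
  taken in one compact part of \<open>F\<close>.\<close>

lemma closed_measurement_image:
  assumes F: "closed F" "F \<subseteq> P"
  shows "closed (len ` F)"
  unfolding closed_sequential_limits
proof (intro allI impI)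
  fix x l assume x: "(\<forall>n. x n \<in> len ` F) \<and> x \<longlonglongrightarrow> l"
  then have "bounded (range x)" by (intro convergent_imp_bounded) blast
  then obtain s where s: "\<And>n. norm (x n) \<le> s" by (auto simp: bounded_iff)
  obtain C where C: "\<And>\<rho>. \<rho> \<in> P \<Longrightarrow> norm (len \<rho>) \<le> s \<Longrightarrow> norm \<rho> \<le> C"
    using slice_norm_bound by blast
  have "x n \<in> len ` (F \<inter> cball 0 C)" for n
    using x s[of n] C F(2) by fastforce
  moreover have "compact (len ` (F \<inter> cball 0 C))"
    by (intro compact_continuous_image continuous_on_rigidity_map_self closed_Int_compact F) auto
  ultimately have "l \<in> len ` (F \<inter> cball 0 C)"
    using x closed_sequentially[OF compact_imp_closed] by blast
  then show "l \<in> len ` F" by blast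
qed

text \<open>The rigidity map at \<rho> is injective on \<open>P\<close>, so \<ell> restricted to
  \<open>P\<close> is an immersion there; the opposite inequality always holds.\<close>

definition regular :: "('v, 'd) framework \<Rightarrow> bool" where
  "regular \<rho> \<longleftrightarrow> t \<le> dim (R \<rho> ` P)"

text \<open>Take \<open>T\<close> = im R_\<rho> for a generic \<rho> over \<open>X\<close>.
  Projected to \<open>T\<close>, the critical values form a negligible set and the image of the open
  set over \<open>X\<close> does not. A point of the difference lifts to a value in \<open>X\<close>
  all of whose preimages in \<open>P\<close> are regular.\<close>

lemma ex_regular_value:
  assumes "open X" "X \<inter> (range len) \<noteq> {}"
  obtains y where "y \<in> X \<inter> (range len)" "y \<notin> len ` {p \<in> P. \<not> regular p}"
proof -
  let ?C = "{p \<in> P. \<not> regular p}"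
  have N: "open (len -` X)" "len -` X \<noteq> {}"
    using assms continuous_on_open_vimage[OF open_UNIV, of len] continuous_on_rigidity_map_self by auto
  then obtain \<rho> where \<rho>: "generic \<rho>" "\<rho> \<in> len -` X"
    using ex_generic by blast
  define T where "T = range (R \<rho>)"
  have dimT: "dim T = t" using generic_rank[OF \<rho>(1)] by (simp add: T_def)
  have T: "subspace T"
    unfolding T_def by (rule subspace_range_rigidity_map)
  have "negligible {x. closest_point T x \<in> closest_point T ` len ` ?C}"
  proof (rule negligible_projected_critical_values[OF subspace_congruence_slice T _ _
        has_derivative_rigidity_map_self])
    show "?C \<subseteq> P" by blast
    show "dim P \<le> dim T" using dimT by simp
    fix p assume "p \<in> ?C"
    then have "dim (R p ` P) < dim T" by (simp add: regular_def dimT)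
    moreover have "dim ((\<lambda>x. closest_point T (2 *\<^sub>R x)) ` R p ` P) \<le> dim (R p ` P)"
      using linear_compose[OF linear_scale_self linear_closest_point[OF T]]
      by (intro dim_image_le) (simp add: o_def)
    ultimately show "(\<lambda>v. closest_point T (2 *\<^sub>R R p v)) ` P \<noteq> T"
      by (auto simp: image_image)
  qed
  moreover have "range (\<lambda>v. closest_point T (2 *\<^sub>R R \<rho> v)) = T"
    unfolding T_def by (rule closest_point_range_rigidity_map)
  then have "\<not> negligible {x. closest_point T x \<in> closest_point T ` len ` (len -` X)}"
    by (rule projected_image_not_negligible[OF T N(1) \<rho>(2) has_derivative_rigidity_map_self])
  ultimately obtain x where "closest_point T x \<in> closest_point T ` len ` (len -` X)"
    "closest_point T x \<notin> closest_point T ` len ` ?C"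
    using negligible_subset by (metis (no_types, lifting) mem_Collect_eq subsetI)
  then obtain \<sigma> where "\<sigma> \<in> len -` X" "len \<sigma> \<notin> len ` ?C" by auto
  then show ?thesis using that[of "len \<sigma>"] by blast
qed

text \<open>\<open>T\<close> = R_p(P) serves as parameter space, with \<open>B\<close> inverting
  R_p, and \<open>E\<close> is a projection onto \<open>T\<close>. The constructed \<open>G\<close>
  reads the parameter off the measurement alone and is smooth on an open subset of R^e, as the
  inverse of a chart must be.\<close>

lemma regular_local_inverse:
  assumes p: "p \<in> P" "regular p"
  obtains N W B T and G :: "real^'e \<Rightarrow> real^'e" where "open N" "p \<in> N" "open W" "smooth_map_on W G"
      "linear B" "subspace T"
    "dim T = t" "B ` T = P" "\<And>y. y \<in> T \<Longrightarrow> B y \<in> N \<Longrightarrow> len (B y) \<in> W \<and> G (len (B y)) = y"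
proof -
  let ?A = "R p"
  define T where "T = ?A ` P"
  note linA = linear_rigidity_map[of a b p] and P = subspace_congruence_slice[of w0 w]
  have T: "subspace T" unfolding T_def by (rule linear_subspace_image[OF linA P])
  have dimT: "dim T = t"
    using p(2) dim_image_le[OF linA, of P] by (simp add: T_def regular_def)
  have "dim {x \<in> P. ?A x = 0} = 0"
    using dim_image_kernel[OF linA P] dimT by (simp add: T_def)
  then have "{x \<in> P. ?A x = 0} \<subseteq> {0}" by (simp only: dim_eq_0)
  then have "inj_on ?A P" by (intro inj_on_subspace linA P) blast
  then obtain B where B: "range B \<subseteq> P" "linear B" "\<And>v. v \<in> P \<Longrightarrow> B (?A v) = v"
    using linear_exists_left_inverse_on[OF linA P] by blast
  have BP: "B y \<in> P" for y using B(1) by blast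
  have BT: "B ` T = P" unfolding T_def using B(1,3) by (force simp: image_image)
  have AB: "?A (B y) = y" if "y \<in> T" for y using that B(3) by (auto simp: T_def)
  define E where "E y = ?A (B y)" for y
  have linE: "linear E" unfolding E_def using linear_compose[OF B(2) linA] by (simp add: o_def)
  have EE: "E (E y) = E y" for y by (simp add: E_def B(3) BP)
  have blE: "bounded_linear E" "bounded_linear B"
    using linE B(2) by (simp_all add: linear_conv_bounded_linear)
  have bl_half: "bounded_linear (\<lambda>x. (1/2) *\<^sub>R E x)"
    by (intro bounded_linear_scaleR_right[THEN bounded_linear_compose] blE)
  \<comment> \<open>On \<open>T\<close> this is half of E(\<ell>(B y)); the summand y - E y makes it
    a self-map of R^e with derivative \<open>id\<close> at \<open>?A p\<close>, to which the smooth
    inverse function theorem applies.\<close>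
  define \<Psi> where "\<Psi> y = (y - E y) + (1/2) *\<^sub>R E (len (B y))" for y
  have "times_differentiable_on k UNIV (\<lambda>y. len (B y))" for k
    by (rule times_differentiable_on_compose[OF open_UNIV times_differentiable_on_rigidity_map_self[OF
        open_UNIV]
          times_differentiable_on_ident_linear[OF open_UNIV blE(2)]]) simp
  then have "times_differentiable_on k UNIV \<Psi>" for k
    unfolding \<Psi>_def[abs_def]
    by (rule times_differentiable_on_add[OF open_UNIV times_differentiable_on_ident_linear[OF open_UNIV
          bounded_linear_sub[OF bounded_linear_ident blE(1)]] times_differentiable_on_linear[OF
              open_UNIV bl_half]])
  then have smooth: "smooth_map_on UNIV \<Psi>" by (simp add: smooth_map_on_def)
  have "(\<Psi> has_derivative (\<lambda>v. (v - E v) + (1/2) *\<^sub>R E (2 *\<^sub>R R (B (?A p)) (B v)))) (at (?A p))"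
    unfolding \<Psi>_def[abs_def]
    by (intro has_derivative_add has_derivative_diff has_derivative_ident
        bounded_linear.has_derivative[OF bl_half] bounded_linear_imp_has_derivative blE
        has_derivative_compose[OF bounded_linear_imp_has_derivative[OF blE(2)]
            has_derivative_rigidity_map_self])
  moreover have "(v - E v) + (1/2) *\<^sub>R E (2 *\<^sub>R R (B (?A p)) (B v)) = v" for v
    using EE[of v] by (simp add: B(3) p linear_scale[OF linE]) (simp add: E_def)
  ultimately have "(\<Psi> has_derivative id) (at (?A p))" by (simp add: id_def)
  then obtain U V g where U: "open U" "?A p \<in> U" "open V" "\<And>x. x \<in> U \<Longrightarrow> \<Psi> x \<in> V \<and> g (\<Psi> x) = x"
    and g: "smooth_map_on V g"
    by (rule smooth_local_inverse[OF smooth]) blast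
  let ?h = "\<lambda>x. (1/2) *\<^sub>R E x"
  define W where "W = ?h -` V"
  have openW: "open W"
    unfolding W_def using linear_continuous_on[OF bl_half, of UNIV] U(3) by (intro open_vimage) auto
  show ?thesis
  proof (rule that[of "?A -` U" W "\<lambda>x. g (?h x)" B T])
    have "bounded_linear ?A" using linA by (simp add: linear_conv_bounded_linear)
    then show "open (?A -` U)"
      using linear_continuous_on U(1) by (intro open_vimage) auto
    show "p \<in> ?A -` U" using U(2) by simp
    have "times_differentiable_on k W (\<lambda>x. g (?h x))" for k
      using g by (intro times_differentiable_on_compose[OF openW _
            times_differentiable_on_ident_linear[OF openW bl_half], of k V g])
        (auto simp: W_def smooth_map_on_def)
    then show "smooth_map_on W (\<lambda>x. g (?h x))" by (simp add: smooth_map_on_def)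
    fix y assume y: "y \<in> T" "B y \<in> ?A -` U"
    then have "y \<in> U" by (simp add: AB)
    moreover have "\<Psi> y = ?h (len (B y))" using AB[OF y(1)] by (simp add: \<Psi>_def E_def)
    ultimately show "len (B y) \<in> W \<and> g (?h (len (B y))) = y" using U(4)[of y] by (simp add: W_def)
  qed (fact openW B(2) T dimT BT)+
qed

lemma smooth_points_dense:
  assumes "open X" "X \<inter> (range len) \<noteq> {}"
  shows "\<exists>x\<in>X. smooth_point t (range len) x"
proof -
  note P = subspace_congruence_slice[of w0 w]
  have closedP: "closed P" by (rule closed_subspace[OF P])
  obtain y where y: "y \<in> X \<inter> (range len)" "y \<notin> len ` {p \<in> P. \<not> regular p}"
    by (rule ex_regular_value[OF assms])
  define K where "K = {p \<in> P. len p = y}"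
  have reg: "regular p" if "p \<in> K" for p
    using that y(2) by (auto simp: K_def)
  have "closed {p. len p = y}"
    by (intro closed_Collect_eq continuous_on_rigidity_map_self continuous_on_const)
  then have "closed K" unfolding K_def using closedP by (auto simp: Collect_conj_eq)
  moreover have "bounded K"
    using slice_norm_bound[of "norm y"] by (fastforce simp: K_def bounded_iff)
  ultimately have "compact K" by (simp add: compact_eq_bounded_closed)
  define chart where "chart p N W G B T \<longleftrightarrow> open N \<and> open W \<and> smooth_map_on W G \<and> linear B \<and> subspace T \<and>
    dim T = t \<and> B ` T = P \<and> (\<forall>y\<in>T. B y \<in> N \<longrightarrow> len (B y) \<in> W \<and> G (len (B y)) = y)"
    for p :: "('v, 'd) framework" and N W and G :: "real^'e \<Rightarrow> real^'e" and B T
  have "\<exists>r>0. \<exists>N W G B T. cball p r \<subseteq> N \<and> chart p N W G B T" if "p \<in> K" for p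
  proof -
    have "p \<in> P" "regular p" using that reg by (simp_all add: K_def)
    then obtain N W B T and G :: "real^'e \<Rightarrow> real^'e" where *: "open N" "p \<in> N" "open W" "smooth_map_on W
        G" "linear B" "subspace T"
      "dim T = t" "B ` T = P" "\<And>y. y \<in> T \<Longrightarrow> B y \<in> N \<Longrightarrow> len (B y) \<in> W \<and> G (len (B y)) = y"
      by (rule regular_local_inverse) blast
    obtain r where r: "r > 0" "cball p r \<subseteq> N" using *(1,2) open_contains_cball by blast
    have "chart p N W G B T" unfolding chart_def using *(1,3-9) by blast
    then show ?thesis using r by blast
  qed
  then obtain r where r: "\<And>p. p \<in> K \<Longrightarrow> r p > 0"
    and ex_chart: "\<And>p. p \<in> K \<Longrightarrow> \<exists>N W G B T. cball p (r p) \<subseteq> N \<and> chart p N W G B T"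
    by metis
  have K_cover: "K \<subseteq> (\<Union>p\<in>K. ball p (r p))" using r by force
  \<comment> \<open>Compactness of the fibre over the regular value leaves finitely many
    charts.\<close>
  obtain I where I: "I \<subseteq> K" "finite I" "K \<subseteq> (\<Union>p\<in>I. ball p (r p))"
    by (rule compactE_image[OF \<open>compact K\<close> open_ball K_cover], rule that)
  \<comment> \<open>The image of this part of the slice is closed and misses \<open>y\<close>. Over
    the complement of that image every preimage in \<open>P\<close> lies in one of the chosen
    balls.\<close>
  let ?F = "P - (\<Union>p\<in>I. ball p (r p))"
  have "closed (len ` ?F)"
    by (intro closed_measurement_image closed_Diff closedP open_UN) auto
  moreover have "y \<notin> len ` ?F" using I(3) by (auto simp: K_def)
  ultimately have X1: "open (X - len ` ?F)" "(X - len ` ?F) \<inter> (range len) \<noteq> {}"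
    using assms(1) y(1) by auto
  have cover: "(X - len ` ?F) \<inter> (range len) \<subseteq> (\<Union>p\<in>I. len ` (P \<inter> cball p (r p)))"
  proof
    fix z assume z: "z \<in> (X - len ` ?F) \<inter> (range len)"
    have "z \<in> len ` P" unfolding rigidity_map_self_slice using z by (rule IntD2)
    then obtain q where q: "q \<in> P" "z = len q" by blast
    then have "q \<in> (\<Union>p\<in>I. ball p (r p))" using z by blast
    then obtain p where "p \<in> I" "q \<in> cball p (r p)" using ball_subset_cball by blast
    then show "z \<in> (\<Union>p\<in>I. len ` (P \<inter> cball p (r p)))" using q by blast
  qed
  have closed_pieces: "closed (len ` (P \<inter> cball p (r p)))" for p
    by (intro closed_measurement_image closed_Int closedP closed_cball) blast
  \<comment> \<open>Several sheets may pass over the same values; on a smaller open set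
    \<open>Y\<close> a single closed disc covers all of the measurement set.\<close>
  from open_subset_finite_closed_cover[OF I(2) X1 cover closed_pieces]
  obtain p Y where p: "p \<in> I" and Y: "open Y" "Y \<subseteq> X - len ` ?F" "Y \<inter> range len \<noteq> {}"
    "Y \<inter> range len \<subseteq> len ` (P \<inter> cball p (r p))"
    by (elim bexE exE conjE)
  from ex_chart[OF subsetD[OF I(1) p]]
  obtain N W G B T where Np: "cball p (r p) \<subseteq> N" and chart: "chart p N W G B T"
    by (elim exE conjE)
  have N: "cball p (r p) \<subseteq> N" "open N" and W: "open W" "smooth_map_on W G"
    and B: "linear B" "B ` T = P" and T: "subspace T" "dim T = t"
    and G: "\<And>y. y \<in> T \<Longrightarrow> B y \<in> N \<Longrightarrow> len (B y) \<in> W \<and> G (len (B y)) = y"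
    using Np chart unfolding chart_def by simp_all
  have Y_rep: "\<exists>y\<in>T. B y \<in> N \<and> x = len (B y)" if x: "x \<in> Y \<inter> (range len)" for x
  proof -
    have "x \<in> len ` (P \<inter> cball p (r p))" using x Y(4) by (rule rev_subsetD)
    then obtain q where q: "q \<in> P" "q \<in> cball p (r p)" "x = len q" by blast
    then obtain y where "y \<in> T" "q = B y" using B(2) by blast
    then show ?thesis using q N(1) by blast
  qed
  obtain y1 where y1: "y1 \<in> T" "B y1 \<in> N" "len (B y1) \<in> Y"
  proof -
    obtain x where x: "x \<in> Y \<inter> range len" using Y(3) by blast
    from Y_rep[OF x] x that show ?thesis by blast
  qed
  have blB: "bounded_linear B" using B(1) by (simp add: linear_conv_bounded_linear)
  have contB: "continuous_on UNIV B" by (rule linear_continuous_on[OF blB])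
  have tdlenB: "times_differentiable_on k UNIV (\<lambda>y. len (B y))" for k
    by (rule times_differentiable_on_compose[OF open_UNIV times_differentiable_on_rigidity_map_self[OF
        open_UNIV]
          times_differentiable_on_ident_linear[OF open_UNIV blB]]) simp
  have "open (B -` N \<inter> (\<lambda>y. len (B y)) -` Y)"
    using N(2) Y(1) contB times_differentiable_on_imp_continuous_on[OF tdlenB]
    by (intro open_Int open_vimage) auto
  then obtain \<delta> where \<delta>: "\<delta> > 0" "ball y1 \<delta> \<subseteq> B -` N \<inter> (\<lambda>y. len (B y)) -` Y"
    using y1 by (meson IntI openE vimageI)
  \<comment> \<open>The small ball about \<open>y1\<close> in \<open>T\<close> is stretched to all
    of \<open>T\<close>.\<close>
  define f where "f v = len (B (y1 + ball_chart \<delta> v))" for v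
  define g where "g x = ball_chart_inv \<delta> (G x - y1)" for x
  \<comment> \<open>Restricting to values whose parameter lies in the ball makes the image of
    \<open>f\<close> exactly the trace of an open set (\<open>image\<close>) and keeps
    \<open>ball_chart_inv\<close> smooth.\<close>
  define W' where "W' = W \<inter> (\<lambda>x. G x - y1) -` ball 0 \<delta>"
  have tdG: "times_differentiable_on k W G" for k using W(2) by (simp add: smooth_map_on_def)
  have "continuous_on W (\<lambda>x. G x - y1)"
    by (intro continuous_intros times_differentiable_on_imp_continuous_on[OF tdG])
  then have openW': "open W'"
    unfolding W'_def by (rule continuous_open_preimage) (use W in auto)
  have bc_T: "ball_chart \<delta> v \<in> T" "ball_chart_inv \<delta> v \<in> T" if "v \<in> T" for v
    using that T(1) by (simp_all add: ball_chart_def ball_chart_inv_def subspace_scale)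
  have y_in: "y1 + ball_chart \<delta> v \<in> T" "y1 + ball_chart \<delta> v \<in> ball y1 \<delta>" if "v \<in> T" for v
    using y1(1) bc_T(1)[OF that] T(1) norm_ball_chart[OF \<delta>(1), of v] by (simp_all add: subspace_add dist_norm)
  have fT: "f v \<in> W \<and> G (f v) = y1 + ball_chart \<delta> v" "f v \<in> Y" if "v \<in> T" for v
    using y_in[OF that] \<delta>(2) G[of "y1 + ball_chart \<delta> v"] by (auto simp: f_def)
  have image: "f ` T = (range len) \<inter> (Y \<inter> W')"
  proof (intro subset_antisym subsetI)
    fix x assume "x \<in> f ` T"
    then obtain v where v: "v \<in> T" "x = f v" by blast
    then show "x \<in> (range len) \<inter> (Y \<inter> W')"
      using fT[OF v(1)] norm_ball_chart[OF \<delta>(1), of v] by (auto simp: W'_def f_def)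
  next
    fix x assume x: "x \<in> (range len) \<inter> (Y \<inter> W')"
    then obtain y' where y': "y' \<in> T" "B y' \<in> N" "x = len (B y')" using Y_rep by blast
    then have "G x = y'" using G by blast
    then have less: "norm (y' - y1) < \<delta>" using x by (simp add: W'_def)
    let ?v = "ball_chart_inv \<delta> (y' - y1)"
    have "?v \<in> T" using y'(1) y1(1) T(1) by (intro bc_T subspace_diff)
    moreover have "f ?v = x" using less y'(3) by (simp add: f_def ball_chart_ball_chart_inv)
    ultimately show "x \<in> f ` T" by blast
  qed
  have tdbc: "times_differentiable_on k UNIV (\<lambda>v. y1 + ball_chart \<delta> v)" for k
    by (rule times_differentiable_on_add[OF open_UNIV times_differentiable_on_const[OF open_UNIV]
          times_differentiable_on_ball_chart])
  have "times_differentiable_on k UNIV f" for k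
    unfolding f_def[abs_def] by (rule times_differentiable_on_compose[OF open_UNIV tdlenB tdbc]) simp
  then have smooth_f: "smooth_map_on UNIV f" by (simp add: smooth_map_on_def)
  have "times_differentiable_on k W' (\<lambda>x. G x - y1)" for k
    using times_differentiable_on_add[OF openW' times_differentiable_on_subset[OF tdG]
        times_differentiable_on_const[OF openW'], of k "- y1"] by (simp add: W'_def)
  then have "times_differentiable_on k W' g" for k
    unfolding g_def[abs_def]
    by (rule times_differentiable_on_ball_chart_inv[OF openW']) (simp add: W'_def)
  then have smooth_g: "smooth_map_on W' g" by (simp add: smooth_map_on_def)
  have "smooth_chart t (range len) (f ` T) T W' f g"
  proof
    show "openin (top_of_set (range len)) (f ` T)"
      unfolding image using Y(1) openW' by (intro openin_open_Int open_Int)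
    show "f ` T \<subseteq> W'" unfolding image by blast
    show "g (f v) = v" if "v \<in> T" for v
      using fT(1)[OF that] by (simp add: g_def ball_chart_inv_ball_chart[OF \<delta>(1)])
  qed (fact T openW' smooth_f smooth_g refl)+
  moreover have "f 0 \<in> f ` T" using subspace_0[OF T(1)] by blast
  ultimately have "smooth_point t (range len) (f 0)" using smooth_point_iff_chart by blast
  moreover have "f 0 \<in> X" using fT(2)[OF subspace_0[OF T(1)]] Y(2) by blast
  ultimately show ?thesis by blast
qed

end

section \<open>The shared stress kernel\<close>

text \<open>The rigidity map in dimension one, of the scalar configuration \<open>x\<close> and the
  indicator of the vertex \<open>u\<close>.\<close>

definition rigidity_form :: "('e::finite \<Rightarrow> 'v::finite) \<Rightarrow> ('e \<Rightarrow> 'v) \<Rightarrow> real^'v \<Rightarrow> 'v \<Rightarrow> real^'e" where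
  "rigidity_form a b x u = (\<chi> i. (x $ a i - x $ b i) * (axis u 1 $ a i - axis u 1 $ b i))"

text \<open>The shared stress kernel in dual form: annihilation by all stresses becomes membership
  in the space that they annihilate. This form is convenient for varying \<rho>.\<close>

definition infinitesimal_kernel ::
    "('e::finite \<Rightarrow> 'v::finite) \<Rightarrow> ('e \<Rightarrow> 'v) \<Rightarrow> ('v, 'd::finite) framework \<Rightarrow> (real^'v) set" where
  "infinitesimal_kernel a b \<rho> = {x. \<forall>u. rigidity_form a b x u \<in> range (rigidity_map a b \<rho>)}"

lemma linear_rigidity_form: "linear (\<lambda>x. rigidity_form a b x u)"
  by (rule linearI) (simp_all add: rigidity_form_def vec_eq_iff algebra_simps)

lemma subspace_infinitesimal_kernel: "subspace (infinitesimal_kernel a b \<rho>)"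
  using subspace_add[OF subspace_range_rigidity_map[of a b \<rho>]]
    subspace_scale[OF subspace_range_rigidity_map[of a b \<rho>]] subspace_0[OF
        subspace_range_rigidity_map[of a b \<rho>]]
  by (intro subspaceI) (simp_all add: infinitesimal_kernel_def linear_add[OF linear_rigidity_form]
      linear_scale[OF linear_rigidity_form] linear_0[OF linear_rigidity_form])

lemma rigidity_map_axis:
  fixes \<tau> :: "('v::finite, 'd::finite) framework"
  shows "rigidity_map a b \<tau> (axis u (axis j 1)) = rigidity_form a b (\<chi> v. \<tau> $ v $ j) u"
proof -
  have "(axis u (axis j 1) :: ('v, 'd) framework) $ v = (axis u 1 $ v) *\<^sub>R axis j 1" for v
    by (simp add: axis_def)
  note ax = this
  show ?thesis
    unfolding vec_eq_iff rigidity_map_def rigidity_form_def vec_lambda_beta ax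
    by (simp add: inner_diff_right inner_axis algebra_simps)
qed

text \<open>It is enough to test \<sigma> on basis vectors, and there the rigidity map sees a single
  coordinate of \<tau>.\<close>

lemma rigidity_map_in_subspace_iff:
  fixes \<tau> :: "('v::finite, 'd::finite) framework"
  assumes "subspace T"
  shows "(\<forall>\<sigma>. rigidity_map a b \<tau> \<sigma> \<in> T) \<longleftrightarrow> (\<forall>u j. rigidity_form a b (\<chi> v. \<tau> $ v $ j) u \<in> T)"
proof
  assume *: "\<forall>u j. rigidity_form a b (\<chi> v. \<tau> $ v $ j) u \<in> T"
  show "\<forall>\<sigma>. rigidity_map a b \<tau> \<sigma> \<in> T"
  proof
    fix \<sigma> :: "('v, 'd) framework"
    have "\<sigma> = (\<Sum>e\<in>Basis. (\<sigma> \<bullet> e) *\<^sub>R e)" by (simp add: euclidean_representation)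
    then have "rigidity_map a b \<tau> \<sigma> = (\<Sum>e\<in>Basis. (\<sigma> \<bullet> e) *\<^sub>R rigidity_map a b \<tau> e)"
      by (metis (no_types, lifting) linear_rigidity_map linear_sum linear_scale sum.cong)
    also have "\<dots> \<in> T"
    proof (intro subspace_sum subspace_scale assms)
      fix e :: "('v, 'd) framework" assume "e \<in> Basis"
      then obtain u j where "e = axis u (axis j 1)" by (auto simp: Basis_vec_def)
      then show "rigidity_map a b \<tau> e \<in> T" using * by (simp add: rigidity_map_axis)
    qed
    finally show "rigidity_map a b \<tau> \<sigma> \<in> T" .
  qed
qed (metis rigidity_map_axis)

text \<open>With the signed incidence matrix \<open>c\<close>, \<Omega> \<omega> is the Laplacian
  with edge weights \<omega>. It is in equilibrium iff \<omega> is orthogonal to im R_\<rho>, and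
  its action on \<open>x\<close> is \<omega> paired with the forms of \<open>x\<close>. So
  \<open>x\<close> is in the shared kernel iff its forms lie in the double orthogonal complement of
  im R_\<rho>, which is im R_\<rho>.\<close>

lemma shared_stress_kernel_eq_infinitesimal_kernel:
  fixes edge :: "'e::finite \<Rightarrow> 'v::finite set" and \<rho> :: "('v, 'd::finite) framework"
  assumes edge: "\<And>i. edge i = {a i, b i}" "\<And>i. a i \<noteq> b i" and inj: "inj edge"
  shows "shared_stress_kernel edge \<rho> = infinitesimal_kernel a b \<rho>"
proof -
  define c where "c i u = axis u 1 $ a i - (axis u 1 $ b i :: real)" for i and u :: 'v
  have c_eq: "c i u = (if a i = u then 1 else 0) - (if b i = u then 1 else 0)" for i u
    by (simp add: c_def axis_def)
  define \<Omega> :: "real^'e \<Rightarrow> real^'v^'v" where "\<Omega> \<omega> = (\<chi> u v. \<Sum>i\<in>UNIV. \<omega> $ i * c i u * c i v)" for \<omega>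
  have c_sum: "(\<Sum>v\<in>UNIV. c i v *\<^sub>R y v) = y (a i) - y (b i)" for i and y :: "'v \<Rightarrow> 'z::real_vector"
    by (simp add: c_eq scaleR_diff_left sum_subtractf if_distrib[of "\<lambda>x. x *\<^sub>R _"] cong: if_cong)
  have \<Omega>_sum: "(\<Sum>v\<in>UNIV. \<Omega> \<omega> $ u $ v *\<^sub>R y v) = (\<Sum>i\<in>UNIV. (\<omega> $ i * c i u) *\<^sub>R (y (a i) - y (b i)))"
    for \<omega> u and y :: "'v \<Rightarrow> 'z::real_vector"
  proof -
    have "(\<Sum>v\<in>UNIV. \<Omega> \<omega> $ u $ v *\<^sub>R y v) = (\<Sum>v\<in>UNIV. \<Sum>i\<in>UNIV. (\<omega> $ i * c i u) *\<^sub>R (c i v *\<^sub>R y v))"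
      by (simp add: \<Omega>_def scaleR_sum_left)
    also have "\<dots> = (\<Sum>i\<in>UNIV. (\<omega> $ i * c i u) *\<^sub>R (\<Sum>v\<in>UNIV. c i v *\<^sub>R y v))"
      by (subst sum.swap) (simp add: scaleR_sum_right)
    finally show ?thesis by (simp only: c_sum)
  qed
  have \<Omega>_mult: "(\<Omega> \<omega> *v x) $ u = \<omega> \<bullet> rigidity_form a b x u" for \<omega> x u
    using \<Omega>_sum[of \<omega> u "\<lambda>v. x $ v"]
    by (simp add: matrix_vector_mult_def inner_vec_def rigidity_form_def c_def algebra_simps)
  have \<Omega>_equilibrium: "(\<forall>u. (\<Sum>v\<in>UNIV. \<Omega> \<omega> $ u $ v *\<^sub>R \<rho> $ v) = 0) \<longleftrightarrow> (\<forall>y \<in> range (rigidity_map a b \<rho>).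
      orthogonal y \<omega>)" for \<omega>
  proof -
    have "(\<Sum>v\<in>UNIV. \<Omega> \<omega> $ u $ v *\<^sub>R \<rho> $ v) $ j = \<omega> \<bullet> rigidity_form a b (\<chi> v. \<rho> $ v $ j) u" for u j
      using \<Omega>_sum[of \<omega> u "\<lambda>v. \<rho> $ v $ j"]
      by (simp add: inner_vec_def rigidity_form_def c_def algebra_simps)
    then have "(\<forall>u. (\<Sum>v\<in>UNIV. \<Omega> \<omega> $ u $ v *\<^sub>R \<rho> $ v) = 0) \<longleftrightarrow>
        (\<forall>u j. rigidity_form a b (\<chi> v. \<rho> $ v $ j) u \<in> {y. \<omega> \<bullet> y = 0})"
      by (simp only: vec_eq_iff[of "sum _ _"] zero_index mem_Collect_eq)
    also have "\<dots> \<longleftrightarrow> (\<forall>\<sigma>. rigidity_map a b \<rho> \<sigma> \<in> {y. \<omega> \<bullet> y = 0})"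
      by (rule rigidity_map_in_subspace_iff[symmetric, OF subspace_hyperplane])
    finally show ?thesis by (simp add: orthogonal_def inner_commute)
  qed
  have \<Omega>_offdiag: "\<Omega> \<omega> $ u $ v = - \<omega> $ i" if "u \<noteq> v" "{u, v} = edge i" for \<omega> u v i
  proof -
    have "\<omega> $ j * c j u * c j v = (if j = i then - \<omega> $ i else 0)" for j
    proof (cases "j = i")
      case True
      then show ?thesis using that edge[of i] by (auto simp: c_eq doubleton_eq_iff)
    next
      case False
      then have "edge j \<noteq> {u, v}" using inj that(2) by (metis injD)
      then show ?thesis using False that(1) edge(1)[of j] by (auto simp: c_eq)
    qed
    then show ?thesis by (simp add: \<Omega>_def)
  qed
  have \<Omega>_nonedge: "\<Omega> \<omega> $ u $ v = 0" if "u \<noteq> v" "{u, v} \<notin> range edge" for \<omega> u v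
  proof -
    have "c j u * c j v = 0" for j
    proof -
      have "edge j \<noteq> {u, v}" using that(2) by blast
      then show ?thesis using that(1) edge(1)[of j] by (auto simp: c_eq)
    qed
    then show ?thesis unfolding \<Omega>_def vec_lambda_beta mult.assoc by (intro sum.neutral) simp
  qed
  have \<Omega>_rows: "(\<Sum>v\<in>UNIV. \<Omega> \<omega> $ u $ v) = 0" for \<omega> u
    using \<Omega>_sum[of \<omega> u "\<lambda>_. 1 :: real"] by simp
  have \<Omega>_stress: "\<Omega> \<omega> \<in> stress_matrices edge \<rho>" if "\<And>y. y \<in> range (rigidity_map a b \<rho>) \<Longrightarrow> orthogonal y \<omega>" for \<omega>
    using that \<Omega>_equilibrium[of \<omega>] \<Omega>_nonedge \<Omega>_rows
    by (auto simp: stress_matrices_def transpose_def vec_eq_iff \<Omega>_def mult_ac)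
  have stress_\<Omega>: "\<exists>\<omega>. \<Theta> = \<Omega> \<omega>" if \<Theta>: "\<Theta> \<in> stress_matrices edge \<rho>" for \<Theta>
  proof
    \<comment> \<open>Off the diagonal the Laplacian carries minus the weight, and injectivity of
      \<open>edge\<close> leaves one summand per entry. The diagonal is then fixed by the zero row
      sums.\<close>
    define \<omega> where "\<omega> = (\<chi> i. - \<Theta> $ a i $ b i)"
    have sym: "\<Theta> $ u $ v = \<Theta> $ v $ u" for u v
    proof -
      have "transpose \<Theta> = \<Theta>" using \<Theta> by (simp add: stress_matrices_def)
      then have "transpose \<Theta> $ u $ v = \<Theta> $ u $ v" by simp
      then show ?thesis by (simp add: transpose_def)
    qed
    have off: "\<Theta> $ u $ v = \<Omega> \<omega> $ u $ v" if uv: "u \<noteq> v" for u v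
    proof (cases "{u, v} \<in> range edge")
      case True
      then obtain i where i: "{u, v} = edge i" by blast
      then have "u = a i \<and> v = b i \<or> u = b i \<and> v = a i" by (simp add: edge doubleton_eq_iff)
      then have "\<Theta> $ u $ v = \<Theta> $ a i $ b i" using sym by metis
      then show ?thesis using \<Omega>_offdiag[OF uv i, of \<omega>] by (simp add: \<omega>_def)
    next
      case False
      then show ?thesis using \<Theta> uv \<Omega>_nonedge[OF uv False] by (simp add: stress_matrices_def)
    qed
    have "\<Theta> $ u $ v = \<Omega> \<omega> $ u $ v" for u v
    proof (cases "u = v")
      case True
      have "(\<Sum>v\<in>UNIV. \<Theta> $ u $ v) = (\<Sum>v\<in>UNIV. \<Omega> \<omega> $ u $ v)"
        using \<Theta> \<Omega>_rows by (simp add: stress_matrices_def)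
      moreover have "(\<Sum>v\<in>UNIV - {u}. \<Theta> $ u $ v) = (\<Sum>v\<in>UNIV - {u}. \<Omega> \<omega> $ u $ v)"
        using off by (intro sum.cong) auto
      ultimately have "\<Theta> $ u $ u = \<Omega> \<omega> $ u $ u"
        by (simp add: sum.remove[of UNIV u])
      then show ?thesis using True by simp
    qed (rule off)
    then show "\<Theta> = \<Omega> \<omega>" by (simp add: vec_eq_iff)
  qed
  have "x \<in> shared_stress_kernel edge \<rho> \<longleftrightarrow>
      (\<forall>\<omega>. (\<forall>y \<in> range (rigidity_map a b \<rho>). orthogonal y \<omega>) \<longrightarrow> (\<forall>u. \<omega> \<bullet> rigidity_form a b x u = 0))" for x
  proof
    assume x: "x \<in> shared_stress_kernel edge \<rho>"
    show "\<forall>\<omega>. (\<forall>y \<in> range (rigidity_map a b \<rho>). orthogonal y \<omega>) \<longrightarrow> (\<forall>u. \<omega> \<bullet> rigidity_form a b x u = 0)"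
    proof (intro allI impI)
      fix \<omega> u assume "\<forall>y \<in> range (rigidity_map a b \<rho>). orthogonal y \<omega>"
      then have "\<Omega> \<omega> \<in> stress_matrices edge \<rho>" by (intro \<Omega>_stress) blast
      then have "\<Omega> \<omega> *v x = 0" using x by (simp add: shared_stress_kernel_def)
      then show "\<omega> \<bullet> rigidity_form a b x u = 0" by (simp flip: \<Omega>_mult)
    qed
  next
    assume x: "\<forall>\<omega>. (\<forall>y \<in> range (rigidity_map a b \<rho>). orthogonal y \<omega>) \<longrightarrow> (\<forall>u. \<omega> \<bullet> rigidity_form a b x u = 0)"
    have "\<Theta> *v x = 0" if \<Theta>: "\<Theta> \<in> stress_matrices edge \<rho>" for \<Theta>
    proof -
      obtain \<omega> where \<omega>: "\<Theta> = \<Omega> \<omega>" using stress_\<Omega>[OF \<Theta>] by blast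
      have "\<forall>u. (\<Sum>v\<in>UNIV. \<Omega> \<omega> $ u $ v *\<^sub>R \<rho> $ v) = 0"
        using \<Theta> by (simp add: \<omega> stress_matrices_def)
      then have "\<forall>u. \<omega> \<bullet> rigidity_form a b x u = 0"
        using x unfolding \<Omega>_equilibrium by blast
      then show ?thesis by (simp add: \<omega> vec_eq_iff \<Omega>_mult)
    qed
    then show "x \<in> shared_stress_kernel edge \<rho>" by (simp add: shared_stress_kernel_def)
  qed
  also have "\<dots> x \<longleftrightarrow> (\<forall>u. rigidity_form a b x u \<in> (range (rigidity_map a b \<rho>))\<^sup>\<bottom>\<^sup>\<bottom>)" for x
    unfolding orthogonal_comp_def by (auto simp: orthogonal_def inner_commute)
  finally show ?thesis
    unfolding orthogonal_comp_self[OF subspace_range_rigidity_map] infinitesimal_kernel_def by blast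
qed

text \<open>\<open>x\<close> lies in the infinitesimal kernel iff it extends to an element \<open>(x, \<sigma>)\<close> of the kernel of a
  linear map whose matrix depends polynomially on \<open>\<rho>\<close>; this makes the dimension a difference of
  generic ranks.\<close>

lemma dim_infinitesimal_kernel_generic:
  fixes \<rho> \<rho>' :: "('v::finite, 'd::finite) framework" and a b :: "'e::finite \<Rightarrow> 'v"
  assumes gen: "generic \<rho>" "generic \<rho>'"
  shows "dim (infinitesimal_kernel a b \<rho>) = dim (infinitesimal_kernel a b \<rho>')"
proof -
  define A :: "('v, 'd) framework \<Rightarrow> (real^'v) \<times> (real^'d^'v^'v) \<Rightarrow> real^('v \<times> 'e)"
    where "A \<rho> = (\<lambda>(x, \<sigma>). \<chi> p. rigidity_form a b x (fst p) $ snd p - rigidity_map a b \<rho> (\<sigma> $ fst p) $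
        snd p)" for \<rho>
  have linA: "linear (A \<rho>)" for \<rho>
    by (rule linearI) (auto simp: A_def vec_eq_iff linear_add[OF linear_rigidity_form]
        linear_add[OF linear_rigidity_map] linear_scale[OF linear_rigidity_form] linear_scale[OF
            linear_rigidity_map]
        algebra_simps)
  have polA: "rational_polynomial (\<lambda>\<rho>. A \<rho> e $ p)" if "e \<in> Basis" for e p
  proof -
    obtain x \<sigma> where e: "e = (x, \<sigma>)" by force
    have x: "x $ u \<in> \<rat>" for u
      using that by (auto simp: e Basis_prod_def Basis_vec_def axis_def)
    have \<sigma>: "\<sigma> $ u $ v $ j \<in> \<rat>" for u v j
      using that by (auto simp: e Basis_prod_def Basis_vec_def axis_def)
    have "rigidity_form a b x (fst p) $ snd p \<in> \<rat>"
      using x by (auto simp: rigidity_form_def axis_def)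
    then obtain q where q: "rigidity_form a b x (fst p) $ snd p = of_rat q" by (rule Rats_cases)
    have "rational_polynomial (\<lambda>\<rho>. rigidity_map a b \<rho> (\<sigma> $ fst p) $ snd p)"
      by (rule rational_polynomial_rigidity_map) (rule \<sigma>)
    from rational_polynomial_diff[OF rational_polynomial_const[of q] this]
    show ?thesis by (simp add: A_def e q)
  qed
  \<comment> \<open>The kernel of \<open>A\<close> projects onto the infinitesimal kernel, and the
    fibre over 0 consists of one element of ker R_\<rho> for each vertex. Rank-nullity then
    expresses the dimension through two generic ranks.\<close>
  have dims: "dim (infinitesimal_kernel a b \<rho>) + CARD('v) * (DIM(('v, 'd) framework) - dim (range
      (rigidity_map a b \<rho>)))
      = DIM((real^'v) \<times> (real^'d^'v^'v)) - dim (range (A \<rho>))" for \<rho> :: "('v, 'd) framework"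
  proof -
    let ?R = "rigidity_map a b \<rho>"
    let ?W = "{z \<in> UNIV. A \<rho> z = 0}" and ?Q = "{\<tau> \<in> UNIV. ?R \<tau> = 0}"
    have A0: "A \<rho> (x, \<sigma>) = 0 \<longleftrightarrow> (\<forall>u. rigidity_form a b x u = ?R (\<sigma> $ u))" for x \<sigma>
      by (auto simp: A_def vec_eq_iff)
    have W: "subspace ?W"
      by (auto simp: subspace_def linear_0[OF linA] linear_add[OF linA] linear_scale[OF linA])
    have Q: "subspace ?Q"
      by (auto simp: subspace_def linear_0[OF linear_rigidity_map] linear_add[OF linear_rigidity_map]
          linear_scale[OF linear_rigidity_map])
    have fstW: "fst ` ?W = infinitesimal_kernel a b \<rho>"
    proof (intro subset_antisym subsetI)
      fix x assume "x \<in> fst ` ?W"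
      then show "x \<in> infinitesimal_kernel a b \<rho>" by (auto simp: A0 infinitesimal_kernel_def)
    next
      fix x assume "x \<in> infinitesimal_kernel a b \<rho>"
      then have "\<forall>u. \<exists>\<tau>. rigidity_form a b x u = ?R \<tau>" by (auto simp: infinitesimal_kernel_def)
      then obtain s where "\<And>u. rigidity_form a b x u = ?R (s u)" by metis
      then have "(x, \<chi> u. s u) \<in> ?W" by (simp add: A0)
      then show "x \<in> fst ` ?W" by force
    qed
    let ?Z = "{z \<in> ?W. fst z = 0}"
    have W0: "subspace ?Z"
      using subspace_0[OF W] subspace_add[OF W] subspace_scale[OF W] by (intro subspaceI) simp_all
    have "snd ` ?Z = {\<sigma> :: real^'d^'v^'v. \<forall>u. \<sigma> $ u \<in> ?Q}"
    proof (intro subset_antisym subsetI)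
      fix \<sigma> assume "\<sigma> \<in> snd ` ?Z"
      then have "A \<rho> (0, \<sigma>) = 0" by auto
      then show "\<sigma> \<in> {\<sigma>. \<forall>u. \<sigma> $ u \<in> ?Q}" by (simp add: A0 linear_0[OF linear_rigidity_form])
    next
      fix \<sigma> :: "real^'d^'v^'v" assume "\<sigma> \<in> {\<sigma>. \<forall>u. \<sigma> $ u \<in> ?Q}"
      then have "(0, \<sigma>) \<in> ?Z" by (simp add: A0 linear_0[OF linear_rigidity_form])
      then show "\<sigma> \<in> snd ` ?Z" by force
    qed
    moreover have "dim (snd ` ?Z) = dim ?Z"
      by (rule dim_image_inj_on[OF linear_snd W0]) (auto simp: inj_on_def)
    ultimately have Z: "dim ?Z = CARD('v) * dim ?Q"
      using dim_vec_components[OF Q, where 'n='v] by simp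
    have dimW: "dim (infinitesimal_kernel a b \<rho>) + dim ?Z = dim ?W"
      using dim_image_kernel[OF linear_fst W] unfolding fstW .
    have dimA: "dim (range (A \<rho>)) + dim ?W = DIM((real^'v) \<times> (real^'d^'v^'v))"
      using dim_image_kernel[OF linA subspace_UNIV] unfolding dim_UNIV .
    have dimQ: "DIM(('v, 'd) framework) - dim (range ?R) = dim ?Q"
      using dim_image_kernel[OF linear_rigidity_map[of a b \<rho>] subspace_UNIV] unfolding dim_UNIV by linarith
    show ?thesis
      unfolding dimQ using Z dimW dimA by linarith
  qed
  have "dim (range (A \<rho>)) = dim (range (A \<rho>'))"
    using generic_rank_maximal[OF linA polA gen(1)] generic_rank_maximal[OF linA polA gen(2)]
    by (simp add: antisym)
  moreover have "dim (range (rigidity_map a b \<rho>)) = dim (range (rigidity_map a b \<rho>'))"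
    by (rule antisym) (intro generic_rigidity_map_rank_maximal gen)+
  ultimately show ?thesis
    using dims[of \<rho>] dims[of \<rho>'] by simp
qed

section \<open>The rank of the Gauss map\<close>

lemma bounded_bilinear_matrix_vector_mult:
  "bounded_bilinear (\<lambda>(A :: real^'n^'m) x. A *v x)"
  unfolding bilinear_conv_bounded_bilinear[symmetric] bilinear_def
  by (auto intro!: linearI simp: matrix_vector_mult_add_rdistrib matrix_vector_right_distrib
      scaleR_matrix_vector_assoc matrix_vector_mult_scaleR)

lemma bounded_bilinear_matrix_mult:
  "bounded_bilinear (\<lambda>(A :: real^'n^'m) (B :: real^'p^'n). A ** B)"
  unfolding bilinear_conv_bounded_bilinear[symmetric] bilinear_def
  by (auto intro!: linearI simp: matrix_matrix_mult_def vec_eq_iff algebra_simps sum.distrib sum_distrib_left)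

lemma bounded_linear_transpose: "bounded_linear (transpose :: real^'n^'m \<Rightarrow> real^'m^'n)"
  unfolding linear_conv_bounded_linear[symmetric]
  by (auto intro!: linearI simp: transpose_def vec_eq_iff)

text \<open>Used to differentiate identities that hold in a neighbourhood.\<close>

lemma has_derivative_unique_on_open:
  assumes "(f has_derivative D) (at x)" "(g has_derivative D') (at x)" "open X" "x \<in> X"
    "\<And>y. y \<in> X \<Longrightarrow> f y = g y"
  shows "D = D'"
  using has_derivative_unique[OF has_derivative_transform_within_open[OF assms(1,3,4,5)] assms(2)] .

context rigid_graph
begin

lemma dim_columns:
  assumes K: "subspace K"
  shows "dim {\<tau> :: ('v, 'd) framework. \<forall>j. (\<chi> v. \<tau> $ v $ j) \<in> K} = CARD('d) * dim K"
proof -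
  let ?f = "\<lambda>y :: real^'v^'d. (\<chi> v j. y $ j $ v) :: ('v, 'd) framework"
  have lin: "linear ?f" by (rule linearI) (simp_all add: vec_eq_iff)
  have S: "subspace {y :: real^'v^'d. \<forall>j. y $ j \<in> K}"
    using subspace_0[OF K] subspace_add[OF K] subspace_scale[OF K] by (intro subspaceI) simp_all
  have "inj_on ?f {y. \<forall>j. y $ j \<in> K}" by (auto simp: inj_on_def vec_eq_iff)
  from dim_image_inj_on[OF lin S this]
  have "dim (?f ` {y. \<forall>j. y $ j \<in> K}) = CARD('d) * dim K" by (simp add: dim_vec_components[OF K])
  moreover have "?f ` {y. \<forall>j. y $ j \<in> K} = {\<tau>. \<forall>j. (\<chi> v. \<tau> $ v $ j) \<in> K}"
  proof (intro subset_antisym subsetI)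
    fix \<tau> :: "('v, 'd) framework" assume \<tau>: "\<tau> \<in> {\<tau>. \<forall>j. (\<chi> v. \<tau> $ v $ j) \<in> K}"
    have "\<tau> = ?f (\<chi> j v. \<tau> $ v $ j)" by (simp add: vec_eq_iff)
    moreover have "(\<chi> j v. \<tau> $ v $ j) \<in> {y :: real^'v^'d. \<forall>j. y $ j \<in> K}" using \<tau> by simp
    ultimately show "\<tau> \<in> ?f ` {y. \<forall>j. y $ j \<in> K}" by (rule image_eqI)
  qed auto
  ultimately show ?thesis by simp
qed

lemma range_rigidity_map_subset_tangent_space: "range (R \<rho>) \<subseteq> tangent_space (range len) (len \<rho>)"
proof (rule image_subsetI)
  fix \<sigma>
  \<comment> \<open>The factor 1/2 cancels the 2 in the derivative of \<ell>.\<close>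
  let ?\<gamma> = "\<lambda>s::real. len (\<rho> + s *\<^sub>R ((1/2) *\<^sub>R \<sigma>))"
  have "((\<lambda>s::real. \<rho> + s *\<^sub>R ((1/2) *\<^sub>R \<sigma>)) has_derivative (\<lambda>s. s *\<^sub>R ((1/2) *\<^sub>R \<sigma>))) (at 0)"
    by (auto intro!: derivative_eq_intros)
  from has_derivative_compose[OF this has_derivative_rigidity_map_self]
  have "(?\<gamma> has_vector_derivative R \<rho> \<sigma>) (at 0)"
    by (simp add: has_vector_derivative_def linear_scale[OF linear_rigidity_map])
  then show "R \<rho> \<sigma> \<in> tangent_space (range len) (len \<rho>)"
    unfolding tangent_space_def by (intro CollectI exI[of _ ?\<gamma>]) auto
qed

lemma tangent_space_generic:
  assumes "generic \<rho>" "smooth_point t (range len) (len \<rho>)"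
  shows "tangent_space (range len) (len \<rho>) = range (R \<rho>)"
  using subspace_dim_equal[OF subspace_range_rigidity_map _ range_rigidity_map_subset_tangent_space[of \<rho>]]
    dim_tangent_space_smooth_point[OF assms(2)] generic_rank[OF assms(1)] by simp

text \<open>A chart of dimension \<open>t'\<close> covers a relatively open set, which by density
  contains a smooth point of dimension \<open>t\<close>. The tangent space there has both
  dimensions.\<close>

lemma smooth_point_dim:
  assumes "smooth_point t' (range len) x"
  shows "t' = t"
proof -
  from assms obtain U L W f g where x: "x \<in> U" and chart: "smooth_chart t' (range len) U L W f g"
    by (auto simp: smooth_point_iff_chart)
  obtain X where X: "open X" "U = range len \<inter> X"
    using smooth_chart.U[OF chart] by (auto simp: openin_open)
  then have "X \<inter> range len \<noteq> {}" using x by blast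
  then obtain y where y: "y \<in> X" "smooth_point t (range len) y"
    using smooth_points_dense[OF X(1)] by blast
  then have "y \<in> U" using X smooth_point_in by blast
  then have "smooth_point t' (range len) y" using chart smooth_point_iff_chart by blast
  then show ?thesis
    using dim_tangent_space_smooth_point(1) y(2) by metis
qed

lemma semialgebraic_dim_measurement_set: "semialgebraic_dim (range len) = t"
proof -
  obtain x where "smooth_point t (range len) x"
    using smooth_points_dense[of UNIV] by auto
  then have "{t'. \<exists>x. smooth_point t' (range len) x} = {t}"
    using smooth_point_dim by blast
  then show ?thesis by (simp add: semialgebraic_dim_def)
qed

end

section \<open>The Gauss map after the length map, at generic frameworks\<close>

locale rigid_graph_chart = rigid_graph a b w0 w +
  C: euclidean_smooth_chart "dim (congruence_slice w0 w)" "range (\<lambda>\<rho> :: ('v, 'd) framework. rigidity_map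
      a b \<rho> \<rho>)" U L W f g
  for a b :: "'e::finite \<Rightarrow> 'v::finite" and w0 :: 'v and w :: "'d::finite \<Rightarrow> 'v" and U L W f g
begin

lemma gauss_len_has_derivative:
  assumes z: "z \<in> L" "f z = len \<rho>"
  shows "((\<lambda>\<sigma>. projection_matrix (gauss_map (range len) (len \<sigma>))) has_derivative
    (\<lambda>\<tau>. C.\<Phi>' z (C.g' (len \<rho>) (2 *\<^sub>R R \<rho> \<tau>)))) (at \<rho>)"
proof -
  obtain X where X: "open X" "U = range len \<inter> X"
    using C.U by (auto simp: openin_open)
  have \<rho>: "len \<rho> \<in> U" using C.f_in_U[OF z(1)] z(2) by simp
  have 1: "open (len -` X)"
    by (intro open_vimage X continuous_on_rigidity_map_self)
  have 2: "\<rho> \<in> len -` X" using \<rho> X by simp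
  have "len \<rho> \<in> W" using \<rho> C.W by blast
  note dg = has_derivative_compose[OF has_derivative_rigidity_map_self C.has_derivative_g[OF this]]
  have gz: "g (len \<rho>) = z" using C.gf[OF z(1)] z(2) by simp
  have 3: "((\<lambda>\<sigma>. C.\<Phi> (g (len \<sigma>))) has_derivative (\<lambda>\<tau>. C.\<Phi>' z (C.g' (len \<rho>) (2 *\<^sub>R R \<rho> \<tau>)))) (at \<rho>)"
    using has_derivative_compose[OF dg C.has_derivative_\<Phi>] unfolding gz .
  have 4: "C.\<Phi> (g (len \<sigma>)) = projection_matrix (gauss_map (range len) (len \<sigma>))" if "\<sigma> \<in> len -` X" for \<sigma>
    using that X(2) by (intro C.projection_matrix_gauss_map[symmetric]) simp
  show ?thesis
    by (rule has_derivative_transform_within_open[OF 3 1 2 4])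
qed

text \<open>The implication from R_\<tau>(\<mu>) in \<open>T\<close> for all \<mu> back to
  \<open>?D\<close> \<tau> = 0 needs more than the identity \<Pi> R = R, which only shows that D
  kills \<open>T\<close>, so D \<Pi> = 0. Differentiating the symmetry of \<Pi> gives a symmetric D,
  hence \<Pi> D = 0. Differentiating \<Pi>^2 = \<Pi> gives D = \<Pi> D + D \<Pi> = 0.\<close>

lemma gauss_rank_generic:
  assumes gen: "generic \<rho>" and z: "z \<in> L" "f z = len \<rho>"
  shows "range (\<lambda>\<tau>. C.\<Phi>' z (C.g' (len \<rho>) (2 *\<^sub>R R \<rho> \<tau>))) = range (C.\<Phi>' z)"
    and "dim (range (C.\<Phi>' z)) = CARD('v) * CARD('d) - dim (infinitesimal_kernel a b \<rho>) * CARD('d)"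
proof -
  let ?D = "\<lambda>\<tau>. C.\<Phi>' z (C.g' (len \<rho>) (2 *\<^sub>R R \<rho> \<tau>))"
  let ?\<Theta> = "\<lambda>\<sigma>. projection_matrix (gauss_map (range len) (len \<sigma>))"
  have smooth: "smooth_point t (range len) (len \<rho>)"
    using C.smooth_point_chart[OF z(1)] z(2) by simp
  define T where "T = range (R \<rho>)"
  have tangent: "tangent_space (range len) (len \<rho>) = T"
    unfolding T_def by (rule tangent_space_generic[OF gen smooth])
  have T: "subspace T" unfolding T_def by (rule subspace_range_rigidity_map)
  have derD: "(?\<Theta> has_derivative ?D) (at \<rho>)"
    by (rule gauss_len_has_derivative[OF z])
  have linD: "linear ?D" using derD has_derivative_linear by blast
  have T2: "range (\<lambda>\<tau>. 2 *\<^sub>R R \<rho> \<tau>) = T"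
    unfolding T_def by (rule range_scaled_rigidity_map)
  \<comment> \<open>At a generic framework the derivative of \<ell> covers the whole tangent space,
    so composing with \<ell> loses no rank.\<close>
  have "range (C.\<Phi>' z) = (\<lambda>w. C.\<Phi>' z (C.g' (len \<rho>) w)) ` T"
    using C.gauss_map_derivative_image[OF z(1) C.gauss_map_has_derivative[OF z(1)]]
      tangent_space_openin[OF openin_smooth_points, of "len \<rho>"] smooth tangent z(2)
    by simp
  then show rangeD: "range ?D = range (C.\<Phi>' z)"
    unfolding T2[symmetric] by (simp add: image_image)
  obtain X where X: "open X" "U = range len \<inter> X"
    using C.U by (auto simp: openin_open)
  have \<rho>U: "len \<rho> \<in> U" using C.f_in_U[OF z(1)] z(2) by simp
  define N where "N = len -` X"
  have N: "open N" "\<rho> \<in> N"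
    unfolding N_def using \<rho>U X by (auto intro!: open_vimage continuous_on_rigidity_map_self)
  have smoothN: "smooth_point t (range len) (len \<sigma>)" if "\<sigma> \<in> N" for \<sigma>
  proof -
    have "len \<sigma> \<in> f ` L" using that X(2) by (simp add: N_def C.fL)
    then show ?thesis using C.smooth_point_chart by (elim imageE) simp
  qed
  have subN: "subspace (gauss_map (range len) (len \<sigma>))" if "\<sigma> \<in> N" for \<sigma>
    using dim_tangent_space_smooth_point(2)[OF smoothN[OF that]] by (simp add: gauss_map_def)
  have \<Theta>\<rho>: "?\<Theta> \<rho> *v y = closest_point T y" for y
    using projection_matrix_mult[OF T] tangent by (simp add: gauss_map_def)
  have D_image: "?D \<tau> *v R \<rho> \<mu> + closest_point T (R \<tau> \<mu>) = R \<tau> \<mu>" for \<tau> \<mu>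
  proof -
    have blR: "bounded_linear (\<lambda>\<sigma>. R \<sigma> \<mu>)"
      by (rule bounded_bilinear.bounded_linear_left[OF bounded_bilinear_rigidity_map])
    have "((\<lambda>\<sigma>. ?\<Theta> \<sigma> *v R \<sigma> \<mu>) has_derivative (\<lambda>\<tau>. ?\<Theta> \<rho> *v R \<tau> \<mu> + ?D \<tau> *v R \<rho> \<mu>)) (at \<rho>)"
      by (rule bounded_bilinear.FDERIV[OF bounded_bilinear_matrix_vector_mult derD
            bounded_linear_imp_has_derivative[OF blR]])
    moreover have "?\<Theta> \<sigma> *v R \<sigma> \<mu> = R \<sigma> \<mu>" if "\<sigma> \<in> N" for \<sigma>
      using range_rigidity_map_subset_tangent_space[of \<sigma>]
      by (simp only: projection_matrix_mult[OF subN[OF that]])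
        (intro closest_point_subspace_ident subN that, auto simp: gauss_map_def)
    ultimately have "(\<lambda>\<tau>. ?\<Theta> \<rho> *v R \<tau> \<mu> + ?D \<tau> *v R \<rho> \<mu>) = (\<lambda>\<tau>. R \<tau> \<mu>)"
      by (intro has_derivative_unique_on_open[OF _ bounded_linear_imp_has_derivative[OF blR] N])
    from fun_cong[OF this, of \<tau>] show ?thesis by (simp only: \<Theta>\<rho> add.commute)
  qed
  have D_idem: "?\<Theta> \<rho> ** ?D \<tau> + ?D \<tau> ** ?\<Theta> \<rho> = ?D \<tau>" for \<tau>
  proof -
    have "((\<lambda>\<sigma>. ?\<Theta> \<sigma> ** ?\<Theta> \<sigma>) has_derivative (\<lambda>\<tau>. ?\<Theta> \<rho> ** ?D \<tau> + ?D \<tau> ** ?\<Theta> \<rho>)) (at \<rho>)"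
      by (rule bounded_bilinear.FDERIV[OF bounded_bilinear_matrix_mult derD derD])
    moreover have "?\<Theta> \<sigma> ** ?\<Theta> \<sigma> = ?\<Theta> \<sigma>" if "\<sigma> \<in> N" for \<sigma>
      using closest_point_subspace_ident[OF subN[OF that] closest_point_subspace(1)[OF subN[OF that]]]
      by (simp add: matrix_eq projection_matrix_mult[OF subN[OF that]] flip: matrix_vector_mul_assoc)
    ultimately have "(\<lambda>\<tau>. ?\<Theta> \<rho> ** ?D \<tau> + ?D \<tau> ** ?\<Theta> \<rho>) = ?D"
      by (intro has_derivative_unique_on_open[OF _ derD N])
    from fun_cong[OF this, of \<tau>] show ?thesis .
  qed
  have D_sym: "transpose (?D \<tau>) = ?D \<tau>" for \<tau>
  proof -
    have "((\<lambda>\<sigma>. transpose (?\<Theta> \<sigma>)) has_derivative (\<lambda>\<tau>. transpose (?D \<tau>))) (at \<rho>)"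
      by (rule bounded_linear.has_derivative[OF bounded_linear_transpose derD])
    moreover have "transpose (?\<Theta> \<sigma>) = ?\<Theta> \<sigma>" if "\<sigma> \<in> N" for \<sigma>
      by (rule transpose_projection_matrix[OF subN[OF that]])
    ultimately have "(\<lambda>\<tau>. transpose (?D \<tau>)) = ?D"
      by (intro has_derivative_unique_on_open[OF _ derD N])
    from fun_cong[OF this, of \<tau>] show ?thesis .
  qed
  have D_eq_0: "?D \<tau> = 0 \<longleftrightarrow> (\<forall>\<mu>. R \<tau> \<mu> \<in> T)" for \<tau>
  proof
    assume "?D \<tau> = 0"
    then have "closest_point T (R \<tau> \<mu>) = R \<tau> \<mu>" for \<mu> using D_image[of \<tau> \<mu>] by simp
    then show "\<forall>\<mu>. R \<tau> \<mu> \<in> T" using closest_point_subspace(1)[OF T] by metis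
  next
    assume "\<forall>\<mu>. R \<tau> \<mu> \<in> T"
    then have "?D \<tau> *v R \<rho> \<mu> = 0" for \<mu>
      using D_image[of \<tau> \<mu>] closest_point_subspace_ident[OF T, of "R \<tau> \<mu>"] by simp
    then have "?D \<tau> *v y = 0" if "y \<in> T" for y using that by (auto simp: T_def)
    then have "(?D \<tau> ** ?\<Theta> \<rho>) *v y = 0 *v y" for y
      using closest_point_subspace(1)[OF T] by (simp add: \<Theta>\<rho> flip: matrix_vector_mul_assoc)
    then have 1: "?D \<tau> ** ?\<Theta> \<rho> = 0" by (simp only: matrix_eq) blast
    have "?\<Theta> \<rho> ** ?D \<tau> = transpose (?D \<tau> ** ?\<Theta> \<rho>)"
      by (simp add: matrix_transpose_mul D_sym transpose_projection_matrix[OF subN[OF N(2)]])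
    also have "\<dots> = 0" by (simp only: 1) (simp add: transpose_def vec_eq_iff)
    finally show "?D \<tau> = 0" using D_idem[of \<tau>] 1 by simp
  qed
  have "{\<tau> \<in> UNIV. ?D \<tau> = 0} = {\<tau>. \<forall>j. (\<chi> v. \<tau> $ v $ j) \<in> infinitesimal_kernel a b \<rho>}"
    unfolding D_eq_0 rigidity_map_in_subspace_iff[OF T] infinitesimal_kernel_def T_def[symmetric] by auto
  then have "dim {\<tau> \<in> UNIV. ?D \<tau> = 0} = CARD('d) * dim (infinitesimal_kernel a b \<rho>)"
    by (simp only: dim_columns[OF subspace_infinitesimal_kernel])
  then show "dim (range (C.\<Phi>' z)) = CARD('v) * CARD('d) - dim (infinitesimal_kernel a b \<rho>) * CARD('d)"
    using dim_image_kernel[OF linD subspace_UNIV] unfolding rangeD by (simp add: mult.commute)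
qed

text \<open>The values in the chart domain whose coordinates lie in \<open>V\<close> form a
  relatively open set. Its preimage under \<ell> is open and nonempty, so it contains a generic
  framework.\<close>

lemma ex_generic_chart_point:
  assumes "z0 \<in> L" "open V" "z0 \<in> V"
  obtains \<rho> z where "generic \<rho>" "z \<in> L" "z \<in> V" "f z = len \<rho>"
proof -
  obtain X where X: "open X" "U = range len \<inter> X"
    using C.U by (auto simp: openin_open)
  have "continuous_on W g"
    using C.g times_differentiable_on_imp_continuous_on[of 0 W g] unfolding smooth_map_on_def by blast
  then have "open (W \<inter> g -` V)" by (rule continuous_open_preimage[OF _ C.W(1) assms(2)])
  then have N: "open (len -` (X \<inter> (W \<inter> g -` V)))"
    by (rule open_vimage[OF open_Int[OF X(1)] continuous_on_rigidity_map_self])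
  have "f z0 \<in> U" by (rule C.f_in_U[OF assms(1)])
  then obtain \<rho>0 where "f z0 = len \<rho>0" "len \<rho>0 \<in> X" using X(2) by auto
  then have "\<rho>0 \<in> len -` (X \<inter> (W \<inter> g -` V))"
    using \<open>f z0 \<in> U\<close> C.W(2) C.gf[OF assms(1)] assms(3) by auto
  then have nonempty: "len -` (X \<inter> (W \<inter> g -` V)) \<noteq> {}" by blast
  obtain \<rho> where \<rho>: "generic \<rho>" "\<rho> \<in> len -` (X \<inter> (W \<inter> g -` V))"
    by (rule ex_generic[OF N nonempty])
  then have "len \<rho> \<in> U" using X(2) by blast
  then have "len \<rho> \<in> f ` L" by (simp only: C.fL)
  then obtain z where z: "z \<in> L" "f z = len \<rho>" by (elim imageE) simp
  then have "z \<in> V" using \<rho>(2) C.gf[OF z(1)] by simp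
  then show ?thesis using that[OF \<rho>(1) z(1)] z(2) by simp
qed

lemma gauss_rank_le:
  assumes k: "\<And>\<rho> :: ('v, 'd) framework. generic \<rho> \<Longrightarrow> dim (infinitesimal_kernel a b \<rho>) = k" and z: "z \<in> L"
  shows "dim (range (C.\<Phi>' z)) \<le> CARD('v) * CARD('d) - k * CARD('d)"
proof -
  have lin: "linear (C.\<Phi>' y)" for y
    using C.has_derivative_\<Phi> has_derivative_linear by blast
  obtain V where V: "open V" "z \<in> V"
    "\<And>y. y \<in> V \<Longrightarrow> dim (range (C.\<Phi>' z)) \<le> dim (range (C.\<Phi>' y))"
    by (rule rank_lower_semicontinuous[of "\<lambda>y. C.\<Phi>' y", OF lin C.continuous_\<Phi>' open_UNIV UNIV_I], rule that)
  obtain \<rho> y where \<rho>: "generic \<rho>" "y \<in> L" "y \<in> V" "f y = len \<rho>"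
    by (rule ex_generic_chart_point[OF z V(1,2)])
  show ?thesis
    using V(3)[OF \<rho>(3)] gauss_rank_generic(2)[OF \<rho>(1,2,4)] k[OF \<rho>(1)] by simp
qed

end

section \<open>The ranks of both maps\<close>

context rigid_graph
begin

lemma ex_chart:
  assumes "smooth_point t (range len) x"
  obtains U L W f g z where "rigid_graph_chart a b w0 w U L W f g" "z \<in> L" "f z = x"
proof -
  from assms obtain U L W f g where x: "x \<in> U" and chart: "smooth_chart t (range len) U L W f g"
    by (auto simp: smooth_point_iff_chart)
  obtain z where "z \<in> L" "f z = x" using smooth_chart.fL[OF chart] x by blast
  moreover have "rigid_graph_chart a b w0 w U L W f g"
    using chart rigid_graph_axioms by (simp add: rigid_graph_chart_def euclidean_smooth_chart_def)
  ultimately show ?thesis using that by blast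
qed

lemma ex_generic_smooth_point:
  obtains \<rho> where "generic \<rho>" "smooth_point t (range len) (len \<rho>)"
proof -
  obtain x where "smooth_point t (range len) x"
    using smooth_points_dense[of UNIV] by auto
  then obtain U L W f g z where "rigid_graph_chart a b w0 w U L W f g" "z \<in> L" "f z = x"
    by (rule ex_chart)
  interpret rigid_graph_chart a b w0 w U L W f g by fact
  obtain \<rho> y where \<rho>: "generic \<rho>" "y \<in> L" "f y = len \<rho>"
    by (rule ex_generic_chart_point[OF \<open>z \<in> L\<close> open_UNIV UNIV_I])
  then show ?thesis using that[OF \<rho>(1)] C.smooth_point_chart[OF \<rho>(2)] by simp
qed

lemma gauss_map_rank:
  assumes k: "\<And>\<rho> :: ('v, 'd) framework. generic \<rho> \<Longrightarrow> dim (infinitesimal_kernel a b \<rho>) = k"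
  shows "grassmannian_map_rank {x. smooth_point t (range len) x} (gauss_map (range len))
    = CARD('v) * CARD('d) - k * CARD('d)"
proof -
  let ?S = "{x. smooth_point t (range len) x}" and ?r = "CARD('v) * CARD('d) - k * CARD('d)"
  let ?A = "{dim (D ` tangent_space ?S x) | x D. x \<in> ?S \<and>
      ((\<lambda>y. projection_matrix (gauss_map (range len) y)) has_derivative D) (at x within ?S)}"
  have le: "m \<le> ?r" if m: "m \<in> ?A" for m
  proof -
    obtain x D where x: "x \<in> ?S" and D: "((\<lambda>y. projection_matrix (gauss_map (range len) y))
        has_derivative D) (at x within ?S)"
      and m: "m = dim (D ` tangent_space ?S x)" using m by blast
    from x have "smooth_point t (range len) x" by simp
    then obtain U L W f g z where chart: "rigid_graph_chart a b w0 w U L W f g" and z: "z \<in> L" "f z = x"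
      by (rule ex_chart)
    interpret rigid_graph_chart a b w0 w U L W f g by (rule chart)
    show ?thesis
      using C.gauss_map_derivative_image[OF z(1), of D] D gauss_rank_le[OF k z(1)] by (simp add: z(2) m)
  qed
  moreover have "?r \<in> ?A"
  proof -
    obtain \<rho> where \<rho>: "generic \<rho>" "smooth_point t (range len) (len \<rho>)" by (rule ex_generic_smooth_point)
    from \<rho>(2) obtain U L W f g z where chart: "rigid_graph_chart a b w0 w U L W f g" and z: "z \<in> L" "f z
        = len \<rho>"
      by (rule ex_chart)
    interpret rigid_graph_chart a b w0 w U L W f g by (rule chart)
    note D = C.gauss_map_has_derivative[OF z(1)]
    have "dim ((\<lambda>w. C.\<Phi>' z (C.g' (f z) w)) ` tangent_space ?S (f z)) = ?r"
      using C.gauss_map_derivative_image[OF z(1) D] gauss_rank_generic(2)[OF \<rho>(1) z] k[OF \<rho>(1)] by simp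
    note r = this
    show ?thesis
    proof (rule CollectI, rule exI[of _ "f z"], rule exI[of _ "\<lambda>w. C.\<Phi>' z (C.g' (f z) w)"], intro conjI)
      show "?r = dim ((\<lambda>w. C.\<Phi>' z (C.g' (f z) w)) ` tangent_space ?S (f z))" by (rule r[symmetric])
      show "f z \<in> ?S" using C.smooth_point_chart[OF z(1)] by simp
    qed (rule D)
  qed
  moreover have "finite ?A" by (rule finite_subset[of _ "{..?r}"]) (use le in auto)
  ultimately show ?thesis
    unfolding grassmannian_map_rank_def by (intro Max_eqI)
qed

lemma gauss_len_rank:
  assumes k: "\<And>\<rho> :: ('v, 'd) framework. generic \<rho> \<Longrightarrow> dim (infinitesimal_kernel a b \<rho>) = k"
  shows "grassmannian_map_rank {\<rho>. smooth_point t (range len) (len \<rho>)} (gauss_map (range len) \<circ> len)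
    = CARD('v) * CARD('d) - k * CARD('d)"
proof -
  let ?S = "{\<rho>. smooth_point t (range len) (len \<rho>)}" and ?r = "CARD('v) * CARD('d) - k * CARD('d)"
  let ?F = "\<lambda>\<rho>. projection_matrix ((gauss_map (range len) \<circ> len) \<rho>)"
  let ?A = "{dim (D ` tangent_space ?S x) | x D. x \<in> ?S \<and> (?F has_derivative D) (at x within ?S)}"
  obtain X where X: "open X" "{x. smooth_point t (range len) x} = range len \<inter> X"
    using openin_smooth_points[where t=t and M="range len"] by (auto simp: openin_open)
  have "?S = len -` X" using X(2) by blast
  then have openS: "open ?S"
    using X(1) by (simp only:) (intro open_vimage continuous_on_rigidity_map_self)
  have tangent: "tangent_space ?S \<rho> = UNIV" if \<rho>: "\<rho> \<in> ?S" for \<rho>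
  proof -
    have "\<tau> \<in> tangent_space ?S \<rho>" for \<tau>
    proof -
      let ?\<gamma> = "\<lambda>s::real. \<rho> + s *\<^sub>R \<tau>"
      have der: "(?\<gamma> has_vector_derivative \<tau>) (at 0)" by (auto intro!: derivative_eq_intros)
      have "?\<gamma> 0 \<in> ?S" using \<rho> by simp
      moreover have "(?\<gamma> \<longlongrightarrow> ?\<gamma> 0) (nhds 0)"
        using has_vector_derivative_continuous[OF der] tendsto_at_iff_tendsto_nhds[of ?\<gamma> 0]
        unfolding isCont_def by (rule rev_iffD1)
      ultimately have "\<forall>\<^sub>F s in nhds 0. ?\<gamma> s \<in> ?S"
        using topological_tendstoD[OF _ openS] by blast
      then show ?thesis
        unfolding tangent_space_def using der by (intro CollectI exI[of _ ?\<gamma>]) simp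
    qed
    then show ?thesis by blast
  qed
  have le: "m \<le> ?r" if m: "m \<in> ?A" for m
  proof -
    from m obtain \<rho> D where m: "m = dim (D ` tangent_space ?S \<rho>)" and \<rho>: "\<rho> \<in> ?S"
      and D: "(?F has_derivative D) (at \<rho> within ?S)" by (elim CollectE[of m] exE conjE)
    from \<rho> have "smooth_point t (range len) (len \<rho>)" by simp
    then obtain U L W f g z where chart: "rigid_graph_chart a b w0 w U L W f g" and z: "z \<in> L" "f z = len \<rho>"
      by (rule ex_chart)
    interpret rigid_graph_chart a b w0 w U L W f g by (rule chart)
    have "(?F has_derivative D) (at \<rho>)" using D unfolding at_within_open[OF \<rho> openS] .
    then have "D = (\<lambda>\<tau>. C.\<Phi>' z (C.g' (len \<rho>) (2 *\<^sub>R R \<rho> \<tau>)))"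
      unfolding o_def by (rule has_derivative_unique[OF _ gauss_len_has_derivative[OF z]])
    \<comment> \<open>At a nongeneric framework the derivative of \<ell> may miss tangent
      directions, so only an inclusion holds.\<close>
    then have "range D \<subseteq> range (C.\<Phi>' z)" by auto
    then have "dim (range D) \<le> dim (range (C.\<Phi>' z))" by (rule dim_subset)
    then show ?thesis using gauss_rank_le[OF k z(1)] by (simp add: m tangent[OF \<rho>])
  qed
  moreover have "?r \<in> ?A"
  proof -
    obtain \<rho> where \<rho>: "generic \<rho>" "smooth_point t (range len) (len \<rho>)" by (rule ex_generic_smooth_point)
    from \<rho>(2) obtain U L W f g z where chart: "rigid_graph_chart a b w0 w U L W f g" and z: "z \<in> L" "f z
        = len \<rho>"
      by (rule ex_chart)
    interpret rigid_graph_chart a b w0 w U L W f g by (rule chart)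
    let ?D = "\<lambda>\<tau>. C.\<Phi>' z (C.g' (len \<rho>) (2 *\<^sub>R R \<rho> \<tau>))"
    have S: "\<rho> \<in> ?S" using \<rho>(2) by simp
    have D: "(?F has_derivative ?D) (at \<rho> within ?S)"
      using has_derivative_at_withinI[OF gauss_len_has_derivative[OF z]] by (simp add: o_def)
    have r: "dim (?D ` tangent_space ?S \<rho>) = ?r"
      unfolding tangent[OF S] gauss_rank_generic(1)[OF \<rho>(1) z] gauss_rank_generic(2)[OF \<rho>(1) z] k[OF \<rho>(1)]
      by (rule refl)
    show ?thesis
      by (rule CollectI, intro exI[of _ \<rho>] exI[of _ ?D] conjI) (fact r[symmetric] S D)+
  qed
  moreover have "finite ?A" by (rule finite_subset[of _ "{..?r}"]) (use le in auto)
  ultimately show ?thesis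
    unfolding grassmannian_map_rank_def by (intro Max_eqI)
qed

end

theorem proposition4p6:
  fixes edge :: "'e::finite \<Rightarrow> 'v::finite set"
    and M :: "(real^'e) set"
    and t k\<^sub>s\<^sub>h :: nat
  assumes graph: "simple_graph edge"
    and vertices: "CARD('v) \<ge> CARD('d::finite) + 2"
    and rigid: "generically_locally_rigid edge TYPE('d)"
    and M_def: "M = range (length_map edge :: ('v, 'd) framework \<Rightarrow> real^'e)"
    and t_def: "t = CARD('v) * CARD('d) - ((CARD('d) + 1) choose 2)"
    and k_def: "k\<^sub>s\<^sub>h = shared_stress_nullity edge TYPE('d)"
  shows "semialgebraic_dim M = t
    \<and> grassmannian_map_rank {x. smooth_point t M x} (gauss_map M)
        = CARD('v) * CARD('d) - k\<^sub>s\<^sub>h * CARD('d)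
    \<and> grassmannian_map_rank
        {\<rho> :: ('v, 'd) framework. smooth_point t M (length_map edge \<rho>)}
        (gauss_map M \<circ> length_map edge)
        = CARD('v) * CARD('d) - k\<^sub>s\<^sub>h * CARD('d)"
proof -
  have inj: "inj edge" using graph by (simp add: simple_graph_def)
  have "\<forall>i. \<exists>u v. edge i = {u, v} \<and> u \<noteq> v"
    using graph by (auto simp: simple_graph_def card_2_iff)
  then obtain a b where edge: "\<And>i. edge i = {a i, b i}" "\<And>i. a i \<noteq> b i" by metis
  let ?len = "\<lambda>\<rho> :: ('v, 'd) framework. rigidity_map a b \<rho> \<rho>"
  have len: "length_map edge = ?len"
    by (simp add: fun_eq_iff vec_eq_iff length_map_edge[of edge, OF edge(1)] rigidity_map_self)
  \<comment> \<open>The bound on the number of vertices provides d + 1 distinct ones for the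
    slice.\<close>
  obtain w :: "'d \<Rightarrow> 'v" where w: "inj w"
    using card_le_inj[of "UNIV :: 'd set" "UNIV :: 'v set"] vertices by auto
  have "range w \<noteq> UNIV"
    using card_image[OF w] vertices by auto
  then obtain w0 where w0: "w0 \<notin> range w" by blast
  interpret rigid_graph a b w0 w
  proof
    fix \<rho> :: "('v, 'd) framework" assume "generic \<rho>"
    then have "locally_rigid edge \<rho>" using rigid by (simp add: generically_locally_rigid_def)
    from this[unfolded locally_rigid_def len] obtain N where N: "open N" "\<rho> \<in> N"
      and cong: "\<forall>\<sigma>\<in>N. ?len \<sigma> = ?len \<rho> \<longrightarrow> congruent_frameworks \<rho> \<sigma>"
      by (elim exE conjE)
    have norm: "norm (\<sigma> $ u - \<sigma> $ u') = norm (\<rho> $ u - \<rho> $ u')" if congruent: "congruent_frameworks \<rho> \<sigma>" for \<sigma> u u'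
    proof -
      from congruent[unfolded congruent_frameworks_def] obtain h :: "real^'d \<Rightarrow> real^'d"
        where h: "\<forall>x y. dist (h x) (h y) = dist x y" "\<forall>u. \<sigma> $ u = h (\<rho> $ u)"
        by (elim exE conjE)
      show ?thesis
        unfolding dist_norm[symmetric] h(2)[rule_format] by (rule h(1)[rule_format])
    qed
    show "\<exists>N. open N \<and> \<rho> \<in> N \<and> (\<forall>\<sigma>\<in>N. ?len \<sigma> = ?len \<rho> \<longrightarrow>
        (\<forall>u u'. norm (\<sigma> $ u - \<sigma> $ u') = norm (\<rho> $ u - \<rho> $ u')))"
      by (intro exI[of _ N] conjI ballI impI allI N norm cong[rule_format])
  qed (fact w w0)+
  obtain \<rho>0 :: "('v, 'd) framework" where \<rho>0: "generic \<rho>0"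
    using ex_generic[of UNIV] by auto
  note kernel = shared_stress_kernel_eq_infinitesimal_kernel[OF edge inj]
  have dims: "dim (shared_stress_kernel edge \<rho>) = dim (infinitesimal_kernel a b \<rho>0)"
    if "generic \<rho>" for \<rho> :: "('v, 'd) framework"
    using dim_infinitesimal_kernel_generic[OF that \<rho>0] kernel by metis
  \<comment> \<open>The description by \<open>THE\<close> is unique because a generic framework
    exists.\<close>
  have "k\<^sub>s\<^sub>h = dim (infinitesimal_kernel a b \<rho>0)"
    unfolding k_def shared_stress_nullity_def
    by (rule the_equality) (use dims \<rho>0 in metis)+
  then have k: "dim (infinitesimal_kernel a b \<rho>) = k\<^sub>s\<^sub>h" if "generic \<rho>" for \<rho> :: "('v, 'd) framework"
    using dims[OF that] kernel by metis
  have t: "t = dim P" by (simp only: t_def dim_congruence_slice[OF w])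
  show ?thesis
    unfolding M_def len t
    using semialgebraic_dim_measurement_set gauss_map_rank[OF k] gauss_len_rank[OF k] by blast
qed

end
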